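(* Let $X\subseteq\mathbb{P}^n$ be a projective hypersurface of degree $d$, not a hyperplane, admitting an induced additive action, let $(A,U)$ be the corresponding $H$-pair with maximal ideal $\mathfrak{m}$, and identify $\mathbb{P}^n$ with $\mathbb{P}(A)$ so that $X$ is given by $$f(z_0,z_1,\ldots,z_n)=z_0^d\,\pi\left(\ln\Bigl(1+\frac{z}{z_0}\Bigr)\right)=0,$$ where $z_1,\ldots,z_n$ are linear coordinates of $z\in\mathfrak{m}$. Write $$f(z_0,\ldots,z_n)=\sum_{k=1}^d z_0^{d-k}f_k(z_1,\ldots,z_n),$$ where $f_k$ is a homogeneous polynomial of degree $k$. Let $f_d=p_1^{a_1}\cdots p_s^{a_s}$, where the $p_i$ are pairwise distinct (non-associate) irreducible polynomials and $a_i\in\mathbb{Z}_{>0}$, and let $\widetilde{f_d}=f_d/(p_1\cdots p_s)$. Then the hypersurface $X$ is normal if and only if the polynomials $\widetilde{f_d}$ and $f_{d-1}$ are coprime.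
   Context: The base field $\mathbb{K}$ is algebraically closed of characteristic zero; all varieties are over $\mathbb{K}$; $\mathbb{G}_a^m=(\mathbb{K}^m,+)$. An additive action on an (irreducible) variety $X$ is an effective regular action of $\mathbb{G}_a^m$ on $X$ with an open orbit. An additive action $\mathbb{G}_a^{n-1}\times X\to X$ on a projective hypersurface $X\subseteq\mathbb{P}^n$ is called induced if it extends to a regular action of $\mathbb{G}_a^{n-1}$ on $\mathbb{P}^n$. All algebras are commutative, associative and unital. An $H$-pair is a pair $(A,U)$, where $A$ is a local finite-dimensional $\mathbb{K}$-algebra with maximal ideal $\mathfrak{m}$ (so $A=\mathbb{K}\oplus\mathfrak{m}$) and $U\subseteq\mathfrak{m}$ is a hyperplane generating $A$ as a unital algebra. It is known (generalized Hassett–Tschinkel correspondence) that induced additive actions on hypersurfaces in $\mathbb{P}^n$ other than hyperplanes correspond bijectively, up to equivalence, to $H$-pairs $(A,U)$ with $\dim A=n+1$: identifying $\mathbb{P}^n$ with $\mathbb{P}(A)$ by a suitable linear isomorphism and denoting by $p\colon A\setminus\{0\}\to\mathbb{P}(A)$ the canonical projection, $X=p(\overline{\mathbb{K}^\times\exp U})$ (Zariski closure in $A\setminus\{0\}$), and $\mathbb{G}_a^{n-1}\cong\exp U$ acts by multiplication. Let $\pi\colon\mathfrak{m}\to\mathfrak{m}/U\cong\mathbb{K}$ be the canonical projection, and let $d$ be the greatest positive integer with $\mathfrak{m}^d\nsubseteq U$. Then it is known that $X$ is irreducible of degree $d\ge 2$ and is given by $z_0^d\pi(\ln(1+z/z_0))=0$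 for $z_0+z\in A=\mathbb{K}\oplus\mathfrak{m}$, $z_0\in\mathbb{K}$, $z\in\mathfrak{m}$; the open orbit of the action is the set of points of $X$ with $z_0\ne0$. *)

theory Defs
  imports
    Complex_Main
    "HOL-Library.Poly_Mapping"
    "HOL-Computational_Algebra.Computational_Algebra"
begin

section \<open>Multivariate polynomials\<close>

text \<open>
  Polynomials over \<open>'k\<close> in variables indexed by \<open>'v\<close>. The ring \<open>K[z\<^sub>i | i \<in> I]\<close> is the set of
  polynomials \<open>p\<close> with \<open>mvars p \<subseteq> I\<close>. A divisor of a nonzero element of this subring lies in the
  subring, so divisibility, irreducibility and coprimality of such polynomials mean the same in
  the subring as in the whole type.
\<close>

type_synonym ('v, 'k) mpoly = "('v \<Rightarrow>\<^sub>0 nat) \<Rightarrow>\<^sub>0 'k"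

definition mvars :: "('v, 'k::zero) mpoly \<Rightarrow> 'v set" where
  "mvars p = (\<Union>m\<in>Poly_Mapping.keys p. Poly_Mapping.keys m)"

definition meval :: "('v \<Rightarrow> 'k) \<Rightarrow> ('v, 'k::comm_semiring_1) mpoly \<Rightarrow> 'k" where
  "meval x p =
     (\<Sum>m\<in>Poly_Mapping.keys p. Poly_Mapping.lookup p m *
        (\<Prod>v\<in>Poly_Mapping.keys m. x v ^ Poly_Mapping.lookup m v))"

definition mvar :: "'v \<Rightarrow> ('v, 'k::comm_semiring_1) mpoly" where
  "mvar v = Poly_Mapping.single (Poly_Mapping.single v 1) 1"

definition homogeneous_in :: "'v set \<Rightarrow> nat \<Rightarrow> ('v, 'k::zero) mpoly \<Rightarrow> bool" where
  "homogeneous_in V e p \<longleftrightarrow>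
     (\<forall>m\<in>Poly_Mapping.keys p. (\<Sum>v\<in>Poly_Mapping.keys m \<inter> V. Poly_Mapping.lookup m v) = e)"

abbreviation homogeneous :: "nat \<Rightarrow> ('v, 'k::zero) mpoly \<Rightarrow> bool" where
  "homogeneous \<equiv> homogeneous_in UNIV"

text \<open>
  The definition of \<^const>\<open>coprime\<close>, which the library restricts to the class
  \<^class>\<open>algebraic_semidom\<close>; polynomials are not an instance of it, for want of a division.
\<close>

definition mcoprime :: "('v, 'k::comm_semiring_1) mpoly \<Rightarrow> ('v, 'k) mpoly \<Rightarrow> bool" where
  "mcoprime p q \<longleftrightarrow> (\<forall>c. c dvd p \<longrightarrow> c dvd q \<longrightarrow> c dvd 1)"

section \<open>Projective space\<close>

text \<open>
  The vector space with coordinates indexed by \<open>I\<close>; thus \<open>vecs {..n}\<close> is \<open>K\<^sup>n\<^sup>+\<^sup>1\<close> and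
  \<open>vecs {..<m}\<close> is \<open>K\<^sup>m\<close>.
\<close>

definition vecs :: "'v set \<Rightarrow> ('v \<Rightarrow> 'k::zero) set" where
  "vecs I = {v. \<forall>i. i \<notin> I \<longrightarrow> v i = 0}"

definition nzvecs :: "nat \<Rightarrow> (nat \<Rightarrow> 'k::zero) set" where
  "nzvecs n = vecs {..n} - {\<lambda>_. 0}"

text \<open>The point with given homogeneous coordinates, as an orbit of the multiplicative group.\<close>

type_synonym 'k point = "(nat \<Rightarrow> 'k) set"

definition pt :: "(nat \<Rightarrow> 'k::field) \<Rightarrow> 'k point" where
  "pt v = {\<lambda>i. c * v i | c. c \<noteq> 0}"

definition proj_space :: "nat \<Rightarrow> 'k::field point set" where
  "proj_space n = pt ` nzvecs n"

definition hom_polys :: "nat \<Rightarrow> (nat, 'k::zero) mpoly set" where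
  "hom_polys n = {p. mvars p \<subseteq> {..n} \<and> (\<exists>e. homogeneous e p)}"

definition proj_zeros :: "nat \<Rightarrow> (nat, 'k::field) mpoly set \<Rightarrow> 'k point set" where
  "proj_zeros n P = pt ` {v \<in> nzvecs n. \<forall>p\<in>P. meval v p = 0}"

definition zariski_open :: "nat \<Rightarrow> 'k::field point set \<Rightarrow> 'k point set \<Rightarrow> bool" where
  "zariski_open n X W \<longleftrightarrow> (\<exists>P \<subseteq> hom_polys n. W = X - proj_zeros n P)"

text \<open>Irreducible hypersurfaces of degree \<open>d\<close>.\<close>

definition hypersurface :: "nat \<Rightarrow> nat \<Rightarrow> 'k::field point set \<Rightarrow> bool" where
  "hypersurface n d X \<longleftrightarrow>
     (\<exists>F. mvars F \<subseteq> {..n} \<and> homogeneous d F \<and> irreducible F \<and> X = proj_zeros n {F})"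

definition hyperplane :: "nat \<Rightarrow> 'k::field point set \<Rightarrow> bool" where
  "hyperplane n X \<longleftrightarrow> hypersurface n 1 X"

section \<open>Normality\<close>

text \<open>
  A function is regular at a point of \<open>X\<close> if on a neighbourhood of this point in \<open>X\<close> it is a
  quotient of homogeneous polynomials of equal degree. Germs are represented by functions defined
  on all points, of which only the values near the point matter.
\<close>

definition regular_at :: "nat \<Rightarrow> 'k::field point set \<Rightarrow> 'k point \<Rightarrow> ('k point \<Rightarrow> 'k) \<Rightarrow> bool" where
  "regular_at n X x h \<longleftrightarrow>
     (\<exists>W G H e. zariski_open n X W \<and> x \<in> W \<and>
        mvars G \<subseteq> {..n} \<and> mvars H \<subseteq> {..n} \<and> homogeneous e G \<and> homogeneous e H \<and>
        (\<forall>v \<in> nzvecs n. pt v \<in> W \<longrightarrow> meval v H \<noteq> 0 \<and> h (pt v) = meval v G / meval v H))"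

text \<open>
  For irreducible \<open>X\<close>, the function field \<open>K(X)\<close> consists of the functions that are regular on a
  nonempty open subset, modulo equality on a nonempty open subset. The local ring of \<open>X\<close> at \<open>x\<close> is
  the subring of the classes of functions regular at \<open>x\<close>, and its field of fractions is \<open>K(X)\<close>.
\<close>

definition rational_fun :: "nat \<Rightarrow> 'k::field point set \<Rightarrow> ('k point \<Rightarrow> 'k) \<Rightarrow> bool" where
  "rational_fun n X h \<longleftrightarrow> (\<exists>W. zariski_open n X W \<and> W \<noteq> {} \<and> (\<forall>x\<in>W. regular_at n X x h))"

definition rational_eq ::
    "nat \<Rightarrow> 'k::field point set \<Rightarrow> ('k point \<Rightarrow> 'k) \<Rightarrow> ('k point \<Rightarrow> 'k) \<Rightarrow> bool" where
  "rational_eq n X h g \<longleftrightarrow> (\<exists>W. zariski_open n X W \<and> W \<noteq> {} \<and> (\<forall>x\<in>W. h x = g x))"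

definition in_local_ring ::
    "nat \<Rightarrow> 'k::field point set \<Rightarrow> 'k point \<Rightarrow> ('k point \<Rightarrow> 'k) \<Rightarrow> bool" where
  "in_local_ring n X x h \<longleftrightarrow> (\<exists>g. regular_at n X x g \<and> rational_eq n X h g)"

definition integral_over_local_ring ::
    "nat \<Rightarrow> 'k::field point set \<Rightarrow> 'k point \<Rightarrow> ('k point \<Rightarrow> 'k) \<Rightarrow> bool" where
  "integral_over_local_ring n X x h \<longleftrightarrow>
     (\<exists>r c. (\<forall>i<r. regular_at n X x (c i)) \<and>
        rational_eq n X (\<lambda>y. h y ^ r + (\<Sum>i<r. c i y * h y ^ i)) (\<lambda>_. 0))"

text \<open>For irreducible \<open>X\<close>: all local rings are integrally closed in their field of fractions.\<close>

definition normal_variety :: "nat \<Rightarrow> 'k::field point set \<Rightarrow> bool" where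
  "normal_variety n X \<longleftrightarrow>
     (\<forall>x\<in>X. \<forall>h. rational_fun n X h \<and> integral_over_local_ring n X x h \<longrightarrow> in_local_ring n X x h)"

section \<open>Additive actions\<close>

text \<open>
  Morphisms from \<open>K\<^sup>m \<times> Y\<close> to projective space. Near each point such a map is given by \<open>n + 1\<close>
  polynomials without common zero, homogeneous of equal degree in the homogeneous coordinates on
  \<open>Y\<close>. The coordinates on \<open>K\<^sup>m\<close> are the variables \<open>Inl j\<close>, those on \<open>Y\<close> the variables \<open>Inr i\<close>.
\<close>

definition regular_map ::
    "nat \<Rightarrow> nat \<Rightarrow> 'k::field point set \<Rightarrow> ((nat \<Rightarrow> 'k) \<Rightarrow> 'k point \<Rightarrow> 'k point) \<Rightarrow> bool" where
  "regular_map n m Y \<alpha> \<longleftrightarrow>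
     (\<forall>s \<in> vecs {..<m}. \<forall>u \<in> nzvecs n. pt u \<in> Y \<longrightarrow>
        (\<exists>(F :: nat \<Rightarrow> (nat + nat, 'k) mpoly) e.
           (\<forall>i\<le>n. mvars (F i) \<subseteq> Inl ` {..<m} \<union> Inr ` {..n} \<and> homogeneous_in (range Inr) e (F i)) \<and>
           (\<exists>i\<le>n. meval (case_sum s u) (F i) \<noteq> 0) \<and>
           (\<forall>t \<in> vecs {..<m}. \<forall>v \<in> nzvecs n. pt v \<in> Y \<longrightarrow>
              (\<exists>i\<le>n. meval (case_sum t v) (F i) \<noteq> 0) \<longrightarrow>
              \<alpha> t (pt v) = pt (\<lambda>i. if i \<le> n then meval (case_sum t v) (F i) else 0))))"

definition regular_action ::
    "nat \<Rightarrow> nat \<Rightarrow> 'k::field point set \<Rightarrow> ((nat \<Rightarrow> 'k) \<Rightarrow> 'k point \<Rightarrow> 'k point) \<Rightarrow> bool" where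
  "regular_action n m Y \<alpha> \<longleftrightarrow>
     (\<forall>t \<in> vecs {..<m}. \<forall>x\<in>Y. \<alpha> t x \<in> Y) \<and>
     (\<forall>x\<in>Y. \<alpha> (\<lambda>_. 0) x = x) \<and>
     (\<forall>s \<in> vecs {..<m}. \<forall>t \<in> vecs {..<m}. \<forall>x\<in>Y. \<alpha> (\<lambda>i. s i + t i) x = \<alpha> s (\<alpha> t x)) \<and>
     regular_map n m Y \<alpha>"

definition additive_action ::
    "nat \<Rightarrow> nat \<Rightarrow> 'k::field point set \<Rightarrow> ((nat \<Rightarrow> 'k) \<Rightarrow> 'k point \<Rightarrow> 'k point) \<Rightarrow> bool" where
  "additive_action n m X \<alpha> \<longleftrightarrow>
     regular_action n m X \<alpha> \<and>
     (\<forall>t \<in> vecs {..<m}. (\<forall>x\<in>X. \<alpha> t x = x) \<longrightarrow> t = (\<lambda>_. 0)) \<and>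
     (\<exists>x\<in>X. zariski_open n X ((\<lambda>t. \<alpha> t x) ` vecs {..<m}))"

definition induced_additive_action ::
    "nat \<Rightarrow> 'k::field point set \<Rightarrow> ((nat \<Rightarrow> 'k) \<Rightarrow> 'k point \<Rightarrow> 'k point) \<Rightarrow> bool" where
  "induced_additive_action n X \<alpha> \<longleftrightarrow>
     additive_action n (n - 1) X \<alpha> \<and>
     (\<exists>\<beta>. regular_action n (n - 1) (proj_space n) \<beta> \<and>
          (\<forall>t \<in> vecs {..<n - 1}. \<forall>x\<in>X. \<beta> t x = \<alpha> t x))"

section \<open>H-pairs\<close>

definition is_ideal :: "'a::comm_ring_1 set \<Rightarrow> bool" where
  "is_ideal I \<longleftrightarrow> 0 \<in> I \<and> (\<forall>x\<in>I. \<forall>y\<in>I. x + y \<in> I) \<and> (\<forall>a. \<forall>x\<in>I. a * x \<in> I)"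

definition is_maximal_ideal :: "'a::comm_ring_1 set \<Rightarrow> bool" where
  "is_maximal_ideal I \<longleftrightarrow>
     is_ideal I \<and> I \<noteq> UNIV \<and> (\<forall>J. is_ideal J \<and> I \<subseteq> J \<longrightarrow> J = I \<or> J = UNIV)"

locale comm_algebra = vector_space scale
  for scale :: "'k::field \<Rightarrow> 'a::comm_ring_1 \<Rightarrow> 'a" +
  assumes scale_mult: "scale c x * y = scale c (x * y)"
begin

definition subalgebra :: "'a set \<Rightarrow> bool" where
  "subalgebra S \<longleftrightarrow> subspace S \<and> 1 \<in> S \<and> (\<forall>x\<in>S. \<forall>y\<in>S. x * y \<in> S)"

end

locale H_pair = comm_algebra scale
  for scale :: "'k::field \<Rightarrow> 'a::comm_ring_1 \<Rightarrow> 'a" +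
  fixes M U :: "'a set"
  assumes finite_dimensional: "\<exists>B. finite B \<and> span B = UNIV"
    and maximal: "is_maximal_ideal M"
    and local: "\<And>J. is_maximal_ideal J \<Longrightarrow> J = M"
    and subspace_U: "subspace U"
    and U_subset: "U \<subseteq> M"
    and codim_U: "dim M = dim U + 1"
    and generates: "subalgebra hull U = UNIV"

text \<open>
  Exponential and logarithm of nilpotent elements; the index sets consist of the nonvanishing terms
  of the power series and are finite in this case.
\<close>

definition nil_exp :: "('k::field_char_0 \<Rightarrow> 'a::comm_ring_1 \<Rightarrow> 'a) \<Rightarrow> 'a \<Rightarrow> 'a" where
  "nil_exp scale u = (\<Sum>k | u ^ k \<noteq> 0. scale (1 / fact k) (u ^ k))"

text \<open>\<open>nil_ln1p scale z\<close> is \<open>ln (1 + z)\<close>.\<close>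

definition nil_ln1p :: "('k::field_char_0 \<Rightarrow> 'a::comm_ring_1 \<Rightarrow> 'a) \<Rightarrow> 'a \<Rightarrow> 'a" where
  "nil_ln1p scale z = (\<Sum>k | 0 < k \<and> z ^ k \<noteq> 0. scale ((- 1) ^ (k - 1) / of_nat k) (z ^ k))"

text \<open>The projection \<open>M \<rightarrow> M/U\<close> followed by an isomorphism of \<open>M/U\<close> with the base field.\<close>

definition quotient_projection ::
    "('k::field \<Rightarrow> 'a::comm_ring_1 \<Rightarrow> 'a) \<Rightarrow> 'a set \<Rightarrow> 'a set \<Rightarrow> ('a \<Rightarrow> 'k) \<Rightarrow> bool" where
  "quotient_projection scale M U \<pi> \<longleftrightarrow>
     (\<forall>x\<in>M. \<forall>y\<in>M. \<pi> (x + y) = \<pi> x + \<pi> y) \<and>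
     (\<forall>c. \<forall>x\<in>M. \<pi> (scale c x) = c * \<pi> x) \<and>
     \<pi> ` M = UNIV \<and> {x\<in>M. \<pi> x = 0} = U"

definition indexed_basis ::
    "('k::field \<Rightarrow> 'a::comm_ring_1 \<Rightarrow> 'a) \<Rightarrow> nat set \<Rightarrow> (nat \<Rightarrow> 'a) \<Rightarrow> 'a set \<Rightarrow> bool" where
  "indexed_basis scale I e V \<longleftrightarrow>
     inj_on e I \<and> \<not> module.dependent scale (e ` I) \<and> module.span scale (e ` I) = V"

text \<open>The element \<open>z\<close> of \<open>M\<close> with coordinates \<open>z\<^sub>1, \<dots>, z\<^sub>n\<close>, and the element \<open>z\<^sub>0 + z\<close>.\<close>

definition m_part :: "('k::field \<Rightarrow> 'a::comm_ring_1 \<Rightarrow> 'a) \<Rightarrow> nat \<Rightarrow> (nat \<Rightarrow> 'a) \<Rightarrow> (nat \<Rightarrow> 'k) \<Rightarrow> 'a" where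
  "m_part scale n e v = (\<Sum>i\<in>{1..n}. scale (v i) (e i))"

definition element :: "('k::field \<Rightarrow> 'a::comm_ring_1 \<Rightarrow> 'a) \<Rightarrow> nat \<Rightarrow> (nat \<Rightarrow> 'a) \<Rightarrow> (nat \<Rightarrow> 'k) \<Rightarrow> 'a" where
  "element scale n e v = scale (v 0) 1 + m_part scale n e v"

definition punctured_closure :: "nat \<Rightarrow> (nat \<Rightarrow> 'k::field) set \<Rightarrow> (nat \<Rightarrow> 'k) set" where
  "punctured_closure n S =
     {v \<in> nzvecs n. \<forall>q. mvars q \<subseteq> {..n} \<and> (\<forall>w\<in>S. meval w q = 0) \<longrightarrow> meval v q = 0}"

text \<open>
  \<open>X\<close> with the action \<open>\<alpha>\<close> of \<open>K\<^sup>n\<^sup>-\<^sup>1\<close> corresponds to the H-pair with hyperplane \<open>U\<close>, where \<open>P\<^sup>n\<close> is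
  identified with the projectivization of the algebra by means of \<open>element scale n e\<close>: \<open>X\<close> is the
  image of the closure of \<open>K\<^sup>\<times> exp U\<close>, and \<open>\<alpha>\<close> is multiplication by elements of \<open>exp U\<close> for some
  linear isomorphism \<open>\<tau>\<close> of \<open>K\<^sup>n\<^sup>-\<^sup>1\<close> with \<open>U\<close>.
\<close>

definition corresponds_to_H_pair ::
    "('k::field_char_0 \<Rightarrow> 'a::comm_ring_1 \<Rightarrow> 'a) \<Rightarrow> 'a set \<Rightarrow> nat \<Rightarrow> (nat \<Rightarrow> 'a) \<Rightarrow>
     'k point set \<Rightarrow> ((nat \<Rightarrow> 'k) \<Rightarrow> 'k point \<Rightarrow> 'k point) \<Rightarrow> bool" where
  "corresponds_to_H_pair scale U n e X \<alpha> \<longleftrightarrow>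
     X = pt ` punctured_closure n
           {v \<in> vecs {..n}. \<exists>c u. c \<noteq> 0 \<and> u \<in> U \<and> element scale n e v = scale c (nil_exp scale u)} \<and>
     (\<exists>\<tau>. bij_betw \<tau> (vecs {..<n - 1}) U \<and>
        (\<forall>s \<in> vecs {..<n - 1}. \<forall>t \<in> vecs {..<n - 1}. \<tau> (\<lambda>i. s i + t i) = \<tau> s + \<tau> t) \<and>
        (\<forall>c. \<forall>t \<in> vecs {..<n - 1}. \<tau> (\<lambda>i. c * t i) = scale c (\<tau> t)) \<and>
        (\<forall>t \<in> vecs {..<n - 1}. \<forall>v \<in> nzvecs n. \<forall>w \<in> nzvecs n.
           pt v \<in> X \<and> element scale n e w = nil_exp scale (\<tau> t) * element scale n e v \<longrightarrow>
           \<alpha> t (pt v) = pt w))"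

end

theory Submission
  imports Defs
begin

text \<open>
  In the logarithmic coordinates \<open>w = ln (1 + z/z\<^sub>0)\<close> the part \<open>z\<^sub>0 \<noteq> 0\<close> of \<open>X\<close> is the hyperplane
  \<open>\<pi> w = 0\<close>. Hence restriction to the cone \<open>K\<^sup>\<times> exp U\<close> is, up to powers of \<open>z\<^sub>0\<close>, a map onto a
  polynomial ring with kernel generated by \<open>f\<close>; so \<open>f\<close> is prime, \<open>X\<close> is normal where \<open>z\<^sub>0 \<noteq> 0\<close>, and an
  integral rational function can only have a power of \<open>z\<^sub>0\<close> as a denominator. Write
  \<open>f = f\<^sub>d + z\<^sub>0 f\<^sub>d\<^sub>-\<^sub>1 + z\<^sub>0\<^sup>2 A\<close>. If no prime \<open>p\<close> with \<open>p\<^sup>2\<close> dividing \<open>f\<^sub>d\<close> divides \<open>f\<^sub>d\<^sub>-\<^sub>1\<close>, then \<open>X\<close> is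
  regular at the generic points of \<open>z\<^sub>0 = f\<^sub>d = 0\<close>, and unique factorization allows removing the powers of
  \<open>z\<^sub>0\<close> one by one. If conversely \<open>f\<^sub>d = q\<^sup>2 r\<close> and \<open>f\<^sub>d\<^sub>-\<^sub>1 = q w\<close> with \<open>q\<close> irreducible, then
  \<open>y = A z\<^sub>0 / q\<close> satisfies \<open>y\<^sup>2 + w y + A r = 0\<close>, but is not regular at a point with
  \<open>z\<^sub>0 = q = 0\<close>.
\<close>

section \<open>Polynomial substitution\<close>

text \<open>The function field is never constructed. A rational function is a pair
  \<open>G0\<close>, \<open>H0\<close> with \<open>f\<close> not dividing \<open>H0\<close>;
  integrality at \<open>v\<close> means that \<open>f\<close> divides the sum of the
  \<open>C i * G0 ^ i * H0 ^ (r - i)\<close>, with \<open>C r\<close> nonzero at \<open>v\<close>;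
  regularity at \<open>v\<close> means \<open>f dvd T * G0 - H0 * G\<close> with \<open>T\<close>
  nonzero at \<open>v\<close>. This translation rests on primality of \<open>f\<close> and on a
  Nullstellensatz for \<open>f\<close>. Both come from the parametrization of the orbit, since
  \<open>f\<close> is at the outset known only through its values where z_0 is nonzero and through
  its zero set. The irreducible equation of \<open>X\<close> enters to exclude the factor z_0 and
  degree 1. The witness y arises by dividing f = 0 by q^2: this is the quadratic equation A
  (z_0/q)^2 + w (z_0/q) + r = 0, and multiplying its root z_0/q by the leading coefficient A gives a
  root of a monic equation.\<close>

locale rhom =
  fixes h :: "'a::comm_ring_1 \<Rightarrow> 'b::comm_ring_1"
  assumes add: "h (x + y) = h x + h y"
    and mult: "h (x * y) = h x * h y"
    and one: "h 1 = 1"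
begin

lemma zero: "h 0 = 0"
  using add[of 0 0] by simp

lemma uminus: "h (- x) = - h x"
  using add[of x "- x"] by (simp add: zero add_eq_0_iff)

lemma diff: "h (x - y) = h x - h y"
  using add[of x "- y"] by (simp add: uminus)

lemma sum: "h (sum f S) = (\<Sum>i\<in>S. h (f i))"
  by (induction S rule: infinite_finite_induct) (simp_all add: add zero)

lemma prod: "h (prod f S) = (\<Prod>i\<in>S. h (f i))"
  by (induction S rule: infinite_finite_induct) (simp_all add: mult one)

lemma power: "h (x ^ n) = h x ^ n"
  by (induction n) (simp_all add: mult one)

lemma dvd: "x dvd y \<Longrightarrow> h x dvd h y"
  by (auto simp: mult elim!: dvdE)

lemmas hom_simps = add mult one zero uminus diff sum prod power

end

lemma rhom_id: "rhom (\<lambda>x. x)"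
  by unfold_locales auto

lemma rhom_comp: "rhom f \<Longrightarrow> rhom g \<Longrightarrow> rhom (\<lambda>x. f (g x))"
  by (auto simp: rhom_def)

lemma rhom_poly: "rhom (\<lambda>p. poly p a)"
  by unfold_locales auto

lemma rhom_pCons: "rhom f \<Longrightarrow> rhom (\<lambda>x. [:f x:])"
  by (auto simp: rhom_def one_pCons)

section \<open>Ring homomorphisms out of a polynomial ring\<close>

definition mconst :: "'k::zero \<Rightarrow> ('v, 'k) mpoly" where
  "mconst c = Poly_Mapping.single 0 c"

lemma rhom_mconst: "rhom (mconst :: 'k::comm_ring_1 \<Rightarrow> ('v, 'k) mpoly)"
  by unfold_locales (simp_all add: mconst_def single_add mult_single)

definition monom_val :: "('v \<Rightarrow> 'r::comm_monoid_mult) \<Rightarrow> ('v \<Rightarrow>\<^sub>0 nat) \<Rightarrow> 'r" where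
  "monom_val \<sigma> m = (\<Prod>v\<in>Poly_Mapping.keys m. \<sigma> v ^ Poly_Mapping.lookup m v)"

lemma monom_val_superset:
  assumes "finite S" "Poly_Mapping.keys m \<subseteq> S"
  shows "monom_val \<sigma> m = (\<Prod>v\<in>S. \<sigma> v ^ Poly_Mapping.lookup m v)"
  unfolding monom_val_def
  by (rule prod.mono_neutral_left) (use assms in \<open>auto simp: in_keys_iff\<close>)

lemma monom_val_add: "monom_val \<sigma> (m + m') = monom_val \<sigma> m * monom_val \<sigma> m'"
proof -
  let ?S = "Poly_Mapping.keys m \<union> Poly_Mapping.keys m'"
  have "Poly_Mapping.keys (m + m') \<subseteq> ?S" by (rule keys_add)
  then show ?thesis
    by (simp add: monom_val_superset[of ?S] lookup_add power_add prod.distrib)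
qed

lemma monom_val_zero [simp]: "monom_val \<sigma> 0 = 1"
  by (simp add: monom_val_def)

text \<open>One construction for evaluation, substitution, separation of a variable, the grading and
  restriction to a line: they differ in the target ring and in the images of constants and
  variables.\<close>

definition psub :: "('k::comm_ring_1 \<Rightarrow> 'r::comm_ring_1) \<Rightarrow> ('v \<Rightarrow> 'r) \<Rightarrow> ('v, 'k) mpoly \<Rightarrow> 'r" where
  "psub \<iota> \<sigma> p = (\<Sum>m\<in>Poly_Mapping.keys p. \<iota> (Poly_Mapping.lookup p m) * monom_val \<sigma> m)"

lemma meval_eq_psub: "meval x = psub (\<lambda>c. c) x"
  by (rule ext) (simp add: meval_def psub_def monom_val_def)

lemma mpoly_sum_monoms:
  "(\<Sum>m\<in>Poly_Mapping.keys p. Poly_Mapping.single m (Poly_Mapping.lookup p m)) = p"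
proof (rule poly_mapping_eqI)
  fix k
  have "(\<Sum>m\<in>Poly_Mapping.keys p. Poly_Mapping.lookup p m when m = k) = Poly_Mapping.lookup p k"
    by (cases "k \<in> Poly_Mapping.keys p") (simp_all add: when_def sum.delta in_keys_iff)
  then show "Poly_Mapping.lookup (\<Sum>m\<in>Poly_Mapping.keys p.
      Poly_Mapping.single m (Poly_Mapping.lookup p m)) k = Poly_Mapping.lookup p k"
    by (simp add: lookup_sum lookup_single)
qed

context
  fixes \<iota> :: "'k::comm_ring_1 \<Rightarrow> 'r::comm_ring_1" and \<sigma> :: "'v \<Rightarrow> 'r"
  assumes hom: "rhom \<iota>"
begin

interpretation rhom \<iota> by (rule hom)

lemma psub_superset:
  assumes "finite S" "Poly_Mapping.keys p \<subseteq> S"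
  shows "psub \<iota> \<sigma> p = (\<Sum>m\<in>S. \<iota> (Poly_Mapping.lookup p m) * monom_val \<sigma> m)"
  unfolding psub_def
  by (rule sum.mono_neutral_left) (use assms in \<open>auto simp: in_keys_iff zero\<close>)

lemma psub_add: "psub \<iota> \<sigma> (p + q) = psub \<iota> \<sigma> p + psub \<iota> \<sigma> q"
proof -
  let ?S = "Poly_Mapping.keys p \<union> Poly_Mapping.keys q"
  have "Poly_Mapping.keys (p + q) \<subseteq> ?S" by (rule keys_add)
  then show ?thesis
    by (simp add: psub_superset[of ?S] lookup_add add distrib_right sum.distrib)
qed

lemma psub_single: "psub \<iota> \<sigma> (Poly_Mapping.single m c) = \<iota> c * monom_val \<sigma> m"
  by (simp add: psub_def zero)

lemma psub_sum: "psub \<iota> \<sigma> (sum f S) = (\<Sum>i\<in>S. psub \<iota> \<sigma> (f i))"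
  by (induction S rule: infinite_finite_induct) (simp_all add: psub_add, simp_all add: psub_def)

lemma psub_mult: "psub \<iota> \<sigma> (p * q) = psub \<iota> \<sigma> p * psub \<iota> \<sigma> q"
proof -
  let ?p = "\<Sum>m\<in>Poly_Mapping.keys p. Poly_Mapping.single m (Poly_Mapping.lookup p m)"
  let ?q = "\<Sum>m\<in>Poly_Mapping.keys q. Poly_Mapping.single m (Poly_Mapping.lookup q m)"
  have "psub \<iota> \<sigma> (?p * ?q) = psub \<iota> \<sigma> ?p * psub \<iota> \<sigma> ?q"
    by (simp add: sum_product psub_sum mult_single psub_single mult monom_val_add ac_simps)
  then show ?thesis by (simp only: mpoly_sum_monoms)
qed

lemma rhom_psub: "rhom (psub \<iota> \<sigma>)"
proof
  show "psub \<iota> \<sigma> 1 = 1"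
    using psub_single[of 0 1] by (simp add: one)
qed (rule psub_add psub_mult)+

lemma psub_mconst: "psub \<iota> \<sigma> (mconst c) = \<iota> c"
  by (simp add: mconst_def psub_single)

lemma psub_mvar: "psub \<iota> \<sigma> (mvar v) = \<sigma> v"
  by (simp add: mvar_def psub_single one) (simp add: monom_val_def)

end

lemma rhom_meval: "rhom (meval x)"
  unfolding meval_eq_psub by (rule rhom_psub[OF rhom_id])

lemma meval_mconst [simp]: "meval x (mconst c) = c" for c :: "'k::comm_ring_1"
  unfolding meval_eq_psub by (rule psub_mconst[OF rhom_id])

lemma meval_mvar [simp]: "meval x (mvar v) = x v" for x :: "'v \<Rightarrow> 'k::comm_ring_1"
  unfolding meval_eq_psub by (rule psub_mvar[OF rhom_id])

lemmas meval_hom [simp] = rhom.hom_simps[OF rhom_meval]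

section \<open>Polynomials in a given set of variables\<close>

definition polys :: "'v set \<Rightarrow> ('v, 'k::zero) mpoly set" where
  "polys V = {p. mvars p \<subseteq> V}"

lemma polys_mono: "V \<subseteq> W \<Longrightarrow> p \<in> polys V \<Longrightarrow> p \<in> polys W"
  by (auto simp: polys_def)

lemma polys_mvars: "p \<in> polys (mvars p)"
  by (simp add: polys_def)

lemma finite_mvars: "finite (mvars p)"
  by (simp add: mvars_def)

lemma polys_mconst [simp]: "mconst c \<in> polys V"
  by (auto simp: polys_def mvars_def mconst_def split: if_splits)

lemma polys_mvar [simp]: "(mvar v :: ('v, 'k::comm_ring_1) mpoly) \<in> polys V \<longleftrightarrow> v \<in> V"
  by (auto simp: polys_def mvars_def mvar_def)

lemma polys_zero [simp]: "0 \<in> polys V"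
  by (simp add: polys_def mvars_def)

lemma polys_one [simp]: "1 \<in> polys V"
  by (simp add: polys_def mvars_def)

lemma polys_add: "p \<in> polys V \<Longrightarrow> q \<in> polys V \<Longrightarrow> p + q \<in> polys V"
  unfolding polys_def mvars_def using keys_add[of p q] by blast

lemma polys_uminus: "p \<in> polys V \<Longrightarrow> - p \<in> polys V" for p :: "('v, 'k::ab_group_add) mpoly"
  by (auto simp: polys_def mvars_def in_keys_iff)

lemma polys_mult: "p \<in> polys V \<Longrightarrow> q \<in> polys V \<Longrightarrow> p * q \<in> polys V"
  for p :: "('v, 'k::semiring_0) mpoly"
proof -
  assume pq: "p \<in> polys V" "q \<in> polys V"
  show ?thesis
    unfolding polys_def mvars_def
  proof clarify
    fix v m assume m: "m \<in> Poly_Mapping.keys (p * q)" and v: "v \<in> Poly_Mapping.keys m"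
    obtain a b where "m = a + b" "a \<in> Poly_Mapping.keys p" "b \<in> Poly_Mapping.keys q"
      using keys_mult[of p q] m by blast
    then show "v \<in> V"
      using v keys_add[of a b] pq unfolding polys_def mvars_def by blast
  qed
qed

lemma polys_diff: "p \<in> polys V \<Longrightarrow> q \<in> polys V \<Longrightarrow> p - q \<in> polys V"
  for p :: "('v, 'k::ab_group_add) mpoly"
  using polys_add[of p V "- q"] polys_uminus[of q V] by simp

lemma polys_power: "p \<in> polys V \<Longrightarrow> p ^ n \<in> polys V" for p :: "('v, 'k::comm_semiring_1) mpoly"
  by (induction n) (auto intro: polys_mult)

lemma polys_sum: "(\<And>i. i \<in> S \<Longrightarrow> f i \<in> polys V) \<Longrightarrow> sum f S \<in> polys V"
  by (induction S rule: infinite_finite_induct) (auto intro: polys_add)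

lemma polys_prod: "(\<And>i. i \<in> S \<Longrightarrow> f i \<in> polys V) \<Longrightarrow> prod f S \<in> polys V"
  for f :: "'i \<Rightarrow> ('v, 'k::comm_semiring_1) mpoly"
  by (induction S rule: infinite_finite_induct) (auto intro: polys_mult)

lemmas polys_intros = polys_add polys_diff polys_uminus polys_mult polys_power polys_sum polys_prod

lemma single_eq_monom_val:
  "Poly_Mapping.single m c = mconst c * monom_val mvar m"
  for c :: "'k::comm_ring_1" and m :: "'v \<Rightarrow>\<^sub>0 nat"
proof -
  have pow: "(mvar v :: ('v, 'k) mpoly) ^ k = Poly_Mapping.single (Poly_Mapping.single v k) 1"
    for v :: 'v and k
    by (induction k) (simp_all add: mvar_def mult_single flip: single_add)
  have "(\<Prod>v\<in>S. mvar v ^ Poly_Mapping.lookup m v)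
      = Poly_Mapping.single (\<Sum>v\<in>S. Poly_Mapping.single v (Poly_Mapping.lookup m v)) (1::'k)"
    for S :: "'v set"
    by (induction S rule: infinite_finite_induct) (simp_all add: pow mult_single)
  from this[of "Poly_Mapping.keys m"]
  have "Poly_Mapping.single m (1::'k) = monom_val mvar m"
    by (simp add: mpoly_sum_monoms monom_val_def)
  then show ?thesis
    using mult_single[of 0 c m 1] by (simp add: mconst_def)
qed

text \<open>Constants and the variables in \<open>V\<close> generate the subring: a polynomial is
  the sum of its terms, and each term is a constant times a product of powers of variables.\<close>

lemma polys_induct [consumes 1, case_names const var add mult]:
  fixes p :: "('v, 'k::comm_ring_1) mpoly"
  assumes p: "p \<in> polys V"
    and const: "\<And>c. Q (mconst c)"
    and var: "\<And>v. v \<in> V \<Longrightarrow> Q (mvar v)"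
    and add: "\<And>p q. p \<in> polys V \<Longrightarrow> q \<in> polys V \<Longrightarrow> Q p \<Longrightarrow> Q q \<Longrightarrow> Q (p + q)"
    and mult: "\<And>p q. p \<in> polys V \<Longrightarrow> q \<in> polys V \<Longrightarrow> Q p \<Longrightarrow> Q q \<Longrightarrow> Q (p * q)"
  shows "Q p"
proof -
  have Q1: "Q 1" and Q0: "Q 0"
    using const[of 1] const[of 0] by (simp_all add: mconst_def)
  have pow: "Q (q ^ k)" if "Q q" "q \<in> polys V" for q k
    using that by (induction k) (auto intro: Q1 mult polys_power)
  have prod: "Q (prod g S)" if "\<And>i. i \<in> S \<Longrightarrow> Q (g i) \<and> g i \<in> polys V" for g and S :: "'v set"
    using that by (induction S rule: infinite_finite_induct) (auto intro: Q1 mult polys_prod)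
  have single: "Q (Poly_Mapping.single m c) \<and> Poly_Mapping.single m c \<in> polys V"
    if "Poly_Mapping.keys m \<subseteq> V" for m c
    unfolding single_eq_monom_val monom_val_def
    using that by (intro conjI mult const prod polys_mult polys_prod polys_power pow var) auto
  have sum: "Q (sum g S)" if "\<And>i. i \<in> S \<Longrightarrow> Q (g i) \<and> g i \<in> polys V" for g and S :: "('v \<Rightarrow>\<^sub>0 nat) set"
    using that by (induction S rule: infinite_finite_induct) (auto intro: Q0 add polys_sum)
  have "Q (\<Sum>m\<in>Poly_Mapping.keys p. Poly_Mapping.single m (Poly_Mapping.lookup p m))"
    by (intro sum single) (use p in \<open>auto simp: polys_def mvars_def\<close>)
  then show ?thesis by (simp add: mpoly_sum_monoms)
qed

lemma rhom_eq_on_polys: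
  assumes "p \<in> polys V" "rhom f" "rhom g"
    and "\<And>c. f (mconst c) = g (mconst c)" "\<And>v. v \<in> V \<Longrightarrow> f (mvar v) = g (mvar v)"
  shows "f p = g p"
  using assms(1) by (induction rule: polys_induct)
    (use assms in \<open>simp_all add: rhom.add rhom.mult\<close>)

text \<open>The standard way here to prove an identity about substitutions: both sides are
  homomorphisms, so they are compared on constants and variables.\<close>

lemma rhom_eqI:
  fixes f :: "('v, 'k::comm_ring_1) mpoly \<Rightarrow> _"
  assumes "rhom f" "rhom g"
    and "\<And>c. f (mconst c) = g (mconst c)" "\<And>v. f (mvar v) = g (mvar v)"
  shows "f p = g p"
  by (rule rhom_eq_on_polys[OF polys_mvars]) (use assms in auto)

lemma meval_cong:
  "p \<in> polys V \<Longrightarrow> (\<And>v. v \<in> V \<Longrightarrow> x v = y v) \<Longrightarrow> meval x p = meval y p"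
  for x :: "'v \<Rightarrow> 'k::comm_ring_1"
  by (rule rhom_eq_on_polys[of p V]) (auto intro: rhom_meval)

abbreviation subst :: "('v \<Rightarrow> ('w, 'k) mpoly) \<Rightarrow> ('v, 'k::comm_ring_1) mpoly \<Rightarrow> ('w, 'k) mpoly" where
  "subst \<equiv> psub mconst"

lemmas rhom_subst = rhom_psub[OF rhom_mconst]
lemmas subst_mconst [simp] = psub_mconst[OF rhom_mconst]
lemmas subst_mvar [simp] = psub_mvar[OF rhom_mconst]
lemmas subst_hom [simp] = rhom.hom_simps[OF rhom_subst]

lemma meval_subst: "meval x (subst \<sigma> p) = meval (\<lambda>v. meval x (\<sigma> v)) p"
  by (rule rhom_eqI[where p = p, OF rhom_comp[OF rhom_meval rhom_subst] rhom_meval]) simp_all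

lemma polys_subst:
  "p \<in> polys V \<Longrightarrow> (\<And>v. v \<in> V \<Longrightarrow> \<sigma> v \<in> polys W) \<Longrightarrow> subst \<sigma> p \<in> polys W"
  by (induction rule: polys_induct) (auto intro: polys_intros)

lemma subst_ident: "p \<in> polys V \<Longrightarrow> (\<And>v. v \<in> V \<Longrightarrow> \<sigma> v = mvar v) \<Longrightarrow> subst \<sigma> p = p"
  by (rule rhom_eq_on_polys[OF _ rhom_subst rhom_id]) auto

section \<open>Separating a variable\<close>

text \<open>The coefficients keep the same type, so that \<open>poly (sep x p) (mvar x)\<close>
  returns \<open>p\<close>; that they are free of \<open>x\<close> is the separate fact
  \<open>coeff_sep_polys\<close>.\<close>

definition sep :: "'v \<Rightarrow> ('v, 'k::comm_ring_1) mpoly \<Rightarrow> ('v, 'k) mpoly poly" where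
  "sep x = psub (\<lambda>c. [:mconst c:]) (\<lambda>v. if v = x then [:0, 1:] else [:mvar v:])"

lemma rhom_sep: "rhom (sep x)"
  unfolding sep_def by (rule rhom_psub[OF rhom_pCons[OF rhom_mconst]])

lemma sep_mconst [simp]: "sep x (mconst c) = [:mconst c:]"
  unfolding sep_def by (rule psub_mconst[OF rhom_pCons[OF rhom_mconst]])

lemma sep_mvar [simp]: "sep x (mvar v) = (if v = x then [:0, 1:] else [:mvar v:])"
  unfolding sep_def by (rule psub_mvar[OF rhom_pCons[OF rhom_mconst]])

lemmas sep_hom [simp] = rhom.hom_simps[OF rhom_sep]

lemma poly_sep [simp]: "poly (sep x p) (mvar x) = p"
  by (rule rhom_eqI[where p = p, OF rhom_comp[OF rhom_poly rhom_sep] rhom_id]) auto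

lemma sep_eq_0_iff [simp]: "sep x p = 0 \<longleftrightarrow> p = 0"
  by (metis poly_0 poly_sep rhom.zero rhom_sep)

lemma sep_const: "p \<in> polys V \<Longrightarrow> x \<notin> V \<Longrightarrow> sep x p = [:p:]"
  by (rule rhom_eq_on_polys[OF _ rhom_sep rhom_pCons[OF rhom_id]]) auto

lemma coeff_sep_polys: "p \<in> polys V \<Longrightarrow> coeff (sep x p) i \<in> polys (V - {x})"
proof (induction arbitrary: i rule: polys_induct)
  case (const c)
  then show ?case by (cases i) auto
next
  case (var v)
  then show ?case by (auto simp: coeff_pCons split: nat.splits)
qed (auto simp: coeff_mult intro!: polys_intros)

definition dg :: "'v \<Rightarrow> ('v, 'k::comm_ring_1) mpoly \<Rightarrow> nat" where
  "dg x p = degree (sep x p)"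

definition lc :: "'v \<Rightarrow> ('v, 'k::comm_ring_1) mpoly \<Rightarrow> ('v, 'k) mpoly" where
  "lc x p = lead_coeff (sep x p)"

lemma lc_polys: "p \<in> polys V \<Longrightarrow> lc x p \<in> polys (V - {x})"
  by (simp add: lc_def coeff_sep_polys)

lemma dg_zero: "p \<in> polys V \<Longrightarrow> x \<notin> V \<Longrightarrow> dg x p = 0"
  by (simp add: dg_def sep_const)

lemma lc_zero: "p \<in> polys V \<Longrightarrow> x \<notin> V \<Longrightarrow> lc x p = p"
  by (simp add: lc_def sep_const)

lemma dg_zero_polys:
  assumes "p \<in> polys V" "dg x p = 0"
  shows "p \<in> polys (V - {x})"
proof -
  obtain c where c: "sep x p = [:c:]"
    using assms(2) unfolding dg_def by (rule degree_eq_zeroE)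
  then have "p = coeff (sep x p) 0"
    using poly_sep[of x p] by simp
  then show ?thesis using coeff_sep_polys[OF assms(1)] by metis
qed

lemma lc_eq_0_iff [simp]: "lc x p = 0 \<longleftrightarrow> p = 0"
  by (simp add: lc_def)

text \<open>The order on the variables induces an order on monomials, by which the polynomials form
  an integral domain.\<close>

lemma dg_mult: "p \<noteq> 0 \<Longrightarrow> q \<noteq> 0 \<Longrightarrow> dg x (p * q) = dg x p + dg x q"
  for p q :: "('v::linorder, 'k::idom) mpoly"
  by (simp add: dg_def degree_mult_eq)

lemma lc_mult: "lc x (p * q) = lc x p * lc x q"
  for p q :: "('v::linorder, 'k::idom) mpoly"
  by (simp add: lc_def lead_coeff_mult)

lemma dg_mvar: "dg x (mvar x ^ n :: ('v::linorder, 'k::idom) mpoly) = n"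
  by (simp add: dg_def degree_power_eq)

lemma lc_mvar: "lc x (mvar x ^ n :: ('v::linorder, 'k::idom) mpoly) = 1"
  by (simp add: lc_def lead_coeff_power)

lemma mvar_neq_0 [simp]: "(mvar x :: ('v, 'k::comm_ring_1) mpoly) \<noteq> 0"
  by (metis pCons_eq_0_iff one_neq_zero sep_eq_0_iff sep_mvar)

lemma dg_diff_less:
  assumes "dg x p = dg x q" "lc x p = lc x q" "p \<noteq> q"
  shows "dg x (p - q) < dg x p"
proof -
  have "degree (sep x p - sep x q) \<le> degree (sep x p)"
    using assms(1) by (intro degree_diff_le) (simp_all add: dg_def)
  moreover have "degree (sep x p - sep x q) \<noteq> degree (sep x p)"
  proof
    assume eq: "degree (sep x p - sep x q) = degree (sep x p)"
    have "lead_coeff (sep x p - sep x q) = 0"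
      unfolding eq using assms(1,2) by (simp add: dg_def lc_def)
    then have "sep x (p - q) = 0" by (simp only: leading_coeff_0_iff sep_hom)
    then show False using assms(3) by (simp only: sep_eq_0_iff) simp
  qed
  ultimately show ?thesis by (simp add: dg_def)
qed

text \<open>In a variable outside \<open>V\<close> the degrees of the two factors add up to 0, so
  neither factor contains it.\<close>

lemma polys_factor:
  fixes p q :: "('v::linorder, 'k::idom) mpoly"
  assumes "p * q \<in> polys V" "p * q \<noteq> 0"
  shows "p \<in> polys V"
proof -
  have "v \<in> V" if v: "v \<in> mvars p" for v
  proof (rule ccontr)
    assume "v \<notin> V"
    then have "dg v p + dg v q = 0"
      using assms by (subst dg_mult[symmetric]) (auto intro: dg_zero)
    then have "p \<in> polys (mvars p - {v})"
      by (intro dg_zero_polys polys_mvars) simp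
    then show False using v by (auto simp: polys_def)
  qed
  then show ?thesis by (auto simp: polys_def)
qed

lemma polys_dvd: "p dvd q \<Longrightarrow> q \<in> polys V \<Longrightarrow> q \<noteq> 0 \<Longrightarrow> p \<in> polys V"
  for p q :: "('v::linorder, 'k::idom) mpoly"
  by (auto simp: polys_factor)

section \<open>The grading by total degree\<close>

text \<open>This is p(t z) as a polynomial in t: its coefficients are the homogeneous components of
  p, and homogeneity of degree e becomes \<open>grade p = monom p e\<close>.\<close>

definition grade :: "('v, 'k::comm_ring_1) mpoly \<Rightarrow> ('v, 'k) mpoly poly" where
  "grade = psub (\<lambda>c. [:mconst c:]) (\<lambda>v. monom (mvar v) 1)"

definition tdeg :: "('v, 'k::comm_ring_1) mpoly \<Rightarrow> nat" where
  "tdeg p = degree (grade p)"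

lemma rhom_grade: "rhom grade"
  unfolding grade_def by (rule rhom_psub[OF rhom_pCons[OF rhom_mconst]])

lemma grade_mconst [simp]: "grade (mconst c) = [:mconst c:]"
  unfolding grade_def by (rule psub_mconst[OF rhom_pCons[OF rhom_mconst]])

lemma grade_mvar [simp]: "grade (mvar v) = monom (mvar v) 1"
  unfolding grade_def by (rule psub_mvar[OF rhom_pCons[OF rhom_mconst]])

lemmas grade_hom [simp] = rhom.hom_simps[OF rhom_grade]

lemma poly_grade [simp]: "poly (grade p) 1 = p"
  by (rule rhom_eqI[where p = p, OF rhom_comp[OF rhom_poly rhom_grade] rhom_id])
    (auto simp: poly_monom)

lemma grade_eq_0_iff [simp]: "grade p = 0 \<longleftrightarrow> p = 0"
  by (metis poly_0 poly_grade rhom.zero rhom_grade)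

lemma poly_grade_0: "poly (grade p) 0 = mconst (meval (\<lambda>_. 0) p)"
  by (rule rhom_eqI[where p = p, OF rhom_comp[OF rhom_poly rhom_grade]
        rhom_comp[OF rhom_mconst rhom_meval]])
    (auto simp: poly_monom rhom.zero[OF rhom_mconst])

lemma coeff_grade_polys: "p \<in> polys V \<Longrightarrow> coeff (grade p) i \<in> polys V"
proof (induction arbitrary: i rule: polys_induct)
  case (const c)
  then show ?case by (cases i) auto
qed (auto simp: coeff_mult intro!: polys_intros)

text \<open>The link between the grading and the definition of homogeneity by exponents; all later
  arguments use the grading.\<close>

lemma lookup_coeff_grade:
  "Poly_Mapping.lookup (coeff (grade p) j) m =
     (if (\<Sum>v\<in>Poly_Mapping.keys m. Poly_Mapping.lookup m v) = j then Poly_Mapping.lookup p m else 0)"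
  for p :: "('v, 'k::comm_ring_1) mpoly"
proof -
  define wt where "wt m = (\<Sum>v\<in>Poly_Mapping.keys m. Poly_Mapping.lookup m v)" for m :: "'v \<Rightarrow>\<^sub>0 nat"
  have pow: "monom a (Suc 0) ^ l = monom (a ^ l) l" for a :: "('v, 'k) mpoly" and l
    by (simp add: monom_power)
  have prod: "(\<Prod>v\<in>S. monom (g v) (k v)) = monom (\<Prod>v\<in>S. g v) (\<Sum>v\<in>S. k v)"
    for S :: "'v set" and g :: "'v \<Rightarrow> ('v, 'k) mpoly" and k
    by (induction S rule: infinite_finite_induct) (simp_all add: mult_monom)
  have "grade (Poly_Mapping.single m c) = monom (Poly_Mapping.single m c) (wt m)" for m and c :: 'k
    unfolding grade_def psub_single[OF rhom_pCons[OF rhom_mconst]]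
    by (simp add: monom_val_def pow prod wt_def single_eq_monom_val smult_monom)
  then have "grade p = (\<Sum>m\<in>Poly_Mapping.keys p. monom (Poly_Mapping.single m (Poly_Mapping.lookup p m)) (wt m))"
    by (subst mpoly_sum_monoms[of p, symmetric], subst rhom.sum[OF rhom_grade]) simp
  then have "Poly_Mapping.lookup (coeff (grade p) j) m =
      (\<Sum>m'\<in>Poly_Mapping.keys p. if m' = m \<and> wt m' = j then Poly_Mapping.lookup p m' else 0)"
    by (simp add: coeff_sum lookup_sum) (auto intro!: sum.cong simp: lookup_single when_def)
  also have "\<dots> = (\<Sum>m'\<in>Poly_Mapping.keys p. if m' = m then if wt m = j then Poly_Mapping.lookup p m else 0 else 0)"
    by (intro sum.cong) auto
  also have "\<dots> = (if wt m = j then Poly_Mapping.lookup p m else 0)"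
    by (simp add: in_keys_iff)
  finally show ?thesis by (simp add: wt_def)
qed

lemma homogeneous_iff_grade: "homogeneous e p \<longleftrightarrow> grade p = monom p e"
  for p :: "('v, 'k::comm_ring_1) mpoly"
proof
  assume h: "homogeneous e p"
  have "coeff (grade p) j = coeff (monom p e) j" for j
    using h by (intro poly_mapping_eqI) (auto simp: lookup_coeff_grade homogeneous_in_def in_keys_iff)
  then show "grade p = monom p e" by (simp add: poly_eq_iff)
next
  assume g: "grade p = monom p e"
  show "homogeneous e p"
    unfolding homogeneous_in_def
  proof
    fix m assume m: "m \<in> Poly_Mapping.keys p"
    then have "Poly_Mapping.lookup (coeff (grade p) e) m \<noteq> 0"
      by (simp add: g in_keys_iff)
    then show "(\<Sum>v\<in>Poly_Mapping.keys m \<inter> UNIV. Poly_Mapping.lookup m v) = e"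
      by (auto simp: lookup_coeff_grade split: if_splits)
  qed
qed

lemma homogeneous_coeff_grade: "homogeneous j (coeff (grade p) j)"
  for p :: "('v, 'k::comm_ring_1) mpoly"
  by (auto simp: homogeneous_in_def in_keys_iff lookup_coeff_grade split: if_splits)

lemma homogeneous_zero [simp]: "homogeneous e 0"
  by (simp add: homogeneous_in_def)

lemma homogeneous_mvar [simp]: "homogeneous 1 (mvar v :: ('v, 'k::comm_ring_1) mpoly)"
  by (simp add: homogeneous_iff_grade)

lemma homogeneous_add: "homogeneous e p \<Longrightarrow> homogeneous e q \<Longrightarrow> homogeneous e (p + q)"
  for p q :: "('v, 'k::comm_ring_1) mpoly"
  by (simp add: homogeneous_iff_grade add_monom)

lemma homogeneous_mult: "homogeneous i p \<Longrightarrow> homogeneous j q \<Longrightarrow> homogeneous (i + j) (p * q)"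
  for p q :: "('v, 'k::comm_ring_1) mpoly"
  by (simp add: homogeneous_iff_grade mult_monom)

lemma homogeneous_power: "homogeneous i p \<Longrightarrow> homogeneous (i * n) (p ^ n)"
  for p :: "('v, 'k::comm_ring_1) mpoly"
  by (simp add: homogeneous_iff_grade monom_power)

lemma homogeneous_sum: "(\<And>i. i \<in> S \<Longrightarrow> homogeneous e (f i)) \<Longrightarrow> homogeneous e (sum f S)"
  for f :: "'i \<Rightarrow> ('v, 'k::comm_ring_1) mpoly"
  by (induction S rule: infinite_finite_induct) (simp_all add: homogeneous_add)

lemma tdeg_homogeneous: "homogeneous e p \<Longrightarrow> p \<noteq> 0 \<Longrightarrow> tdeg p = e"
  for p :: "('v, 'k::comm_ring_1) mpoly"
  by (simp add: tdeg_def homogeneous_iff_grade degree_monom_eq)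

lemma tdeg_mult: "p \<noteq> 0 \<Longrightarrow> q \<noteq> 0 \<Longrightarrow> tdeg (p * q) = tdeg p + tdeg q"
  for p q :: "('v::linorder, 'k::idom) mpoly"
  by (simp add: tdeg_def degree_mult_eq)

text \<open>If p(t z) is constant in t, its values at t = 1 and t = 0 agree.\<close>

lemma tdeg_eq_0: 
  assumes "tdeg p = 0"
  shows "p = mconst (meval (\<lambda>_. 0) p)"
proof -
  obtain c where "grade p = [:c:]"
    using assms unfolding tdeg_def by (rule degree_eq_zeroE)
  then have "poly (grade p) 1 = poly (grade p) 0" by simp
  then show ?thesis by (simp only: poly_grade poly_grade_0)
qed

lemma mconst_dvd_1: "c \<noteq> 0 \<Longrightarrow> mconst c dvd (1 :: ('v, 'k::field) mpoly)"
  by (intro dvdI[of _ _ "mconst (inverse c)"])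
    (simp add: rhom.mult[OF rhom_mconst, symmetric] rhom.one[OF rhom_mconst])

lemma tdeg_one [simp]: "tdeg (1 :: ('v, 'k::comm_ring_1) mpoly) = 0"
  by (simp add: tdeg_def)

lemma dvd_1_iff_tdeg: "p dvd 1 \<longleftrightarrow> p \<noteq> 0 \<and> tdeg p = 0"
  for p :: "('v::linorder, 'k::field) mpoly"
proof
  assume "p dvd 1"
  then obtain q where q: "1 = p * q" by (auto elim: dvdE)
  then have "p \<noteq> 0" "q \<noteq> 0" by auto
  moreover have "tdeg p + tdeg q = 0"
    using tdeg_mult[OF \<open>p \<noteq> 0\<close> \<open>q \<noteq> 0\<close>] q by (metis tdeg_one)
  ultimately show "p \<noteq> 0 \<and> tdeg p = 0" by simp
next
  assume p: "p \<noteq> 0 \<and> tdeg p = 0"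
  then have eq: "p = mconst (meval (\<lambda>_. 0) p)" by (intro tdeg_eq_0) simp
  then have "meval (\<lambda>_. 0) p \<noteq> 0"
    using p by (metis rhom.zero rhom_mconst)
  then show "p dvd 1" by (subst eq) (rule mconst_dvd_1)
qed

lemma irreducible_divisor_exists:
  fixes p :: "('v::linorder, 'k::field) mpoly"
  assumes "p \<noteq> 0" "\<not> p dvd 1"
  shows "\<exists>q. irreducible q \<and> q dvd p"
  using assms
proof (induction "tdeg p" arbitrary: p rule: less_induct)
  case less
  show ?case
  proof (cases "irreducible p")
    case False
    then obtain a b where ab: "p = a * b" "\<not> a dvd 1" "\<not> b dvd 1"
      using less.prems by (auto simp: irreducible_def)
    then have "a \<noteq> 0" "b \<noteq> 0" using less.prems by auto
    then have "tdeg a < tdeg p"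
      using ab by (auto simp: tdeg_mult dvd_1_iff_tdeg)
    then obtain q where "irreducible q" "q dvd a"
      using less.hyps \<open>a \<noteq> 0\<close> ab(2) by blast
    then show ?thesis using ab(1) by auto
  qed auto
qed

text \<open>Order at 0 and degree are both additive and both equal \<open>n\<close> on the product.
  Since the order of each factor is at most its degree, they coincide on each factor, which is
  therefore a monomial.\<close>

lemma poly_mult_eq_monom:
  fixes p q :: "'a::idom poly"
  assumes "p * q = monom c n" "c \<noteq> 0"
  shows "p = monom (lead_coeff p) (degree p)"
proof -
  have n0: "p \<noteq> 0" "q \<noteq> 0" using assms by (auto simp: monom_eq_0_iff)
  have oX: "order 0 p + order 0 q = n" 
    using order_mult[of p q 0] n0 assms by (simp add: order_0_monom)
  have dX: "degree p + degree q = n"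
    using degree_mult_eq[OF n0] assms by (simp add: degree_monom_eq)
  have "order 0 p = degree p"
    using oX dX order_degree[OF n0(1), of 0] order_degree[OF n0(2), of 0] by linarith
  then have "[:0, 1:] ^ degree p dvd p"
    using order_1[of 0 p] by simp
  then have m: "monom 1 (degree p) dvd p" by (simp add: monom_altdef)
  have "coeff p i = 0" if "i < degree p" for i
    using m that by (simp add: monom_1_dvd_iff')
  then show ?thesis
    by (intro poly_eqI) (metis coeff_eq_0 coeff_monom linorder_neqE_nat)
qed

lemma homogeneous_factor:
  fixes p q :: "('v::linorder, 'k::idom) mpoly"
  assumes "homogeneous e (p * q)" "p * q \<noteq> 0"
  shows "homogeneous (tdeg p) p"
proof -
  have "grade p * grade q = monom (p * q) e"
    using assms(1) by (simp add: homogeneous_iff_grade)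
  from poly_mult_eq_monom[OF this assms(2)]
  have eq: "grade p = monom (lead_coeff (grade p)) (tdeg p)" by (simp add: tdeg_def)
  then have "poly (grade p) 1 = lead_coeff (grade p)"
    by (metis mult.right_neutral poly_monom power_one)
  then show ?thesis using eq by (simp add: homogeneous_iff_grade)
qed

section \<open>Unique factorization\<close>

text \<open>Testing only on factors from \<open>polys V\<close> permits an induction over the finite
  set \<open>V\<close>.\<close>

definition prime_on :: "'v set \<Rightarrow> ('v, 'k::field) mpoly \<Rightarrow> bool" where
  "prime_on V p \<longleftrightarrow> (\<forall>a\<in>polys V. \<forall>b\<in>polys V. p dvd a * b \<longrightarrow> p dvd a \<or> p dvd b)"

lemma drop_leading_term:
  fixes a :: "('v::linorder, 'k::field) mpoly"
  assumes "a \<in> polys V" "a \<noteq> 0"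
  shows "a - lc x a * mvar x ^ dg x a = 0 \<or> dg x (a - lc x a * mvar x ^ dg x a) < dg x a"
proof -
  have c: "lc x a \<in> polys (V - {x})" by (rule lc_polys[OF assms(1)])
  have "dg x (lc x a * mvar x ^ dg x a) = dg x a"
    using dg_zero[OF c] assms(2) by (simp add: dg_mult dg_mvar)
  moreover have "lc x (lc x a * mvar x ^ dg x a) = lc x a"
    using lc_zero[OF c] by (simp add: lc_mult lc_mvar)
  ultimately show ?thesis
    using dg_diff_less[of x a "lc x a * mvar x ^ dg x a"] by auto
qed

lemma prime_on_insert:
  fixes p :: "('v::linorder, 'k::field) mpoly"
  assumes p: "p \<in> polys W" and prime: "prime_on W p" and x: "x \<notin> W"
  shows "prime_on (insert x W) p"
proof -
  let ?V = "insert x W"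
  have W: "?V - {x} = W" using x by auto
  have "p dvd a \<or> p dvd b" if "a \<in> polys ?V" "b \<in> polys ?V" "p dvd a * b" for a b
    using that
  proof (induction "dg x a + dg x b" arbitrary: a b rule: less_induct)
    case less
    show ?case
    proof (cases "a = 0 \<or> b = 0")
      case False
      then have a0: "a \<noteq> 0" and b0: "b \<noteq> 0" by auto
      obtain c where c: "a * b = p * c" using less.prems(3) by (auto elim: dvdE)
      then have "lc x a * lc x b = p * lc x c"
        using lc_zero[OF p x] by (metis lc_mult)
      moreover have la: "lc x a \<in> polys W" and lb: "lc x b \<in> polys W"
        using lc_polys[of a ?V x] lc_polys[of b ?V x] less.prems W by auto
      ultimately have "p dvd lc x a \<or> p dvd lc x b"
        using prime unfolding prime_on_def by (metis dvd_triv_left)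
      then show ?thesis
      proof
        assume d: "p dvd lc x a"
        let ?t = "lc x a * mvar x ^ dg x a"
        have "p dvd ?t" using d by simp
        then have "p dvd (a - ?t) * b"
          using less.prems(3) by (simp add: left_diff_distrib dvd_diff)
        moreover have "a - ?t \<in> polys ?V"
          using less.prems polys_mono[OF _ la, of ?V] by (auto intro!: polys_intros)
        ultimately have "a - ?t = 0 \<or> p dvd a - ?t \<or> p dvd b"
          using drop_leading_term[OF less.prems(1) a0, of x] less.hyps[of "a - ?t" b] less.prems(2)
          by auto
        then show ?thesis using \<open>p dvd ?t\<close>
          by (metis add.commute diff_add_cancel dvd_add dvd_0_right)
      next
        assume d: "p dvd lc x b"
        let ?t = "lc x b * mvar x ^ dg x b"
        have "p dvd ?t" using d by simp
        then have "p dvd a * (b - ?t)"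
          using less.prems(3) by (simp add: right_diff_distrib dvd_diff)
        moreover have "b - ?t \<in> polys ?V"
          using less.prems polys_mono[OF _ lb, of ?V] by (auto intro!: polys_intros)
        ultimately have "b - ?t = 0 \<or> p dvd a \<or> p dvd b - ?t"
          using drop_leading_term[OF less.prems(2) b0, of x] less.hyps[of a "b - ?t"] less.prems(1)
          by auto
        then show ?thesis using \<open>p dvd ?t\<close>
          by (metis add.commute diff_add_cancel dvd_add dvd_0_right)
      qed
    qed auto
  qed
  then show ?thesis by (auto simp: prime_on_def)
qed

text \<open>The induction step from K[W] to K[W][x]. Instead of working over the fraction field of
  K[W], denominators from \<open>polys W\<close> are carried along and cancelled one irreducible
  factor at a time.\<close>

locale gauss_step =
  fixes W :: "'v::linorder set" and x :: 'v and V
  assumes x: "x \<notin> W" and V_def: "V = insert x W"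
    and prime: "\<And>p :: ('v, 'k::field) mpoly. p \<in> polys W \<Longrightarrow> irreducible p \<Longrightarrow> prime_on V p"
begin

lemma W_V: "p \<in> polys W \<Longrightarrow> p \<in> polys V"
  by (rule polys_mono[of W]) (auto simp: V_def)

lemma dg_W: "p \<in> polys W \<Longrightarrow> dg x p = 0"
  using x by (rule dg_zero[rotated])

lemma irreducible_divisor_W:
  fixes r :: "('v, 'k) mpoly"
  assumes "r \<in> polys W" "r \<noteq> 0" "\<not> r dvd 1"
  obtains \<rho> r' where "irreducible \<rho>" "r = \<rho> * r'" "\<rho> \<in> polys W" "r' \<in> polys W" "tdeg r' < tdeg r"
    "r' \<noteq> 0"
proof -
  obtain \<rho> where \<rho>: "irreducible \<rho>" "\<rho> dvd r"
    using irreducible_divisor_exists[OF assms(2,3)] by blast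
  then obtain r' where r': "r = \<rho> * r'" by (auto elim: dvdE)
  have n0: "\<rho> \<noteq> 0" "r' \<noteq> 0" using r' assms by auto
  have "tdeg \<rho> \<noteq> 0" using \<rho>(1) n0 by (auto simp: irreducible_def dvd_1_iff_tdeg)
  then have "tdeg r' < tdeg r" using r' n0 by (simp add: tdeg_mult)
  moreover have "\<rho> \<in> polys W" "r' \<in> polys W"
    using polys_factor[of \<rho> r' W] polys_factor[of r' \<rho> W] r' assms by (auto simp: mult.commute)
  ultimately show thesis using that \<rho> r' n0 by blast
qed

text \<open>The factor \<open>r\<close> free of \<open>x\<close> is distributed over \<open>t\<close> and \<open>m\<close>, one irreducible factor at a time.\<close>

lemma cancel_split:
  fixes r t m :: "('v, 'k) mpoly"
  assumes "r \<in> polys W" "r \<noteq> 0" "t \<in> polys V" "m \<in> polys V" "r * p = t * m" "p \<noteq> 0"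
  shows "\<exists>t' m'. p = t' * m' \<and> dg x t' = dg x t \<and> dg x m' = dg x m"
  using assms(1-5)
proof (induction "tdeg r" arbitrary: r t m rule: less_induct)
  case less
  have tm0: "t \<noteq> 0" "m \<noteq> 0" using less.prems assms(6) by auto
  show ?case
  proof (cases "r dvd 1")
    case True
    then obtain u where u: "1 = r * u" by (auto elim: dvdE)
    then have u': "p = (u * t) * m"
      using less.prems(5) by (metis mult.assoc mult.commute mult.left_neutral)
    have "u \<noteq> 0" using u by auto
    have "u \<in> polys W" using polys_factor[of u r W] u by (metis mult.commute polys_one one_neq_zero)
    then have "dg x (u * t) = dg x t" using tm0 \<open>u \<noteq> 0\<close> by (simp add: dg_mult dg_W)
    with u' show ?thesis by blast
  next
    case False
    then obtain \<rho> r' where \<rho>: "irreducible \<rho>" "r = \<rho> * r'" "\<rho> \<in> polys W" "r' \<in> polys W"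
      "tdeg r' < tdeg r" "r' \<noteq> 0"
      using irreducible_divisor_W less.prems by metis
    have \<rho>0: "\<rho> \<noteq> 0" using \<rho>(1) by auto
    have "\<rho> dvd t * m" using less.prems(5) \<rho>(2) by (metis dvd_triv_left mult.assoc)
    then have "\<rho> dvd t \<or> \<rho> dvd m"
      using prime[OF \<rho>(3,1)] less.prems by (auto simp: prime_on_def)
    then show ?thesis
    proof
      assume "\<rho> dvd t"
      then obtain t1 where t1: "t = \<rho> * t1" by (auto elim: dvdE)
      have "r' * p = t1 * m" using less.prems(5) \<rho>(2) t1 \<rho>0 by (simp add: mult.assoc)
      moreover have "t1 \<in> polys V"
        using polys_factor[of t1 \<rho> V] t1 tm0 less.prems by (simp add: mult.commute)
      ultimately obtain t' m' where "p = t' * m'" "dg x t' = dg x t1" "dg x m' = dg x m"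
        using less.hyps[OF \<rho>(5,4,6)] less.prems by blast
      moreover have "dg x t = dg x t1"
        using t1 tm0 \<rho>0 \<rho>(3) by (auto simp: dg_mult dg_W)
      ultimately show ?thesis by metis
    next
      assume "\<rho> dvd m"
      then obtain m1 where m1: "m = \<rho> * m1" by (auto elim: dvdE)
      have "\<rho> * (r' * p) = \<rho> * (t * m1)" using less.prems(5) \<rho>(2) m1 by (simp add: ac_simps)
      then have "r' * p = t * m1" using \<rho>0 by simp
      moreover have "m1 \<in> polys V"
        using polys_factor[of m1 \<rho> V] m1 tm0 less.prems by (simp add: mult.commute)
      ultimately obtain t' m' where "p = t' * m'" "dg x t' = dg x t" "dg x m' = dg x m1"
        using less.hyps[OF \<rho>(5,4,6)] less.prems by blast
      moreover have "dg x m = dg x m1"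
        using m1 tm0 \<rho>0 \<rho>(3) by (auto simp: dg_mult dg_W)
      ultimately show ?thesis by metis
    qed
  qed
qed

text \<open>The second assumption on \<open>p\<close> is primitivity over K[W]. An irreducible
  factor of \<open>r\<close> is prime and does not divide \<open>p\<close>, so in
  \<open>r * y = p * c\<close> it divides \<open>c\<close> and cancels.\<close>

lemma cancel_primitive:
  fixes p r y :: "('v, 'k) mpoly"
  assumes p: "p \<in> polys V" "\<And>\<rho>. \<rho> \<in> polys W \<Longrightarrow> irreducible \<rho> \<Longrightarrow> \<not> \<rho> dvd p"
    and "r \<in> polys W" "r \<noteq> 0" "y \<in> polys V" "p dvd r * y"
  shows "p dvd y"
  using assms(3-6)
proof (induction "tdeg r" arbitrary: r rule: less_induct)
  case less
  show ?case
  proof (cases "r dvd 1")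
    case True
    then obtain u where u: "1 = r * u" by (auto elim: dvdE)
    then have "y = u * (r * y)" by (metis mult.assoc mult.commute mult.left_neutral)
    then show ?thesis using less.prems(4) by (metis dvd_mult)
  next
    case False
    then obtain \<rho> r' where \<rho>: "irreducible \<rho>" "r = \<rho> * r'" "\<rho> \<in> polys W" "r' \<in> polys W"
      "tdeg r' < tdeg r" "r' \<noteq> 0"
      using irreducible_divisor_W less.prems by metis
    have \<rho>0: "\<rho> \<noteq> 0" using \<rho>(1) by auto
    obtain c where c: "r * y = p * c" using less.prems(4) by (auto elim: dvdE)
    show ?thesis
    proof (cases "y = 0")
      case False
      then have "c \<in> polys V"
        using c less.prems polys_factor[of c p V] W_V
        by (metis mult.commute mult_eq_0_iff polys_mult)
      moreover have "\<rho> dvd p * c" using c \<rho>(2) by (metis dvd_triv_left mult.assoc)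
      ultimately have "\<rho> dvd c"
        using prime[OF \<rho>(3,1)] p \<rho> by (auto simp: prime_on_def)
      then obtain c' where "c = \<rho> * c'" by (auto elim: dvdE)
      then have "\<rho> * (r' * y) = \<rho> * (p * c')" using c \<rho>(2) by (simp add: ac_simps)
      then have "p dvd r' * y" using \<rho>0 by simp
      then show ?thesis using less.hyps[OF \<rho>(5,4,6)] less.prems by blast
    qed simp
  qed
qed

text \<open>Over the fraction field of K[W] the ideal generated by \<open>p\<close> and
  \<open>a\<close> would be principal. Pseudo-division yields a generator \<open>m\<close> up to
  factors from \<open>polys W\<close>, and irreducibility of \<open>p\<close> leaves two cases:
  \<open>m\<close> is free of \<open>x\<close>, or \<open>m\<close> is \<open>p\<close> up to such
  factors.\<close>

lemma irreducible_imp_prime_on: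
  fixes p :: "('v, 'k) mpoly"
  assumes p: "p \<in> polys V" "irreducible p"
  shows "prime_on V p"
proof (cases "dg x p = 0")
  case True
  then have "p \<in> polys W"
    using dg_zero_polys[OF p(1) True] x by (simp add: V_def)
  then show ?thesis using prime p by blast
next
  case False
  have p0: "p \<noteq> 0" using p by auto
  have prim: "\<not> \<rho> dvd p" if \<rho>: "\<rho> \<in> polys W" "irreducible \<rho>" for \<rho>
  proof
    assume "\<rho> dvd p"
    then obtain k where k: "p = \<rho> * k" by (auto elim: dvdE)
    then have "k dvd 1" using p(2) \<rho>(2) by (auto simp: irreducible_def)
    then have "k \<in> polys W" by (rule polys_dvd) auto
    then have "dg x p = 0" using k p0 \<rho> by (auto simp: dg_mult dg_W)
    with False show False by simp
  qed
  show ?thesis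
    unfolding prime_on_def
  proof (intro ballI impI)
    fix a b assume a: "a \<in> polys V" and b: "b \<in> polys V" and ab: "p dvd a * b"
    show "p dvd a \<or> p dvd b"
    proof (rule ccontr)
      assume contr: "\<not> (p dvd a \<or> p dvd b)"
      define I where "I = {u * p + v * a | u v. u \<in> polys V \<and> v \<in> polys V}"
      have I_V: "y \<in> polys V" if "y \<in> I" for y
        using that p(1) a by (auto simp: I_def intro!: polys_intros)
      have I_diff: "s * y - t * z \<in> I" if "y \<in> I" "z \<in> I" "s \<in> polys V" "t \<in> polys V" for s t y z
      proof -
        obtain u v u' v' where "y = u * p + v * a" "z = u' * p + v' * a"
          and uv: "u \<in> polys V" "v \<in> polys V" "u' \<in> polys V" "v' \<in> polys V"
          using \<open>y \<in> I\<close> \<open>z \<in> I\<close> unfolding I_def by blast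
        then have "s * y - t * z = (s * u - t * u') * p + (s * v - t * v') * a"
          by (simp add: algebra_simps)
        then show ?thesis
          unfolding I_def using uv that by (blast intro: polys_intros)
      qed
      have "1 * p + 0 * a \<in> I" unfolding I_def using polys_one polys_zero by blast
      then have pI: "p \<in> I" by simp
      have "0 * p + 1 * a \<in> I" unfolding I_def using polys_one polys_zero by blast
      then have aI: "a \<in> I" by simp
      \<comment> \<open>An element of least degree in \<open>x\<close> plays the role of the gcd of
        \<open>p\<close> and \<open>a\<close> over the fraction field.\<close>
      obtain m where m: "m \<in> I" "m \<noteq> 0" and min: "\<And>y. y \<in> I \<Longrightarrow> y \<noteq> 0 \<Longrightarrow> dg x m \<le> dg x y"
        using ex_has_least_nat[of "\<lambda>y. y \<in> I \<and> y \<noteq> 0" p "dg x"] pI p0 by blast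
      have V_W: "lc x y \<in> polys W" if "y \<in> polys V" for y :: "('v, 'k) mpoly"
        using lc_polys[OF that, of x] x by (auto simp: V_def)
      have reduce: "\<exists>r\<in>polys W. \<exists>t\<in>polys V. r \<noteq> 0 \<and> r * y = t * m" if "y \<in> I" for y
        using that
      proof (induction "dg x y" arbitrary: y rule: less_induct)
        case less
        show ?case
        proof (cases "y = 0")
          case True
          then show ?thesis by (intro bexI[of _ 1] bexI[of _ 0]) auto
        next
          case False
          have le: "dg x m \<le> dg x y" by (rule min[OF less.prems False])
          \<comment> \<open>One step of pseudo-division: multiplying \<open>y\<close> by
            \<open>lc x m\<close> makes the leading terms of \<open>lc x m * y\<close> and
            \<open>l * m\<close> equal.\<close>
          define l where "l = lc x y * mvar x ^ (dg x y - dg x m)"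
          define y' where "y' = lc x m * y - l * m"
          have mV: "m \<in> polys V" and yV: "y \<in> polys V" using I_V m less.prems by auto
          have lV: "l \<in> polys V"
            unfolding l_def using W_V[OF V_W[OF yV]] by (auto intro!: polys_intros simp: V_def)
          have y'I: "y' \<in> I"
            unfolding y'_def using I_diff[OF less.prems m(1)] W_V[OF V_W[OF mV]] lV by blast
          have lcW: "dg x (lc x m) = 0" "dg x (lc x y) = 0"
            "lc x (lc x m) = lc x m" "lc x (lc x y) = lc x y"
            using V_W[OF mV] V_W[OF yV] lc_zero[of _ W x] x by (auto intro: dg_W)
          have "dg x (lc x m * y) = dg x y"
            using m False lcW by (simp add: dg_mult)
          moreover have "dg x (l * m) = dg x y"
            using m False lcW le by (simp add: l_def dg_mult dg_mvar)
          moreover have "lc x (lc x m * y) = lc x (l * m)"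
            using lcW by (simp add: l_def lc_mult lc_mvar)
          ultimately have "y' = 0 \<or> dg x y' < dg x y"
            unfolding y'_def using dg_diff_less[of x "lc x m * y" "l * m"] by auto
          then obtain r t where rt: "r \<in> polys W" "t \<in> polys V" "r \<noteq> 0" "r * y' = t * m"
            using less.hyps[OF _ y'I] by (metis mult_zero_left mult_zero_right polys_one polys_zero one_neq_zero)
          have "r * lc x m * y = (t + r * l) * m"
            using rt(4) by (simp add: y'_def algebra_simps)
          moreover have "r * lc x m \<in> polys W" "r * lc x m \<noteq> 0" "t + r * l \<in> polys V"
            using rt V_W[OF mV] m lV W_V by (auto intro!: polys_intros)
          ultimately show ?thesis by blast
        qed
      qed
      obtain r t where rt: "r \<in> polys W" "t \<in> polys V" "r \<noteq> 0" "r * p = t * m"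
        using reduce[OF pI] by blast
      obtain t' m' where tm: "p = t' * m'" "dg x t' = dg x t" "dg x m' = dg x m"
        using cancel_split[OF rt(1,3,2) I_V[OF m(1)] rt(4) p0] by blast
      have unit_dg: "dg x u = 0" if "u dvd 1" for u :: "('v, 'k) mpoly"
        using polys_dvd[OF that, of W] dg_W by auto
      have to_W: "y \<in> polys W" if "dg x y = 0" "y \<in> polys V" for y :: "('v, 'k) mpoly"
        using dg_zero_polys[OF that(2,1)] x by (simp add: V_def)
      \<comment> \<open>A unit has degree 0 in \<open>x\<close>, and \<open>t'\<close>,
        \<open>m'\<close> have the same degrees as \<open>t\<close>, \<open>m\<close>; so
        \<open>m\<close> or \<open>t\<close> lies in \<open>polys W\<close>. In the one case
        \<open>p\<close> divides \<open>m * b\<close>, in the other \<open>t * r' * a\<close>, and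
        \<open>cancel_primitive\<close> removes the factors from \<open>polys W\<close>.\<close>
      from p(2) tm(1) have "t' dvd 1 \<or> m' dvd 1" by (auto simp: irreducible_def)
      then show False
      proof
        assume "m' dvd 1"
        then have mW: "m \<in> polys W" using unit_dg tm(3) to_W I_V m(1) by metis
        obtain u v where "m = u * p + v * a" using m(1) by (auto simp: I_def)
        then have "m * b = u * b * p + v * (a * b)" by (simp add: algebra_simps)
        then have "p dvd m * b" using ab by (metis dvd_add dvd_mult dvd_triv_right)
        then have "p dvd b" using cancel_primitive[OF p(1) prim mW m(2) b] by blast
        then show False using contr by simp
      next
        assume "t' dvd 1"
        then have tW: "t \<in> polys W" using unit_dg tm(2) to_W rt(2) by metis
        have t0: "t \<noteq> 0" using rt p0 by auto
        obtain r' s where rs: "r' \<in> polys W" "s \<in> polys V" "r' \<noteq> 0" "r' * a = s * m"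
          using reduce[OF aI] by blast
        have "t * r' * a = t * (s * m)" using rs(4) by (simp add: mult.assoc)
        also have "\<dots> = s * (t * m)" by (simp add: ac_simps)
        also have "\<dots> = p * (s * r)" using rt(4) by (simp add: ac_simps)
        finally have "p dvd t * r' * a" by simp
        then have "p dvd a"
          using cancel_primitive[OF p(1) prim _ _ a, of "t * r'"] tW t0 rs by (auto intro: polys_mult)
        then show False using contr by simp
      qed
    qed
  qed
qed

end

lemma irreducible_imp_prime_on:
  fixes p :: "('v::linorder, 'k::field) mpoly"
  assumes "finite V" "p \<in> polys V" "irreducible p"
  shows "prime_on V p"
  using assms
proof (induction V arbitrary: p rule: finite_induct)
  case empty
  have "dg v p = 0" for v using empty.prems by (auto intro: dg_zero)
  have "p = mconst (meval (\<lambda>_. 0) p)"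
    by (rule rhom_eq_on_polys[OF empty.prems(1) rhom_id rhom_comp[OF rhom_mconst rhom_meval]]) auto
  moreover from this have "meval (\<lambda>_. 0) p \<noteq> 0"
    using empty.prems(2) by (metis not_irreducible_zero rhom.zero rhom_mconst)
  ultimately have "p dvd 1" by (metis mconst_dvd_1)
  then show ?case using empty.prems by (simp add: irreducible_def)
next
  case (insert x W)
  interpret gauss_step W x "insert x W"
    by unfold_locales (use insert in \<open>auto intro: prime_on_insert\<close>)
  show ?case by (rule irreducible_imp_prime_on) (use insert in auto)
qed

theorem irreducible_imp_prime_elem_mpoly:
  fixes p :: "('v::linorder, 'k::field) mpoly"
  assumes "irreducible p"
  shows "prime_elem p"
  unfolding prime_elem_def
proof (intro conjI allI impI)
  fix a b assume ab: "p dvd a * b"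
  let ?V = "mvars p \<union> mvars a \<union> mvars b"
  have "prime_on ?V p"
    by (rule irreducible_imp_prime_on) (auto simp: finite_mvars polys_def assms)
  then show "p dvd a \<or> p dvd b"
    using ab by (auto simp: prime_on_def polys_def)
qed (use assms in \<open>auto simp: irreducible_def\<close>)

section \<open>Prime divisors and the rational root theorem\<close>

lemma prime_elem_dvd_mult_iff: "prime_elem p \<Longrightarrow> p dvd a * b \<longleftrightarrow> p dvd a \<or> p dvd b"
  for p :: "'a::comm_semiring_1"
  by (auto simp: prime_elem_def)

lemma prime_elem_power: "prime_elem p \<Longrightarrow> p dvd a ^ n \<Longrightarrow> p dvd a"
  for p :: "'a::comm_semiring_1"
  by (induction n) (auto simp: prime_elem_def)

lemma prime_elem_prod: "prime_elem p \<Longrightarrow> p dvd prod f S \<Longrightarrow> \<exists>i\<in>S. p dvd f i"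
  for p :: "'a::comm_semiring_1"
  by (induction S rule: infinite_finite_induct) (auto simp: prime_elem_def)

text \<open>Coprimality of \<open>Q\<close> and \<open>P\<close> is expressed through irreducible
  divisors, which are prime; they are moved from \<open>Q\<close> into \<open>c\<close> one by
  one.\<close>

lemma dvd_mult_no_common_irreducible:
  fixes Q c P :: "('v::linorder, 'k::field) mpoly"
  assumes "Q dvd c * P ^ r" "Q \<noteq> 0" "\<And>q. irreducible q \<Longrightarrow> q dvd Q \<Longrightarrow> \<not> q dvd P"
  shows "Q dvd c"
  using assms
proof (induction "tdeg Q" arbitrary: Q c rule: less_induct)
  case less
  show ?case
  proof (cases "Q dvd 1")
    case True
    then show ?thesis using dvd_trans one_dvd by blast
  next
    case False
    then obtain q where q: "irreducible q" "q dvd Q"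
      using irreducible_divisor_exists less.prems by blast
    then obtain Q' where Q': "Q = q * Q'" by (auto elim: dvdE)
    have n0: "q \<noteq> 0" "Q' \<noteq> 0" using less.prems Q' by auto
    have prime: "prime_elem q" by (rule irreducible_imp_prime_elem_mpoly[OF q(1)])
    have "\<not> q dvd P" using less.prems q by blast
    then have "q dvd c"
      using prime_elem_dvd_mult_iff[OF prime] prime_elem_power[OF prime] dvd_trans[OF q(2) less.prems(1)]
      by blast
    then obtain c' where c': "c = q * c'" by (auto elim: dvdE)
    have "Q' dvd c' * P ^ r" using less.prems(1) Q' c' n0 by (simp add: mult.assoc)
    moreover have "tdeg Q' < tdeg Q"
      using q(1) n0 by (auto simp: Q' tdeg_mult irreducible_def dvd_1_iff_tdeg)
    moreover have "\<not> q' dvd P" if "irreducible q'" "q' dvd Q'" for q'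
      using less.prems(3)[OF that(1)] that(2) Q' by auto
    ultimately have "Q' dvd c'" using less.hyps n0 by blast
    then show ?thesis by (simp add: Q' c')
  qed
qed

text \<open>The rational root theorem with denominators cleared: \<open>P/Q\<close> is a root of the polynomial with
  coefficients \<open>c i\<close>.\<close>

lemma rational_root:
  fixes P Q :: "('v::linorder, 'k::field) mpoly"
  assumes "(\<Sum>i\<le>r. c i * P ^ i * Q ^ (r - i)) = 0" "Q \<noteq> 0"
  shows "Q dvd c r * P"
  using assms
proof (induction "tdeg Q" arbitrary: P Q rule: less_induct)
  case less
  show ?case
  proof (cases "\<exists>q. irreducible q \<and> q dvd Q \<and> q dvd P")
    \<comment> \<open>The factor \<open>P\<close> in the conclusion makes it stable under a common
      factor of \<open>P\<close> and \<open>Q\<close>, so the fraction may be reduced.\<close>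
    case True
    then obtain q P' Q' where q: "irreducible q" and P': "P = q * P'" and Q': "Q = q * Q'"
      by (auto elim!: dvdE)
    have n0: "q \<noteq> 0" "Q' \<noteq> 0" using less.prems Q' by auto
    have "q ^ r * (\<Sum>i\<le>r. c i * P' ^ i * Q' ^ (r - i)) = (\<Sum>i\<le>r. c i * P ^ i * Q ^ (r - i))"
      unfolding sum_distrib_left
    proof (rule sum.cong[OF refl])
      fix i assume "i \<in> {..r}"
      then have "q ^ r = q ^ i * q ^ (r - i)" by (simp flip: power_add)
      then show "q ^ r * (c i * P' ^ i * Q' ^ (r - i)) = c i * P ^ i * Q ^ (r - i)"
        by (simp add: P' Q' power_mult_distrib ac_simps)
    qed
    then have "(\<Sum>i\<le>r. c i * P' ^ i * Q' ^ (r - i)) = 0" using less.prems n0 by simp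
    moreover have "tdeg Q' < tdeg Q"
      using q n0 by (auto simp: Q' tdeg_mult irreducible_def dvd_1_iff_tdeg)
    ultimately have "Q' dvd c r * P'" using less.hyps n0 by blast
    then show ?thesis by (simp add: P' Q' mult.left_commute)
  next
    case False
    \<comment> \<open>All terms but the one with \<open>i = r\<close> contain \<open>Q\<close>, so
      \<open>Q\<close> divides \<open>c r * P ^ r\<close> as well.\<close>
    have "Q dvd (\<Sum>i<r. c i * P ^ i * Q ^ (r - i))"
      by (intro dvd_sum dvd_mult) (simp add: dvd_power)
    moreover have "(\<Sum>i<r. c i * P ^ i * Q ^ (r - i)) = - (c r * P ^ r)"
      using less.prems(1) by (simp add: eq_neg_iff_add_eq_0 flip: lessThan_Suc_atMost)
    ultimately have "Q dvd c r * P ^ r" by simp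
    then have "Q dvd c r"
      by (rule dvd_mult_no_common_irreducible) (use less.prems False in auto)
    then show ?thesis by simp
  qed
qed

section \<open>Polynomials as functions\<close>

lemma meval_fun_upd:
  fixes p :: "('v, 'k::comm_ring_1) mpoly"
  assumes "p \<in> polys (insert v W)" "v \<notin> W"
  shows "meval (x(v := t)) p = (\<Sum>i\<le>dg v p. meval x (coeff (sep v p) i) * t ^ i)"
proof -
  have c: "meval (x(v := t)) (coeff (sep v p) i) = meval x (coeff (sep v p) i)" for i
    by (rule meval_cong[OF coeff_sep_polys[OF assms(1)]]) (use assms(2) in auto)
  have "p = (\<Sum>i\<le>dg v p. coeff (sep v p) i * mvar v ^ i)"
    unfolding dg_def by (subst poly_altdef[symmetric]) simp
  then have "meval (x(v := t)) p = meval (x(v := t)) (\<Sum>i\<le>dg v p. coeff (sep v p) i * mvar v ^ i)"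
    by simp
  then show ?thesis by (simp only: meval_hom meval_mvar c fun_upd_same)
qed

text \<open>A point where the leading coefficient in \<open>v\<close> does not vanish leaves a
  nonzero univariate polynomial, and a field of characteristic 0 is infinite.\<close>

lemma nonzero_value_exists:
  fixes p :: "('v, 'k::field_char_0) mpoly"
  assumes "finite V" "p \<in> polys V" "p \<noteq> 0"
  shows "\<exists>x\<in>vecs V. meval x p \<noteq> 0"
  using assms
proof (induction V arbitrary: p rule: finite_induct)
  case empty
  have "p = mconst (meval (\<lambda>_. 0) p)"
    by (rule rhom_eq_on_polys[OF empty.prems(1) rhom_id rhom_comp[OF rhom_mconst rhom_meval]]) auto
  then have "meval (\<lambda>_. 0) p \<noteq> 0" using empty.prems(2) by (metis rhom.zero rhom_mconst)
  then show ?case by (auto simp: vecs_def)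
next
  case (insert v W)
  have "lc v p \<in> polys W" "lc v p \<noteq> 0"
    using lc_polys[OF insert.prems(1), of v] insert by auto
  then obtain x where x: "x \<in> vecs W" "meval x (lc v p) \<noteq> 0" using insert.IH by blast
  define q where "q = (\<Sum>i\<le>dg v p. monom (meval x (coeff (sep v p) i)) i)"
  have "coeff q (dg v p) = meval x (lc v p)"
    by (simp add: q_def coeff_sum lc_def dg_def)
  then have "q \<noteq> 0" using x by auto
  then obtain t where "poly q t \<noteq> 0" using poly_all_0_iff_0 by blast
  then have "meval (x(v := t)) p \<noteq> 0"
    using insert by (simp add: meval_fun_upd[of p v W] q_def poly_sum poly_monom)
  moreover have "x(v := t) \<in> vecs (insert v W)" using x by (auto simp: vecs_def)
  ultimately show ?case by blast
qed

text \<open>The difference times \<open>mvar v\<close> vanishes everywhere. This form is used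
  because \<open>f\<close> and the logarithmic coordinates are controlled only where z_0 is
  nonzero.\<close>

lemma mpoly_eqI_nonzero:
  fixes p q :: "('v::linorder, 'k::field_char_0) mpoly"
  assumes "finite V" "v \<in> V" "p \<in> polys V" "q \<in> polys V"
    and "\<And>x. x \<in> vecs V \<Longrightarrow> x v \<noteq> 0 \<Longrightarrow> meval x p = meval x q"
  shows "p = q"
proof (rule ccontr)
  assume "p \<noteq> q"
  then have "mvar v * (p - q) \<noteq> 0" by simp
  moreover have "mvar v * (p - q) \<in> polys V" using assms by (auto intro!: polys_intros)
  ultimately obtain x where "x \<in> vecs V" "meval x (mvar v * (p - q)) \<noteq> 0"
    using nonzero_value_exists[OF assms(1)] by blast
  then show False using assms(5)[of x] by auto
qed

lemma meval_scaled:
  "meval (\<lambda>i. c * x i) p = (\<Sum>j\<le>tdeg p. meval x (coeff (grade p) j) * c ^ j)"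
  for p :: "('v, 'k::comm_ring_1) mpoly"
proof -
  have "meval (\<lambda>i. c * x i) p = meval x (poly (grade p) (mconst c))"
    by (rule rhom_eqI[where p = p, OF rhom_meval
          rhom_comp[OF rhom_meval rhom_comp[OF rhom_poly rhom_grade]]])
      (auto simp: poly_monom)
  then show ?thesis by (simp add: poly_altdef tdeg_def)
qed

lemma meval_homogeneous:
  fixes p :: "('v, 'k::comm_ring_1) mpoly"
  assumes "homogeneous e p"
  shows "meval (\<lambda>i. c * x i) p = c ^ e * meval x p"
proof (cases "p = 0")
  case False
  have "meval x (coeff (grade p) j) * c ^ j = (if j = e then c ^ e * meval x p else 0)" for j
    using assms by (auto simp: homogeneous_iff_grade)
  then show ?thesis
    using tdeg_homogeneous[OF assms False] by (simp add: meval_scaled)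
qed simp

text \<open>Reduction modulo the variable \<open>x\<close>, with residue classes represented by
  polynomials free of \<open>x\<close>; accordingly \<open>sub0 x p = p\<close> is used to say that
  \<open>p\<close> is free of \<open>x\<close>.\<close>

definition sub0 :: "'v \<Rightarrow> ('v, 'k::comm_ring_1) mpoly \<Rightarrow> ('v, 'k) mpoly" where
  "sub0 x = subst (\<lambda>v. if v = x then 0 else mvar v)"

lemma rhom_sub0: "rhom (sub0 x)"
  unfolding sub0_def by (rule rhom_subst)

lemmas sub0_hom [simp] = rhom.hom_simps[OF rhom_sub0]

lemma sub0_mvar [simp]: "sub0 x (mvar v) = (if v = x then 0 else mvar v)"
  by (simp add: sub0_def)

lemma sub0_mconst [simp]: "sub0 x (mconst c) = mconst c"
  by (simp add: sub0_def)

lemma sub0_ident: "p \<in> polys V \<Longrightarrow> x \<notin> V \<Longrightarrow> sub0 x p = p"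
  unfolding sub0_def by (rule subst_ident) auto

lemma sub0_polys: "p \<in> polys V \<Longrightarrow> sub0 x p \<in> polys (V - {x})"
  unfolding sub0_def by (rule polys_subst) auto

lemma meval_sub0: "x v = 0 \<Longrightarrow> meval x (sub0 v p) = meval x p"
  unfolding sub0_def meval_subst by (rule arg_cong[where f = "\<lambda>y. meval y p"]) auto

lemma mvar_dvd_diff_sub0: "mvar x dvd p - sub0 x p"
  using polys_mvars[of p]
proof (induction rule: polys_induct)
  case (add p q)
  then show ?case by (simp add: add_diff_add)
next
  case (mult p q)
  have "p * q - sub0 x p * sub0 x q = (p - sub0 x p) * q + sub0 x p * (q - sub0 x q)"
    by (simp add: algebra_simps)
  then show ?case using mult by simp
qed auto

lemma sub0_decomp: obtains E where "p = sub0 x p + mvar x * E"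
  using mvar_dvd_diff_sub0[of x p] by (metis add.commute diff_add_cancel dvdE)

lemma mvar_dvd_iff: "mvar x dvd p \<longleftrightarrow> sub0 x p = 0"
  using mvar_dvd_diff_sub0[of x p] by (auto elim!: dvdE)

lemma prime_elem_mvar: "prime_elem (mvar x :: ('v::linorder, 'k::field) mpoly)"
  by (auto simp: prime_elem_def mvar_dvd_iff)

section \<open>Denominators at points with vanishing first coordinate\<close>

lemma prime_power_dvd_cancel:
  fixes p :: "'a::idom"
  assumes "prime_elem p" "\<not> p dvd y" "p ^ n dvd y * k"
  shows "p ^ n dvd k"
  using assms(3)
proof (induction n arbitrary: k)
  case (Suc n)
  have "p dvd p ^ Suc n" by simp
  then have "p dvd y * k" using Suc.prems by (rule dvd_trans)
  then have "p dvd k" using assms(1,2) by (simp add: prime_elem_dvd_mult_iff)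
  then obtain k' where k': "k = p * k'" by (rule dvdE)
  have "p \<noteq> 0" using assms(1) by auto
  then have "p ^ n dvd y * k'" using Suc.prems by (simp add: k' mult.left_commute)
  then have "p ^ n dvd k'" by (rule Suc.IH)
  then show ?case by (simp add: k')
qed simp

lemma prod_prime_powers_dvd:
  fixes p :: "'i \<Rightarrow> 'a::idom"
  assumes "finite S" "\<And>i. i \<in> S \<Longrightarrow> prime_elem (p i)" "\<And>i. i \<in> S \<Longrightarrow> p i ^ a i dvd y"
    and "\<And>i j. i \<in> S \<Longrightarrow> j \<in> S \<Longrightarrow> i \<noteq> j \<Longrightarrow> \<not> p i dvd p j"
  shows "(\<Prod>i\<in>S. p i ^ a i) dvd y"
  using assms
proof (induction S rule: finite_induct)
  case (insert j S)
  have "(\<Prod>i\<in>S. p i ^ a i) dvd y"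
    by (rule insert.IH) (use insert.prems in auto)
  then obtain k where k: "y = (\<Prod>i\<in>S. p i ^ a i) * k" by (rule dvdE)
  have "\<not> p j dvd (\<Prod>i\<in>S. p i ^ a i)"
  proof
    assume "p j dvd (\<Prod>i\<in>S. p i ^ a i)"
    then obtain i where "i \<in> S" "p j dvd p i ^ a i"
      using insert.prems prime_elem_prod[of "p j" "\<lambda>i. p i ^ a i" S] by auto
    then have "p j dvd p i" using insert.prems prime_elem_power[of "p j" "p i"] by simp
    then show False using insert.prems(3)[of j i] \<open>i \<in> S\<close> insert.hyps by auto
  qed
  moreover have "p j ^ a j dvd (\<Prod>i\<in>S. p i ^ a i) * k" "prime_elem (p j)"
    unfolding k[symmetric] using insert.prems(1,2) by simp_all
  ultimately have "p j ^ a j dvd k" using prime_power_dvd_cancel by blast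
  then have "(\<Prod>i\<in>S. p i ^ a i) * p j ^ a j dvd y" unfolding k by (rule mult_dvd_mono[OF dvd_refl])
  then show ?case using insert.hyps by (simp add: mult.commute)
qed simp

lemma prime_multiplicity_split:
  fixes p :: "('v::linorder, 'k::field) mpoly"
  assumes "prime_elem p" "y \<noteq> 0"
  obtains c s where "y = p ^ c * s" "\<not> p dvd s"
proof -
  have "\<exists>c s. y = p ^ c * s \<and> \<not> p dvd s"
    using assms(2)
  proof (induction "tdeg y" arbitrary: y rule: less_induct)
    case less
    show ?case
    proof (cases "p dvd y")
      case True
      then obtain y' where y': "y = p * y'" by (rule dvdE)
      have n0: "p \<noteq> 0" "y' \<noteq> 0" using y' less.prems by auto
      then have "tdeg y' < tdeg y"
        using assms(1) by (auto simp: y' tdeg_mult prime_elem_def dvd_1_iff_tdeg)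
      then obtain c s where "y' = p ^ c * s" "\<not> p dvd s" using less.hyps n0 by blast
      then have "y = p ^ Suc c * s \<and> \<not> p dvd s" by (simp add: y' mult.assoc)
      then show ?thesis by blast
    next
      case False
      then show ?thesis by (intro exI[of _ 0] exI[of _ y]) simp
    qed
  qed
  then show thesis using that by blast
qed

lemma dvd_power_cong: "f dvd a - b \<Longrightarrow> f dvd a ^ n - b ^ n" for f :: "'a::comm_ring_1"
proof (induction n)
  case (Suc n)
  have "a ^ Suc n - b ^ Suc n = a * (a ^ n - b ^ n) + (a - b) * b ^ n"
    by (simp add: algebra_simps)
  then show ?case using Suc by simp
qed simp

lemma dvd_of_dvd_diff: "f dvd a \<Longrightarrow> f dvd a - b \<Longrightarrow> f dvd b" for f :: "'a::comm_ring_1"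
  using dvd_diff[of f a "a - b"] by simp

text \<open>Here \<open>Fd\<close> is the part of \<open>f\<close> free of \<open>x0\<close>, and
  \<open>sub0 x0 D\<close> is the polynomial called f_{d-1} in the theorem. The point
  \<open>ev\<close> lies on \<open>x0 = 0\<close>. Only primes of multiplicity at least 2 in
  \<open>Fd\<close> restrict \<open>D\<close>, since exactly these survive division by the product
  of the distinct primes.\<close>

locale initial_form =
  fixes x0 :: "'v::linorder" and f Fd D :: "('v, 'k::field) mpoly"
    and S :: "'i set" and p :: "'i \<Rightarrow> ('v, 'k) mpoly" and a :: "'i \<Rightarrow> nat"
    and ev :: "'v \<Rightarrow> 'k"
  assumes f_prime: "prime_elem f" and f_eq: "f = Fd + mvar x0 * D"
    and Fd_free: "sub0 x0 Fd = Fd" and Fd_nz: "Fd \<noteq> 0"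
    and fin: "finite S" and Fd_factor: "Fd = (\<Prod>i\<in>S. p i ^ a i)"
    and p_free: "\<And>i. i \<in> S \<Longrightarrow> sub0 x0 (p i) = p i"
    and p_prime: "\<And>i. i \<in> S \<Longrightarrow> prime_elem (p i)"
    and p_distinct: "\<And>i j. i \<in> S \<Longrightarrow> j \<in> S \<Longrightarrow> i \<noteq> j \<Longrightarrow> \<not> p i dvd p j"
    and a_pos: "\<And>i. i \<in> S \<Longrightarrow> 0 < a i"
    and coprime: "\<And>i. i \<in> S \<Longrightarrow> 2 \<le> a i \<Longrightarrow> \<not> p i dvd sub0 x0 D"
    and ev0: "ev x0 = 0"
begin

text \<open>Together with primality of \<open>f\<close> this allows cancelling \<open>x0\<close>
  modulo \<open>f\<close>.\<close>

lemma f_not_dvd_mvar: "\<not> f dvd mvar x0"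
proof
  assume "f dvd mvar x0"
  then obtain k where k: "mvar x0 = f * k" by (rule dvdE)
  then have "sub0 x0 f * sub0 x0 k = 0" by (metis sub0_hom(2) sub0_mvar)
  then have "mvar x0 dvd k" using Fd_nz by (simp add: f_eq Fd_free mvar_dvd_iff)
  then obtain k' where "k = mvar x0 * k'" by (rule dvdE)
  then have "mvar x0 * 1 = mvar x0 * (f * k')" using k by (simp add: ac_simps)
  then have "1 = f * k'" by (simp only: mult_cancel_left mvar_neq_0) simp
  then have "f dvd 1" by (rule dvdI)
  then show False using f_prime by (simp add: prime_elem_def)
qed

text \<open>The assumption says that \<open>P/x0\<close> is integral over the local ring at \<open>ev\<close>. Let \<open>p i\<^sup>c\<close> be the
  exact power dividing \<open>P\<close> modulo \<open>x0\<close>. The relation \<open>Fd = - x0 D\<close> modulo \<open>f\<close> trades the denominator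
  \<open>x0\<close> for a power of \<open>p i\<close>: if \<open>c < a i\<close>, a multiple of \<open>P/x0\<close> has a simple pole along \<open>p i = 0\<close>,
  which an integral element cannot have.\<close>

lemma prime_power_dvd_numerator:
  assumes int: "f dvd (\<Sum>j\<le>r. C j * mvar x0 ^ (r - j) * P ^ j)"
    and Cr: "meval ev (C r) \<noteq> 0" and i: "i \<in> S" and evp: "meval ev (p i) = 0"
  shows "p i ^ a i dvd sub0 x0 P"
proof (rule ccontr)
  assume contr: "\<not> p i ^ a i dvd sub0 x0 P"
  let ?B = "sub0 x0" and ?z = "mvar x0 :: ('v, 'k) mpoly"
  have prime: "prime_elem (p i)" by (rule p_prime[OF i])
  have p0: "p i \<noteq> 0" using prime by auto
  have dvdFd: "p i ^ a i dvd Fd" unfolding Fd_factor using fin i by (rule dvd_prodI)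
  then obtain u where u: "Fd = p i ^ a i * u" by (rule dvdE)
  have pFd: "p i dvd Fd" using dvdFd a_pos[OF i] by (metis dvd_power dvd_trans)
  have not_dvd_C: "\<not> p i dvd ?B (C r)"
  proof
    assume "p i dvd ?B (C r)"
    then have "meval ev (p i) dvd meval ev (?B (C r))" by (rule rhom.dvd[OF rhom_meval])
    then show False using evp Cr by (simp add: meval_sub0 ev0)
  qed
  \<comment> \<open>Modulo \<open>x0\<close> only the leading term of the integral equation remains,
    and \<open>f\<close> becomes \<open>Fd\<close>. As \<open>p i\<close> vanishes at
    \<open>ev\<close> and \<open>C r\<close> does not, \<open>p i\<close> divides \<open>P\<close>
    modulo \<open>x0\<close>.\<close>
  have "Fd dvd ?B (\<Sum>j\<le>r. C j * ?z ^ (r - j) * P ^ j)"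
    using rhom.dvd[OF rhom_sub0[of x0] int] by (simp add: f_eq Fd_free)
  also have "?B (\<Sum>j\<le>r. C j * ?z ^ (r - j) * P ^ j) =
      (\<Sum>j\<le>r. if j = r then ?B (C r) * ?B P ^ r else 0)"
    unfolding sub0_hom sub0_mvar by (rule sum.cong) (auto simp: power_0_left)
  finally have "Fd dvd ?B (C r) * ?B P ^ r" by simp
  then have "p i dvd ?B P"
    using pFd not_dvd_C prime_elem_dvd_mult_iff[OF prime] prime_elem_power[OF prime] dvd_trans by blast
  moreover have BP0: "?B P \<noteq> 0" using contr by auto
  ultimately obtain c s where s: "?B P = p i ^ c * s" "\<not> p i dvd s"
    using prime_multiplicity_split[OF prime] by blast
  have c0: "0 < c" using \<open>p i dvd ?B P\<close> s by (cases c) auto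
  have ca: "c < a i"
  proof (rule ccontr)
    assume "\<not> c < a i"
    then have "p i ^ a i dvd p i ^ c" by (simp add: le_imp_power_dvd)
    then show False using contr s by simp
  qed
  have "?B (?B P) = ?B P" by (rule sub0_ident[OF sub0_polys[OF polys_mvars]]) simp
  then have "p i ^ c * ?B s = p i ^ c * s" by (simp add: s p_free[OF i])
  then have Bs: "?B s = s" using p0 by simp
  have "p i ^ a i * ?B u = p i ^ a i * u" using Fd_free by (simp add: u p_free[OF i])
  then have Bu: "?B u = u" using p0 by simp
  obtain E where E: "P = ?B P + ?z * E" by (rule sub0_decomp)
  \<comment> \<open>The choice gives \<open>\<beta> * p i ^ c = Fd\<close>, so modulo
    \<open>f\<close> the part \<open>\<beta> * ?B P = Fd * s\<close> equals
    \<open>- x0 * D * s\<close>. Hence \<open>\<beta> * P\<close> is congruent to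
    \<open>x0 * Y\<close>: the fraction P/x0 is also Y/\<beta>, with a denominator divisible by
    \<open>p i\<close> because \<open>c < a i\<close>.\<close>
  define \<beta> where "\<beta> = p i ^ (a i - c) * u"
  define Y where "Y = \<beta> * E - D * s"
  have B\<beta>: "?B \<beta> = \<beta>" by (simp add: \<beta>_def p_free[OF i] Bu)
  have p\<beta>: "p i dvd \<beta>" using ca by (simp add: \<beta>_def)
  have "\<beta> * p i ^ c = Fd"
    using ca by (simp add: \<beta>_def u ac_simps flip: power_add)
  then have "\<beta> * ?B P = Fd * s" by (simp add: s flip: mult.assoc)
  then have "\<beta> * P - ?z * Y = f * s"
    by (subst E) (simp add: Y_def f_eq algebra_simps)
  then have cong: "f dvd \<beta> * P - ?z * Y" by simp
  \<comment> \<open>The integral equation is multiplied by \<open>\<beta> ^ r\<close>,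
    \<open>\<beta> * P\<close> is replaced by \<open>x0 * Y\<close>, and the common factor
    \<open>x0 ^ r\<close> cancels modulo the prime \<open>f\<close>. What remains is the integral
    equation for Y/\<beta>.\<close>
  have "f dvd (\<Sum>j\<le>r. C j * (\<beta> * ?z) ^ (r - j) * (\<beta> * P) ^ j)"
  proof -
    have "(\<Sum>j\<le>r. C j * (\<beta> * ?z) ^ (r - j) * (\<beta> * P) ^ j)
        = \<beta> ^ r * (\<Sum>j\<le>r. C j * ?z ^ (r - j) * P ^ j)"
      unfolding sum_distrib_left
    proof (rule sum.cong[OF refl])
      fix j assume "j \<in> {..r}"
      then have "\<beta> ^ r = \<beta> ^ (r - j) * \<beta> ^ j" by (simp flip: power_add)
      then show "C j * (\<beta> * ?z) ^ (r - j) * (\<beta> * P) ^ j = \<beta> ^ r * (C j * ?z ^ (r - j) * P ^ j)"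
        by (simp add: power_mult_distrib ac_simps)
    qed
    then show ?thesis using int by simp
  qed
  moreover have "f dvd (\<Sum>j\<le>r. C j * (\<beta> * ?z) ^ (r - j) * (\<beta> * P) ^ j)
      - (\<Sum>j\<le>r. C j * (\<beta> * ?z) ^ (r - j) * (?z * Y) ^ j)"
    unfolding sum_subtractf[symmetric] right_diff_distrib[symmetric]
    by (intro dvd_sum dvd_mult dvd_power_cong cong)
  ultimately have "f dvd (\<Sum>j\<le>r. C j * (\<beta> * ?z) ^ (r - j) * (?z * Y) ^ j)"
    by (rule dvd_of_dvd_diff)
  also have "(\<Sum>j\<le>r. C j * (\<beta> * ?z) ^ (r - j) * (?z * Y) ^ j)
      = ?z ^ r * (\<Sum>j\<le>r. C j * \<beta> ^ (r - j) * Y ^ j)"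
    unfolding sum_distrib_left
  proof (rule sum.cong[OF refl])
    fix j assume "j \<in> {..r}"
    then have "?z ^ r = ?z ^ (r - j) * ?z ^ j" by (simp flip: power_add)
    then show "C j * (\<beta> * ?z) ^ (r - j) * (?z * Y) ^ j = ?z ^ r * (C j * \<beta> ^ (r - j) * Y ^ j)"
      by (simp add: power_mult_distrib ac_simps)
  qed
  finally have "f dvd (\<Sum>j\<le>r. C j * \<beta> ^ (r - j) * Y ^ j)"
    using f_not_dvd_mvar prime_elem_dvd_mult_iff[OF f_prime] prime_elem_power[OF f_prime] by blast
  \<comment> \<open>Modulo \<open>x0\<close> and \<open>p i\<close> all terms containing \<beta>
    vanish, so \<open>p i\<close> divides \<open>Y\<close>, hence \<open>D * s\<close>, modulo
    \<open>x0\<close>.\<close>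
  then have "Fd dvd ?B (\<Sum>j\<le>r. C j * \<beta> ^ (r - j) * Y ^ j)"
    using rhom.dvd[OF rhom_sub0[of x0], of f] by (simp add: f_eq Fd_free del: sub0_hom(7))
  then have "p i dvd (\<Sum>j\<le>r. ?B (C j) * \<beta> ^ (r - j) * ?B Y ^ j)"
    using dvd_trans[OF pFd] by (simp add: B\<beta>)
  moreover have "p i dvd (\<Sum>j<r. ?B (C j) * \<beta> ^ (r - j) * ?B Y ^ j)"
  proof (rule dvd_sum)
    fix j assume "j \<in> {..<r}"
    then have "p i dvd \<beta> ^ (r - j)" by (intro dvd_trans[OF p\<beta> dvd_power]) auto
    then show "p i dvd ?B (C j) * \<beta> ^ (r - j) * ?B Y ^ j" by (rule dvd_mult2[OF dvd_mult])
  qed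
  ultimately have "p i dvd ?B (C r) * ?B Y ^ r"
    by (simp add: dvd_add_right_iff flip: lessThan_Suc_atMost)
  then have "p i dvd ?B Y"
    using not_dvd_C prime_elem_dvd_mult_iff[OF prime] prime_elem_power[OF prime] by blast
  then have "p i dvd \<beta> * ?B E - ?B Y" using p\<beta> by (intro dvd_diff) auto
  then have "p i dvd ?B D * s" by (simp add: Y_def B\<beta> Bs)
  then have "p i dvd ?B D" using s prime_elem_dvd_mult_iff[OF prime] by blast
  \<comment> \<open>Because \<open>0 < c < a i\<close>, the prime is a multiple factor of
    \<open>Fd\<close>, where the coprimality assumption applies.\<close>
  moreover have "2 \<le> a i" using c0 ca by simp
  ultimately show False using coprime[OF i] by blast
qed

text \<open>The conclusion says that P/x0 is regular at \<open>ev\<close>. The primes of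
  \<open>Fd\<close> through \<open>ev\<close> divide \<open>P\<close> modulo \<open>x0\<close> with
  full multiplicity, and the remaining ones form the unit \<open>T\<close> at \<open>ev\<close>. So
  \<open>T * P\<close> is a multiple of \<open>Fd\<close> modulo \<open>x0\<close>, and
  \<open>Fd\<close> is congruent to \<open>- x0 * D\<close> modulo \<open>f\<close>.\<close>

lemma clear_pole:
  assumes int: "f dvd (\<Sum>j\<le>r. C j * mvar x0 ^ (r - j) * P ^ j)"
    and Cr: "meval ev (C r) \<noteq> 0"
  shows "\<exists>T W. meval ev T \<noteq> 0 \<and> f dvd T * P - mvar x0 * W"
proof -
  let ?B = "sub0 x0" and ?z = "mvar x0 :: ('v, 'k) mpoly"
  define S0 where "S0 = {i\<in>S. meval ev (p i) = 0}"
  define T where "T = (\<Prod>i\<in>S - S0. p i ^ a i)"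
  have "meval ev T \<noteq> 0" unfolding T_def using fin by (auto simp: S0_def)
  moreover have "(\<Prod>i\<in>S0. p i ^ a i) dvd ?B P"
  proof (rule prod_prime_powers_dvd)
    fix i assume "i \<in> S0"
    then show "p i ^ a i dvd ?B P"
      using prime_power_dvd_numerator[OF int Cr, of i] by (auto simp: S0_def)
  qed (use fin p_prime p_distinct in \<open>auto simp: S0_def\<close>)
  then obtain k where k: "?B P = (\<Prod>i\<in>S0. p i ^ a i) * k" by (rule dvdE)
  have "Fd = T * (\<Prod>i\<in>S0. p i ^ a i)"
    unfolding Fd_factor T_def using fin by (intro prod.subset_diff) (auto simp: S0_def)
  then have TB: "T * ?B P = Fd * k" by (simp add: k)
  obtain E where E: "P = ?B P + ?z * E" by (rule sub0_decomp)
  have "T * P = Fd * k + T * ?z * E" by (subst E) (simp add: TB algebra_simps)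
  then have "T * P - ?z * (T * E - D * k) = f * k" by (simp add: f_eq algebra_simps)
  ultimately show ?thesis by (metis dvd_triv_left)
qed

text \<open>Induction on the power of \<open>x0\<close> in the denominator. If G0/H0 = G/(x0 T'),
  then G/x0 is \<open>T'\<close> times an integral element, hence integral, and
  \<open>clear_pole\<close> removes one factor \<open>x0\<close>.\<close>

lemma denominator_exists:
  assumes int: "f dvd (\<Sum>j\<le>r. C j * G0 ^ j * H0 ^ (r - j))"
    and H0: "\<not> f dvd H0" and Cr: "meval ev (C r) \<noteq> 0"
    and N: "meval ev T \<noteq> 0" "f dvd mvar x0 ^ N * T * G0 - H0 * G"
  shows "\<exists>T G. meval ev T \<noteq> 0 \<and> f dvd T * G0 - H0 * G"
  using N
proof (induction N arbitrary: T G)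
  case (Suc N)
  let ?z = "mvar x0 :: ('v, 'k) mpoly"
  define T' where "T' = ?z ^ N * T"
  have cong: "f dvd ?z * T' * G0 - H0 * G" using Suc.prems(2) by (simp add: T'_def mult.assoc)
  have "f dvd (\<Sum>j\<le>r. C j * (?z * T' * G0) ^ j * (?z * T' * H0) ^ (r - j))"
  proof -
    have "(\<Sum>j\<le>r. C j * (?z * T' * G0) ^ j * (?z * T' * H0) ^ (r - j))
        = (?z * T') ^ r * (\<Sum>j\<le>r. C j * G0 ^ j * H0 ^ (r - j))"
      unfolding sum_distrib_left
    proof (rule sum.cong[OF refl])
      fix j assume "j \<in> {..r}"
      then have "(?z * T') ^ r = (?z * T') ^ (r - j) * (?z * T') ^ j" by (simp flip: power_add)
      then show "C j * (?z * T' * G0) ^ j * (?z * T' * H0) ^ (r - j)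
          = (?z * T') ^ r * (C j * G0 ^ j * H0 ^ (r - j))"
        by (simp add: power_mult_distrib ac_simps)
    qed
    then show ?thesis using int by simp
  qed
  moreover have "f dvd (\<Sum>j\<le>r. C j * (?z * T' * G0) ^ j * (?z * T' * H0) ^ (r - j))
      - (\<Sum>j\<le>r. C j * (H0 * G) ^ j * (?z * T' * H0) ^ (r - j))"
    unfolding sum_subtractf[symmetric] right_diff_distrib[symmetric] left_diff_distrib[symmetric]
    by (intro dvd_sum dvd_mult dvd_mult2 dvd_power_cong cong)
  ultimately have "f dvd (\<Sum>j\<le>r. C j * (H0 * G) ^ j * (?z * T' * H0) ^ (r - j))"
    by (rule dvd_of_dvd_diff)
  also have "(\<Sum>j\<le>r. C j * (H0 * G) ^ j * (?z * T' * H0) ^ (r - j))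
      = H0 ^ r * (\<Sum>j\<le>r. (C j * T' ^ (r - j)) * ?z ^ (r - j) * G ^ j)"
    unfolding sum_distrib_left
  proof (rule sum.cong[OF refl])
    fix j assume "j \<in> {..r}"
    then have "H0 ^ r = H0 ^ (r - j) * H0 ^ j" by (simp flip: power_add)
    then show "C j * (H0 * G) ^ j * (?z * T' * H0) ^ (r - j)
        = H0 ^ r * ((C j * T' ^ (r - j)) * ?z ^ (r - j) * G ^ j)"
      by (simp add: power_mult_distrib ac_simps)
  qed
  finally have "f dvd (\<Sum>j\<le>r. (C j * T' ^ (r - j)) * ?z ^ (r - j) * G ^ j)"
    using H0 prime_elem_dvd_mult_iff[OF f_prime] prime_elem_power[OF f_prime] by blast
  \<comment> \<open>The leading coefficient is \<open>C r * T' ^ 0\<close>; it does not vanish at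
    \<open>ev\<close> even if \<open>T'\<close> does.\<close>
  then obtain T1 W where T1: "meval ev T1 \<noteq> 0" "f dvd T1 * G - ?z * W"
    using clear_pole[where r = r and C = "\<lambda>j. C j * T' ^ (r - j)" and P = G] Cr by auto
  have "?z * (?z ^ N * (T1 * T) * G0 - H0 * W)
      = T1 * (?z * T' * G0 - H0 * G) + H0 * (T1 * G - ?z * W)"
    by (simp add: T'_def algebra_simps)
  then have "f dvd ?z * (?z ^ N * (T1 * T) * G0 - H0 * W)"
    using cong T1(2) by (metis dvd_add dvd_mult)
  then have "f dvd ?z ^ N * (T1 * T) * G0 - H0 * W"
    using f_not_dvd_mvar prime_elem_dvd_mult_iff[OF f_prime] by blast
  then show ?case using Suc.IH[of "T1 * T" W] T1 Suc.prems(1) by simp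
qed auto

end

section \<open>Local algebras\<close>

context comm_algebra
begin

lemma scale_conv_mult: "scale c x = scale c 1 * x"
  by (simp add: scale_mult)

lemma mult_scale: "x * scale c y = scale c (x * y)"
  using scale_mult[of c y x] by (simp add: mult.commute)

lemma ideal_subspace: "is_ideal J \<Longrightarrow> subspace J"
  unfolding is_ideal_def subspace_def by (metis scale_conv_mult)

lemma scale_power: "(scale c x) ^ k = scale (c ^ k) (x ^ k)"
  by (induction k) (simp_all add: scale_mult mult_scale mult.commute)

end

lemma is_ideal_principal: "is_ideal (range ((*) a))" for a :: "'a::comm_ring_1"
  unfolding is_ideal_def
proof (intro conjI ballI allI)
  show "0 \<in> range ((*) a)" by (rule range_eqI[of _ _ 0]) simp
next
  fix x y assume "x \<in> range ((*) a)" "y \<in> range ((*) a)"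
  then obtain u v where "x = a * u" "y = a * v" by blast
  then show "x + y \<in> range ((*) a)" by (intro range_eqI[of _ _ "u + v"]) (simp add: distrib_left)
next
  fix b x assume "x \<in> range ((*) a)"
  then obtain u where "x = a * u" by blast
  then show "b * x \<in> range ((*) a)" by (intro range_eqI[of _ _ "b * u"]) (simp add: ac_simps)
qed

context H_pair
begin

lemma M_ideal: "is_ideal M" and M_proper: "M \<noteq> UNIV"
  using maximal by (auto simp: is_maximal_ideal_def)

lemma one_not_in_M: "1 \<notin> M"
proof
  assume "1 \<in> M"
  then have "a * 1 \<in> M" for a using M_ideal unfolding is_ideal_def by blast
  then show False using M_proper by auto
qed

lemma M_subspace: "subspace M"
  by (rule ideal_subspace[OF M_ideal])

lemma obtain_finite_basis: obtains B where "finite_dimensional_vector_space scale B"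
proof -
  obtain S where S: "finite S" "span S = UNIV" using finite_dimensional by blast
  obtain B where B: "B \<subseteq> S" "independent B" "S \<subseteq> span B" by (rule maximal_independent_subset)
  have "span B = UNIV" using span_mono[OF B(3)] S by (auto simp: span_span)
  then have "finite_dimensional_vector_space scale B"
    using B S by unfold_locales (auto intro: finite_subset)
  then show thesis by (rule that)
qed

text \<open>By finite dimension there is a proper ideal of greatest dimension among those containing
  \<open>a\<close>. It is maximal, hence equal to \<open>M\<close>.\<close>

lemma unit_outside_M:
  assumes "a \<notin> M"
  shows "\<exists>b. a * b = 1"
proof (rule ccontr)
  assume contr: "\<nexists>b. a * b = 1"
  obtain B where "finite_dimensional_vector_space scale B" by (rule obtain_finite_basis)
  then interpret fd: finite_dimensional_vector_space scale B .
  define proper where "proper J \<longleftrightarrow> is_ideal J \<and> 1 \<notin> J \<and> range ((*) a) \<subseteq> J" for J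
  have "proper (range ((*) a))"
    unfolding proper_def using contr is_ideal_principal by (auto simp: eq_commute[of 1])
  moreover have "dim J \<le> dim UNIV" for J by (rule fd.dim_subset) simp
  ultimately obtain J where J: "proper J" and max: "\<And>J'. proper J' \<Longrightarrow> dim J' \<le> dim J"
    using ex_has_greatest_nat[of proper "range ((*) a)" dim "Suc (dim UNIV)"]
    by (auto simp: less_Suc_eq_le)
  have "is_maximal_ideal J"
    unfolding is_maximal_ideal_def
  proof (intro conjI allI impI)
    show "is_ideal J" "J \<noteq> UNIV" using J by (auto simp: proper_def)
    fix J' assume J': "is_ideal J' \<and> J \<subseteq> J'"
    show "J' = J \<or> J' = UNIV"
    proof (cases "1 \<in> J'")
      case True
      then have "b * 1 \<in> J'" for b using J' unfolding is_ideal_def by blast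
      then show ?thesis by auto
    next
      case False
      then have "proper J'" using J J' by (auto simp: proper_def)
      then have "J = J'"
        using J J' max by (intro fd.subspace_dim_equal ideal_subspace) (auto simp: proper_def)
      then show ?thesis by simp
    qed
  qed
  then have "J = M" by (rule local)
  moreover have "a * 1 \<in> J" using J unfolding proper_def by blast
  ultimately show False using assms by simp
qed

text \<open>The ideals generated by the powers of \<open>z\<close> decrease strictly until they
  vanish: equality of two consecutive ones would give \<open>z ^ k * (1 - z * y) = 0\<close>, and
  \<open>1 - z * y\<close> is a unit. So the dimension drops at each step.\<close>

lemma M_nilpotent:
  assumes z: "z \<in> M"
  shows "z ^ (dim UNIV + 1) = 0"
proof -
  obtain B where "finite_dimensional_vector_space scale B" by (rule obtain_finite_basis)
  then interpret fd: finite_dimensional_vector_space scale B .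
  define R where "R k = range ((*) (z ^ k))" for k
  have sub: "subspace (R k)" for k
    unfolding R_def by (rule ideal_subspace[OF is_ideal_principal])
  have "z ^ k = 0 \<or> dim (R k) + k \<le> dim UNIV" for k
  proof (induction k)
    case 0
    show ?case using fd.dim_subset[of "R 0" UNIV] by simp
  next
    case (Suc k)
    show ?case
    proof (cases "z ^ Suc k = 0")
      case False
      then have zk: "z ^ k \<noteq> 0" by auto
      have sub': "R (Suc k) \<subseteq> R k"
        unfolding R_def by (auto simp: power_Suc2 mult.assoc simp del: power_Suc)
      have "dim (R (Suc k)) \<noteq> dim (R k)"
      proof
        assume "dim (R (Suc k)) = dim (R k)"
        then have "R (Suc k) = R k" using fd.subspace_dim_equal[OF sub sub sub'] by simp
        moreover have "z ^ k \<in> R k" unfolding R_def by (rule range_eqI[of _ _ 1]) simp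
        ultimately obtain y where y: "z ^ k = z ^ Suc k * y" unfolding R_def by blast
        then have "z ^ k * (1 - z * y) = 0" by (simp add: right_diff_distrib ac_simps)
        moreover have "1 - z * y \<notin> M"
        proof
          assume "1 - z * y \<in> M"
          moreover have "y * z \<in> M" using M_ideal z unfolding is_ideal_def by blast
          ultimately have "(1 - z * y) + y * z \<in> M" using M_ideal unfolding is_ideal_def by blast
          then show False using one_not_in_M by (simp add: mult.commute)
        qed
        then obtain b where "(1 - z * y) * b = 1" using unit_outside_M by blast
        ultimately have "z ^ k = 0" by (metis mult.assoc mult.right_neutral mult_zero_left)
        with zk show False by simp
      qed
      then have "dim (R (Suc k)) < dim (R k)" using fd.dim_subset[OF sub'] by simp
      then show ?thesis using Suc zk by simp
    qed simp
  qed
  from this[of "dim UNIV + 1"] show ?thesis by simp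
qed

end

section \<open>Coordinates\<close>

text \<open>Isolates what is needed of a basis of \<open>M\<close>, so that the given basis and an
  adapted one can be used side by side on the same algebra. The exponent \<open>n + 2\<close> is the
  bound of \<open>M_nilpotent\<close> for an algebra of dimension \<open>n + 1\<close>.\<close>

locale based_algebra = comm_algebra scale
  for scale :: "'k::field \<Rightarrow> 'a::comm_ring_1 \<Rightarrow> 'a" +
  fixes M :: "'a set" and n :: nat and e :: "nat \<Rightarrow> 'a"
  assumes M_ideal: "is_ideal M"
    and nilpotent: "z \<in> M \<Longrightarrow> z ^ (n + 2) = 0"
    and e_in_M: "i \<in> {1..n} \<Longrightarrow> e i \<in> M"
    and element_bij: "bij_betw (element scale n e) (vecs {..n}) UNIV"
    and m_part_onto: "w \<in> M \<Longrightarrow> \<exists>v\<in>vecs {..n}. v 0 = 0 \<and> m_part scale n e v = w"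

text \<open>Since 1 is not in \<open>M\<close>, adding it to the basis of \<open>M\<close> gives
  \<open>n + 1\<close> independent elements, which span the algebra.\<close>

lemma (in H_pair) based_algebraI:
  assumes dim: "dim UNIV = n + 1" and basis: "indexed_basis scale {1..n} e M"
  shows "based_algebra scale M n e"
proof -
  obtain B where "finite_dimensional_vector_space scale B" by (rule obtain_finite_basis)
  then interpret fd: finite_dimensional_vector_space scale B .
  let ?I = "{1..n}"
  have inj: "inj_on e ?I" and ind: "independent (e ` ?I)" and span: "span (e ` ?I) = M"
    using basis by (auto simp: indexed_basis_def)
  have onto: "\<exists>v\<in>vecs {..n}. v 0 = 0 \<and> m_part scale n e v = w" if w: "w \<in> M" for w
  proof -
    have "w \<in> range (\<lambda>u. \<Sum>x\<in>e ` ?I. scale (u x) x)"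
      using w span_finite[of "e ` ?I"] span by simp
    then obtain u where "w = (\<Sum>x\<in>e ` ?I. scale (u x) x)" by blast
    then have "w = (\<Sum>i\<in>?I. scale (u (e i)) (e i))" by (simp only: sum.reindex[OF inj] o_def)
    also have "\<dots> = m_part scale n e (\<lambda>i. if i \<in> ?I then u (e i) else 0)"
      unfolding m_part_def by (rule sum.cong) auto
    finally show ?thesis
      by (intro bexI[of _ "\<lambda>i. if i \<in> ?I then u (e i) else 0"]) (auto simp: vecs_def)
  qed
  have m_in_M: "m_part scale n e v \<in> M" for v
    unfolding m_part_def
  proof (intro subspace_sum[OF M_subspace] subspace_scale[OF M_subspace])
    fix i assume "i \<in> ?I"
    then show "e i \<in> M" unfolding span[symmetric] by (intro span_base imageI)
  qed
  have one: "1 \<notin> e ` ?I" using span span_base one_not_in_M by blast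
  have "independent (insert 1 (e ` ?I))"
    using one one_not_in_M ind span by (simp add: independent_insert)
  moreover have "card (insert 1 (e ` ?I)) = n + 1"
    using one card_image[OF inj] by simp
  ultimately have "UNIV \<subseteq> span (insert 1 (e ` ?I))"
    using dim by (intro fd.card_ge_dim_independent) auto
  then have spl: "\<exists>c. a - scale c 1 \<in> M" for a
    using span by (simp add: span_insert) blast
  have surj: "\<exists>v\<in>vecs {..n}. element scale n e v = a" for a
  proof -
    obtain c where "a - scale c 1 \<in> M" using spl by blast
    then obtain v where v: "v \<in> vecs {..n}" "v 0 = 0" "m_part scale n e v = a - scale c 1"
      using onto by blast
    have "m_part scale n e (v(0 := c)) = m_part scale n e v"
      unfolding m_part_def by (rule sum.cong) auto
    then have "element scale n e (v(0 := c)) = a" by (simp add: element_def v)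
    moreover have "v(0 := c) \<in> vecs {..n}" using v by (auto simp: vecs_def)
    ultimately show ?thesis by blast
  qed
  have ker: "v = (\<lambda>_. 0)" if v: "v \<in> vecs {..n}" "element scale n e v = 0" for v
  proof -
    have v0: "v 0 = 0"
    proof (rule ccontr)
      assume "v 0 \<noteq> 0"
      have "scale (v 0) 1 = - m_part scale n e v"
        using v(2) by (simp add: element_def eq_neg_iff_add_eq_0)
      also have "\<dots> \<in> M" using m_in_M M_subspace by (rule subspace_neg[rotated])
      finally have "scale (1 / v 0) (scale (v 0) 1) \<in> M" by (rule subspace_scale[OF M_subspace])
      then show False using \<open>v 0 \<noteq> 0\<close> one_not_in_M by simp
    qed
    have "(\<Sum>x\<in>e ` ?I. scale (v (the_inv_into ?I e x)) x) = 0"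
      unfolding sum.reindex[OF inj] o_def
      using v(2) v0 the_inv_into_f_f[OF inj] by (simp add: element_def m_part_def)
    then have "v (the_inv_into ?I e x) = 0" if "x \<in> e ` ?I" for x
      using independentD[OF ind, of "e ` ?I" "\<lambda>x. v (the_inv_into ?I e x)"] that by blast
    then have "v i = 0" if "i \<in> ?I" for i
      using that the_inv_into_f_f[OF inj, of i] by (metis imageI)
    moreover have "v i = 0" if "i \<notin> ?I" for i
      using that v(1) v0 by (cases "i = 0") (auto simp: vecs_def)
    ultimately show ?thesis by blast
  qed
  have "inj_on (element scale n e) (vecs {..n})"
  proof (rule inj_onI)
    fix v w assume vw: "v \<in> vecs {..n}" "w \<in> vecs {..n}" "element scale n e v = element scale n e w"
    have "element scale n e (\<lambda>i. v i - w i) = element scale n e v - element scale n e w"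
      by (simp add: element_def m_part_def scale_left_diff_distrib sum_subtractf)
    then have "(\<lambda>i. v i - w i) = (\<lambda>_. 0)"
      using vw by (intro ker) (auto simp: vecs_def)
    then show "v = w" by (auto simp: fun_eq_iff)
  qed
  then have "bij_betw (element scale n e) (vecs {..n}) UNIV"
    using surj by (auto simp: bij_betw_def) (metis image_eqI)
  moreover have "e i \<in> M" if "i \<in> ?I" for i using that span span_base by blast
  moreover have "z ^ (n + 2) = 0" if "z \<in> M" for z
    using M_nilpotent[OF that] dim by simp
  ultimately show ?thesis
    using M_ideal onto by unfold_locales auto
qed

text \<open>A basis of \<open>U\<close> completed by an element on which \<pi> is 1. In these
  coordinates \<pi> is the last coordinate and \<open>U\<close> is the hyperplane where it
  vanishes.\<close>

lemma (in H_pair) adapted_basis_exists: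
  assumes dim: "dim UNIV = n + 1" and basis: "indexed_basis scale {1..n} e M"
    and proj: "quotient_projection scale M U \<pi>"
  obtains e' where "indexed_basis scale {1..n} e' M" "1 \<le> n"
    "\<And>i. i \<in> {1..<n} \<Longrightarrow> \<pi> (e' i) = 0" "\<pi> (e' n) = 1"
proof -
  obtain B0 where "finite_dimensional_vector_space scale B0" by (rule obtain_finite_basis)
  then interpret fd: finite_dimensional_vector_space scale B0 .
  have "dim M = n"
    using basis dim_span_eq_card_independent[of "e ` {1..n}"]
    by (auto simp: indexed_basis_def card_image)
  then have n: "1 \<le> n" "dim U = n - 1" using codim_U by auto
  obtain B where B: "B \<subseteq> U" "independent B" "U \<subseteq> span B" "card B = dim U"
    by (rule basis_exists)
  have spanB: "span B = U" using B subspace_U by (metis span_subspace)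
  have finB: "finite B" by (rule fd.finiteI_independent[OF B(2)])
  have \<pi>_add: "\<pi> (x + y) = \<pi> x + \<pi> y" if "x \<in> M" "y \<in> M" for x y
    using proj that by (auto simp: quotient_projection_def)
  have \<pi>_scale: "\<pi> (scale c x) = c * \<pi> x" if "x \<in> M" for c x
    using proj that by (auto simp: quotient_projection_def)
  have U_iff: "x \<in> U \<longleftrightarrow> x \<in> M \<and> \<pi> x = 0" for x
    using proj by (auto simp: quotient_projection_def)
  obtain b where b: "b \<in> M" "\<pi> b = 1"
  proof -
    have "1 \<in> \<pi> ` M" using proj by (auto simp: quotient_projection_def)
    then show thesis using that by (metis imageE)
  qed
  have bU: "b \<notin> span B" using b spanB U_iff by simp
  then have bB: "b \<notin> B" using span_base by blast
  obtain h where h: "bij_betw h {1..card B} B"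
    using ex_bij_betw_nat_finite_1[OF finB] by blast
  define e' where "e' = h(n := b)"
  have card: "card B = n - 1" using B n by simp
  have img: "e' ` {1..<n} = B"
  proof -
    have "{1..card B} = {1..<n}" using n card by auto
    then have "h ` {1..<n} = B" using h by (simp add: bij_betw_def)
    moreover have "e' ` {1..<n} = h ` {1..<n}" unfolding e'_def by (rule image_cong) auto
    ultimately show ?thesis by simp
  qed
  have split: "{1..n} = insert n {1..<n}" using n by auto
  have img': "e' ` {1..n} = insert b B"
    unfolding split image_insert img by (simp add: e'_def)
  have "inj_on e' {1..n}"
    by (rule eq_card_imp_inj_on) (use img' bB finB card n in auto)
  moreover have "independent (insert b B)" using B bU bB by (simp add: independent_insert)
  moreover have "span (insert b B) = M"
  proof (rule subset_antisym)
    show "span (insert b B) \<subseteq> M"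
      using b B U_subset M_subspace by (intro span_minimal) auto
    show "M \<subseteq> span (insert b B)"
    proof
      fix w assume w: "w \<in> M"
      have mb: "scale (- \<pi> w) b \<in> M" using b by (intro subspace_scale[OF M_subspace])
      have "w + scale (- \<pi> w) b \<in> U"
        unfolding U_iff
        using subspace_add[OF M_subspace w mb] \<pi>_add[OF w mb] \<pi>_scale[OF b(1), of "- \<pi> w"] b(2)
        by simp
      then show "w \<in> span (insert b B)"
        unfolding span_insert spanB by (auto intro!: exI[of _ "\<pi> w"])
    qed
  qed
  ultimately have "indexed_basis scale {1..n} e' M"
    unfolding indexed_basis_def img' by simp
  moreover have "\<pi> (e' i) = 0" if "i \<in> {1..<n}" for i
    using img that B(1) U_iff by blast
  moreover have "\<pi> (e' n) = 1" by (simp add: e'_def b)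
  ultimately show thesis using that n by blast
qed

context based_algebra
begin

lemma M_subspace: "subspace M"
  by (rule ideal_subspace[OF M_ideal])

lemma M_mult: "x \<in> M \<Longrightarrow> a * x \<in> M"
  using M_ideal by (auto simp: is_ideal_def)

lemma M_power: "x \<in> M \<Longrightarrow> 0 < k \<Longrightarrow> x ^ k \<in> M"
  by (cases k) (auto simp: mult.commute[of x] intro: M_mult)

lemma nilpotent_ge: "z \<in> M \<Longrightarrow> n + 2 \<le> k \<Longrightarrow> z ^ k = 0"
  using nilpotent[of z] by (metis le_add_diff_inverse mult_zero_left power_add)

lemma m_part_in_M: "m_part scale n e v \<in> M"
  unfolding m_part_def
  by (intro subspace_sum[OF M_subspace] subspace_scale[OF M_subspace] e_in_M)

definition cd :: "'a \<Rightarrow> nat \<Rightarrow> 'k" where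
  "cd = the_inv_into (vecs {..n}) (element scale n e)"

lemma cd_in [simp]: "cd a \<in> vecs {..n}"
  unfolding cd_def using bij_betw_the_inv_into[OF element_bij] by (auto simp: bij_betw_def)

lemma element_cd [simp]: "element scale n e (cd a) = a"
  unfolding cd_def by (rule f_the_inv_into_f_bij_betw[OF element_bij]) simp

lemma cd_element: "v \<in> vecs {..n} \<Longrightarrow> cd (element scale n e v) = v"
  unfolding cd_def using element_bij by (intro the_inv_into_f_f) (auto simp: bij_betw_def)

lemma cd_eqI: "v \<in> vecs {..n} \<Longrightarrow> element scale n e v = a \<Longrightarrow> cd a = v"
  using cd_element by blast

lemma cd_add: "cd (a + b) = (\<lambda>i. cd a i + cd b i)"
proof (rule cd_eqI)
  have "element scale n e (\<lambda>i. cd a i + cd b i) = element scale n e (cd a) + element scale n e (cd b)"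
    by (simp only: element_def m_part_def scale_left_distrib sum.distrib) (simp add: ac_simps)
  then show "element scale n e (\<lambda>i. cd a i + cd b i) = a + b" by simp
  show "(\<lambda>i. cd a i + cd b i) \<in> vecs {..n}"
    using cd_in[of a] cd_in[of b] by (auto simp: vecs_def)
qed

lemma cd_scale: "cd (scale c a) = (\<lambda>i. c * cd a i)"
proof (rule cd_eqI)
  have "element scale n e (\<lambda>i. c * cd a i) = scale c (element scale n e (cd a))"
    by (simp add: element_def m_part_def scale_right_distrib scale_sum_right)
  then show "element scale n e (\<lambda>i. c * cd a i) = scale c a" by simp
  show "(\<lambda>i. c * cd a i) \<in> vecs {..n}" using cd_in[of a] by (auto simp: vecs_def)
qed

lemma cd_split:
  assumes "w \<in> M"
  shows "cd (scale c 1 + w) 0 = c" "m_part scale n e (cd (scale c 1 + w)) = w"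
proof -
  obtain v where v: "v \<in> vecs {..n}" "v 0 = 0" "m_part scale n e v = w"
    using m_part_onto[OF assms] by blast
  have m: "m_part scale n e (v(0 := c)) = w"
    unfolding v(3)[symmetric] m_part_def by (rule sum.cong) auto
  have "cd (scale c 1 + w) = v(0 := c)"
    using v by (intro cd_eqI) (auto simp: element_def m vecs_def)
  with m show "cd (scale c 1 + w) 0 = c" "m_part scale n e (cd (scale c 1 + w)) = w" by simp_all
qed

lemma cd_M: "w \<in> M \<Longrightarrow> cd w 0 = 0" "w \<in> M \<Longrightarrow> m_part scale n e (cd w) = w"
  using cd_split[of w 0] by simp_all

text \<open>The family \<open>e\<close> carries information only on \<open>{1..n}\<close>; index 0
  belongs to the unit element.\<close>

definition basis_at :: "nat \<Rightarrow> 'a" where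
  "basis_at j = (if j = 0 then 1 else e j)"

lemma element_sum: "element scale n e v = (\<Sum>j\<le>n. scale (v j) (basis_at j))"
proof -
  have "{..n} = insert 0 {1..n}" by auto
  then show ?thesis by (simp add: element_def m_part_def basis_at_def)
qed

end

section \<open>Polynomial functions with values in an algebra\<close>

definition poly_fun :: "'v set \<Rightarrow> (('v \<Rightarrow> 'k::comm_ring_1) \<Rightarrow> 'k) \<Rightarrow> bool" where
  "poly_fun V \<phi> \<longleftrightarrow> (\<exists>P\<in>polys V. \<forall>x. \<phi> x = meval x P)"

lemma poly_fun_const: "poly_fun V (\<lambda>_. c)"
  unfolding poly_fun_def by (rule bexI[of _ "mconst c"]) auto

lemma poly_fun_coord: "i \<in> V \<Longrightarrow> poly_fun V (\<lambda>x. x i)"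
  unfolding poly_fun_def by (rule bexI[of _ "mvar i"]) auto

lemma poly_fun_add: "poly_fun V \<phi> \<Longrightarrow> poly_fun V \<psi> \<Longrightarrow> poly_fun V (\<lambda>x. \<phi> x + \<psi> x)"
  unfolding poly_fun_def by (metis meval_hom(1) polys_add)

lemma poly_fun_mult: "poly_fun V \<phi> \<Longrightarrow> poly_fun V \<psi> \<Longrightarrow> poly_fun V (\<lambda>x. \<phi> x * \<psi> x)"
  unfolding poly_fun_def by (metis meval_hom(2) polys_mult)

lemma poly_fun_sum: "(\<And>i. i \<in> S \<Longrightarrow> poly_fun V (\<phi> i)) \<Longrightarrow> poly_fun V (\<lambda>x. \<Sum>i\<in>S. \<phi> i x)"
  by (induction S rule: infinite_finite_induct) (auto intro: poly_fun_add poly_fun_const)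

lemma poly_fun_power: "poly_fun V \<phi> \<Longrightarrow> poly_fun V (\<lambda>x. \<phi> x ^ k)"
  by (induction k) (auto intro: poly_fun_mult poly_fun_const)

context comm_algebra
begin

definition functional :: "('a \<Rightarrow> 'k) \<Rightarrow> bool" where
  "functional l \<longleftrightarrow> (\<forall>x y. l (x + y) = l x + l y) \<and> (\<forall>c x. l (scale c x) = c * l x)"

lemma functional_sum: "functional l \<Longrightarrow> l (sum g S) = (\<Sum>i\<in>S. l (g i))"
proof -
  assume l: "functional l"
  have "l 0 = 0" using l unfolding functional_def by (metis mult_zero_left scale_zero_left)
  then show ?thesis
    using l by (induction S rule: infinite_finite_induct) (auto simp: functional_def)
qed

text \<open>Testing with all linear functionals makes the notion independent of a basis, so a map
  built in one basis can be read off in the other.\<close>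

definition alg_poly :: "nat set \<Rightarrow> ((nat \<Rightarrow> 'k) \<Rightarrow> 'a) \<Rightarrow> bool" where
  "alg_poly V \<Theta> \<longleftrightarrow> (\<forall>l. functional l \<longrightarrow> poly_fun V (\<lambda>x. l (\<Theta> x)))"

lemma alg_poly_scale: "poly_fun V \<phi> \<Longrightarrow> alg_poly V \<Theta> \<Longrightarrow> alg_poly V (\<lambda>x. scale (\<phi> x) (\<Theta> x))"
  by (auto simp: alg_poly_def functional_def intro!: poly_fun_mult)

lemma alg_poly_const: "alg_poly V (\<lambda>_. a)"
  by (auto simp: alg_poly_def poly_fun_const)

lemma alg_poly_sum: "(\<And>i. i \<in> S \<Longrightarrow> alg_poly V (\<Theta> i)) \<Longrightarrow> alg_poly V (\<lambda>x. \<Sum>i\<in>S. \<Theta> i x)"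
  by (auto simp: alg_poly_def functional_sum intro!: poly_fun_sum)

end

context based_algebra
begin

lemma functional_cd: "functional (\<lambda>a. cd a j)"
  by (simp add: functional_def cd_add cd_scale)

text \<open>The coordinates of a product are bilinear in those of the factors, with the structure
  constants \<open>basis_at i * basis_at j\<close>.\<close>

lemma alg_poly_mult:
  assumes "alg_poly V \<Theta>" "alg_poly V \<Xi>"
  shows "alg_poly V (\<lambda>x. \<Theta> x * \<Xi> x)"
  unfolding alg_poly_def
proof (intro allI impI)
  fix l assume l: "functional l"
  have "l (\<Theta> x * \<Xi> x) =
      (\<Sum>i\<le>n. \<Sum>j\<le>n. cd (\<Theta> x) i * cd (\<Xi> x) j * l (basis_at i * basis_at j))" for x
  proof -
    have "\<Theta> x * \<Xi> x = (\<Sum>i\<le>n. scale (cd (\<Theta> x) i) (basis_at i)) * (\<Sum>j\<le>n. scale (cd (\<Xi> x) j) (basis_at j))"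
      by (simp flip: element_sum)
    also have "\<dots> = (\<Sum>i\<le>n. \<Sum>j\<le>n. scale (cd (\<Theta> x) i * cd (\<Xi> x) j) (basis_at i * basis_at j))"
      by (simp add: sum_product scale_mult mult_scale mult.commute[of "cd (\<Xi> x) _"])
    finally show ?thesis using l by (simp add: functional_sum[OF l]) (simp add: functional_def)
  qed
  moreover have "poly_fun V (\<lambda>x. cd (\<Theta> x) i)" "poly_fun V (\<lambda>x. cd (\<Xi> x) i)" for i
    using assms functional_cd by (auto simp: alg_poly_def)
  ultimately show "poly_fun V (\<lambda>x. l (\<Theta> x * \<Xi> x))"
    by (auto intro!: poly_fun_sum poly_fun_mult poly_fun_const)
qed

lemma alg_poly_power: "alg_poly V \<Theta> \<Longrightarrow> alg_poly V (\<lambda>x. \<Theta> x ^ k)"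
  by (induction k) (auto intro: alg_poly_mult alg_poly_const)

lemma alg_poly_m_part: "alg_poly {..n} (m_part scale n e)"
proof -
  have "alg_poly {..n} (\<lambda>v. \<Sum>i\<in>{1..n}. scale (v i) (e i))"
    by (auto intro!: alg_poly_sum alg_poly_scale alg_poly_const poly_fun_coord)
  then show ?thesis by (simp add: m_part_def[abs_def])
qed

section \<open>Exponential and logarithm of nilpotent elements\<close>

text \<open>For \<open>z\<close> in \<open>M\<close> the cut at \<open>n + 2\<close> loses nothing
  by nilpotency. Evaluation is then a homomorphism compatible with composition, so identities for
  exp and ln follow from those of formal power series.\<close>

definition fps_val :: "'a \<Rightarrow> 'k fps \<Rightarrow> 'a" where
  "fps_val z F = (\<Sum>k<n+2. scale (fps_nth F k) (z ^ k))"

lemma fps_val_add: "fps_val z (F + G) = fps_val z F + fps_val z G"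
  by (simp add: fps_val_def scale_left_distrib sum.distrib)

lemma fps_val_one: "fps_val z 1 = 1"
proof -
  have "fps_val z 1 = (\<Sum>k<n+2. if k = 0 then 1 else 0)"
    unfolding fps_val_def by (intro sum.cong) auto
  then show ?thesis by simp
qed

lemma fps_val_X: "fps_val z fps_X = z"
proof -
  have "fps_val z fps_X = (\<Sum>k<n+2. if k = 1 then z else 0)"
    unfolding fps_val_def by (intro sum.cong) auto
  then show ?thesis by simp
qed

lemma fps_val_mult:
  assumes "z \<in> M"
  shows "fps_val z (F * G) = fps_val z F * fps_val z G"
proof -
  define g where "g i j = scale (fps_nth F i * fps_nth G j) (z ^ (i + j))" for i j
  have "fps_val z F * fps_val z G = (\<Sum>i<n+2. \<Sum>j<n+2. g i j)"
    unfolding fps_val_def sum_product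
    by (intro sum.cong refl) (simp add: g_def scale_mult mult_scale power_add mult.commute)
  also have "\<dots> = (\<Sum>(i,j)\<in>{..<n+2} \<times> {..<n+2}. g i j)"
    by (rule sum.cartesian_product)
  also have "\<dots> = (\<Sum>(i,j)\<in>{(i,j). i + j < n+2}. g i j)"
  proof (rule sum.mono_neutral_right, goal_cases)
    case 3
    have "g i j = 0" if "\<not> i + j < n + 2" for i j
      using that nilpotent_ge[OF assms, of "i + j"] by (simp add: g_def)
    then show ?case by auto
  qed auto
  also have "\<dots> = (\<Sum>k<n+2. \<Sum>i\<le>k. g i (k - i))"
    by (rule sum.triangle_reindex)
  also have "\<dots> = fps_val z (F * G)"
    unfolding fps_val_def fps_mult_nth
    by (rule sum.cong) (auto simp: g_def scale_sum_left atLeast0AtMost intro!: sum.cong)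
  finally show ?thesis by simp
qed

lemma fps_val_power: "z \<in> M \<Longrightarrow> fps_val z (F ^ k) = fps_val z F ^ k"
  by (induction k) (simp_all add: fps_val_one fps_val_mult)

lemma fps_val_in_M:
  assumes "z \<in> M" "fps_nth F 0 = 0"
  shows "fps_val z F \<in> M"
  unfolding fps_val_def
proof (rule subspace_sum[OF M_subspace])
  fix k
  show "scale (fps_nth F k) (z ^ k) \<in> M"
    using assms by (cases "k = 0") (auto intro!: subspace_scale[OF M_subspace] M_power subspace_0[OF M_subspace])
qed

text \<open>The power \<open>G ^ i\<close> has no terms below degree \<open>i\<close>, so the
  coefficients below \<open>n + 2\<close> involve only \<open>i < n + 2\<close>, which matches the
  truncation of the outer series.\<close>

lemma fps_val_compose:
  assumes z: "z \<in> M" and G: "fps_nth G 0 = 0"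
  shows "fps_val z (F oo G) = fps_val (fps_val z G) F"
proof -
  have nth: "fps_nth (F oo G) k = (\<Sum>i<n+2. fps_nth F i * fps_nth (G ^ i) k)" if "k < n + 2" for k
    unfolding fps_compose_nth
    by (rule sum.mono_neutral_left)
      (use that startsby_zero_power_prefix[OF G] in \<open>auto simp: not_le\<close>)
  have "fps_val z (F oo G) = (\<Sum>k<n+2. \<Sum>i<n+2. scale (fps_nth F i) (scale (fps_nth (G ^ i) k) (z ^ k)))"
    unfolding fps_val_def
    by (rule sum.cong[OF refl]) (simp only: nth lessThan_iff scale_sum_left scale_scale)
  also have "\<dots> = (\<Sum>i<n+2. scale (fps_nth F i) (fps_val z (G ^ i)))"
    unfolding fps_val_def by (subst sum.swap) (simp only: scale_sum_right)
  also have "\<dots> = fps_val (fps_val z G) F"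
    by (simp only: fps_val_power[OF z]) (simp only: fps_val_def)
  finally show ?thesis .
qed

end

locale exp_algebra = based_algebra scale M n e
  for scale :: "'k::field_char_0 \<Rightarrow> 'a::comm_ring_1 \<Rightarrow> 'a" and M n e
begin

abbreviation expA :: "'a \<Rightarrow> 'a" where "expA w \<equiv> fps_val w (fps_exp 1)"
text \<open>\<open>fps_ln 1\<close> is the series of ln(1 + X), so \<open>lnA z\<close> stands for
  ln(1 + z).\<close>

abbreviation lnA :: "'a \<Rightarrow> 'a" where "lnA z \<equiv> fps_val z (fps_ln 1)"

lemma nil_ln1p_eq: "z \<in> M \<Longrightarrow> nil_ln1p scale z = lnA z"
  unfolding nil_ln1p_def fps_val_def
  by (rule sum.mono_neutral_cong_left) (auto simp: fps_ln_nth not_less[symmetric] dest: nilpotent_ge)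

lemma fps_exp_compose_ln: "fps_exp 1 oo fps_ln 1 = (1 + fps_X :: 'k fps)"
proof -
  have "(fps_exp 1 - 1 :: 'k fps) oo fps_ln 1 = fps_X"
    unfolding fps_ln_fps_exp_inv[OF one_neq_zero] by (rule fps_inv_right) auto
  then show ?thesis
    by (simp add: fps_compose_sub_distrib algebra_simps)
qed

lemma fps_ln_compose_exp: "fps_ln 1 oo (fps_exp 1 - 1) = (fps_X :: 'k fps)"
  unfolding fps_ln_fps_exp_inv[OF one_neq_zero] by (rule fps_inv) auto

lemma exp_ln: "z \<in> M \<Longrightarrow> expA (lnA z) = 1 + z"
  by (simp add: fps_exp_compose_ln fps_val_add fps_val_one fps_val_X flip: fps_val_compose)

lemma ln_in_M: "z \<in> M \<Longrightarrow> lnA z \<in> M"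
  by (rule fps_val_in_M) auto

lemma exp_minus_1_in_M: "w \<in> M \<Longrightarrow> expA w - 1 \<in> M"
  and ln_exp: "w \<in> M \<Longrightarrow> lnA (expA w - 1) = w"
proof -
  have eq: "fps_val w (fps_exp 1 - 1) = expA w - 1"
    using fps_val_add[of w "fps_exp 1 - 1" 1] by (simp add: fps_val_one)
  assume w: "w \<in> M"
  show "expA w - 1 \<in> M" unfolding eq[symmetric] using w by (rule fps_val_in_M) auto
  show "lnA (expA w - 1) = w"
    using w by (simp add: fps_ln_compose_exp fps_val_X flip: eq fps_val_compose)
qed

lemma alg_poly_fps_val: "alg_poly V \<Theta> \<Longrightarrow> alg_poly V (\<lambda>x. fps_val (\<Theta> x) F)"
  unfolding fps_val_def
  by (intro alg_poly_sum alg_poly_scale poly_fun_const alg_poly_power)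

end

section \<open>The parametrization of the hypersurface\<close>

text \<open>The basis \<open>e\<close> carries the coordinates in which \<open>f\<close> is written;
  \<open>e'\<close> is adapted to \<pi> and carries the logarithmic coordinates. That z_0 does not
  divide \<open>f\<close> is what lets powers of z_0 be cancelled from \<open>f * G\<close>.\<close>

locale parametrization =
  A: exp_algebra scale M n e + B: exp_algebra scale M n e'
  for scale :: "'k::field_char_0 \<Rightarrow> 'a::comm_ring_1 \<Rightarrow> 'a" and M n e e' +
  fixes \<pi> :: "'a \<Rightarrow> 'k" and d :: nat and f :: "(nat, 'k) mpoly"
  assumes n_pos: "1 \<le> n"
    and \<pi>_add: "x \<in> M \<Longrightarrow> y \<in> M \<Longrightarrow> \<pi> (x + y) = \<pi> x + \<pi> y"
    and \<pi>_scale: "x \<in> M \<Longrightarrow> \<pi> (scale c x) = c * \<pi> x"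
    and \<pi>_e': "i \<in> {1..<n} \<Longrightarrow> \<pi> (e' i) = 0" "\<pi> (e' n) = 1"
    and f_vars: "f \<in> polys {..n}"
    and f_val: "z \<in> vecs {..n} \<Longrightarrow> z 0 \<noteq> 0 \<Longrightarrow>
      meval z f = z 0 ^ d * \<pi> (nil_ln1p scale (scale (1 / z 0) (m_part scale n e z)))"
    and not_mvar_dvd: "\<not> mvar 0 dvd f"
begin

lemma \<pi>_m_part: "\<pi> (m_part scale n e' v) = v n"
proof -
  have \<pi>0: "\<pi> 0 = 0" using \<pi>_scale[of 0 0] A.M_ideal by (simp add: is_ideal_def)
  have sum: "\<pi> (\<Sum>i\<in>S. scale (v i) (e' i)) = (\<Sum>i\<in>S. v i * \<pi> (e' i))"
    if "finite S" "S \<subseteq> {1..n}" for S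
    using that
  proof (induction S rule: finite_induct)
    case (insert i S)
    have "(\<Sum>i\<in>S. scale (v i) (e' i)) \<in> M" "scale (v i) (e' i) \<in> M"
      using insert.prems
      by (auto intro!: A.subspace_sum[OF A.M_subspace] A.subspace_scale[OF A.M_subspace] B.e_in_M
          simp del: One_nat_def)
    then show ?case
      using insert \<pi>_scale[OF B.e_in_M, of i "v i"] by (simp add: \<pi>_add)
  qed (simp add: \<pi>0)
  have "\<pi> (m_part scale n e' v) = (\<Sum>i\<in>{1..n}. v i * \<pi> (e' i))"
    unfolding m_part_def by (rule sum) auto
  also have "\<dots> = (\<Sum>i\<in>{1..n}. if i = n then v n else 0)"
    by (rule sum.cong) (use \<pi>_e' in auto)
  finally show ?thesis using n_pos by simp
qed

text \<open>\<open>E\<close> sends (v_0, w), with w read in the basis \<open>e'\<close>, to v_0 exp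
  w, read in the basis \<open>e\<close>; \<open>L\<close> below is its inverse where the coordinate
  0 is nonzero. \<open>E\<close> is polynomial, \<open>L\<close> only up to powers of z_0.\<close>

definition E :: "(nat \<Rightarrow> 'k) \<Rightarrow> nat \<Rightarrow> 'k" where
  "E v = A.cd (scale (v 0) (A.expA (m_part scale n e' v)))"

definition logm :: "(nat \<Rightarrow> 'k) \<Rightarrow> 'a" where
  "logm z = A.lnA (scale (1 / z 0) (m_part scale n e z))"

definition L :: "(nat \<Rightarrow> 'k) \<Rightarrow> nat \<Rightarrow> 'k" where
  "L z = (B.cd (logm z))(0 := z 0)"

lemma scaled_m_part_in_M: "scale c (m_part scale n e z) \<in> M"
  by (intro A.subspace_scale[OF A.M_subspace] A.m_part_in_M)

lemma logm_in_M: "logm z \<in> M"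
  unfolding logm_def by (intro A.ln_in_M scaled_m_part_in_M)

lemma E_decomp:
  "scale (v 0) (A.expA (m_part scale n e' v))
    = scale (v 0) 1 + scale (v 0) (A.expA (m_part scale n e' v) - 1)"
  by (simp flip: A.scale_right_distrib)

lemma E_part_in_M: "scale (v 0) (A.expA (m_part scale n e' v) - 1) \<in> M"
  by (intro A.subspace_scale[OF A.M_subspace] A.exp_minus_1_in_M B.m_part_in_M)

lemma E_0: "E v 0 = v 0"
  and m_part_E: "m_part scale n e (E v) = scale (v 0) (A.expA (m_part scale n e' v) - 1)"
  unfolding E_def E_decomp using A.cd_split[OF E_part_in_M] by auto

lemma E_in: "E v \<in> vecs {..n}"
  by (simp add: E_def)

lemma L_in: "L z \<in> vecs {..n}"
  using B.cd_in[of "logm z"] by (auto simp: L_def vecs_def)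

lemma L_0: "L z 0 = z 0"
  by (simp add: L_def)

lemma m_part_L: "m_part scale n e' (L z) = logm z"
proof -
  have "m_part scale n e' (L z) = m_part scale n e' (B.cd (logm z))"
    unfolding m_part_def L_def by (rule sum.cong) auto
  then show ?thesis by (simp add: B.cd_M logm_in_M)
qed

lemma L_n: "L z n = \<pi> (logm z)"
  using \<pi>_m_part[of "L z"] by (simp add: m_part_L)

lemma f_eq_L: "z \<in> vecs {..n} \<Longrightarrow> z 0 \<noteq> 0 \<Longrightarrow> meval z f = z 0 ^ d * L z n"
  using f_val[of z] scaled_m_part_in_M by (simp add: L_n logm_def A.nil_ln1p_eq)

lemma E_L:
  assumes "z \<in> vecs {..n}" "z 0 \<noteq> 0"
  shows "E (L z) = z"
proof -
  have "A.expA (m_part scale n e' (L z)) = 1 + scale (1 / z 0) (m_part scale n e z)"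
    unfolding m_part_L logm_def by (rule A.exp_ln[OF scaled_m_part_in_M])
  then have "scale (L z 0) (A.expA (m_part scale n e' (L z))) = element scale n e z"
    using assms(2) by (simp add: L_0 A.scale_right_distrib element_def)
  then show ?thesis unfolding E_def using assms(1) by (simp add: A.cd_element)
qed

lemma L_E:
  assumes "v \<in> vecs {..n}" "v 0 \<noteq> 0"
  shows "L (E v) = v"
proof -
  have "logm (E v) = m_part scale n e' v"
    using assms(2) by (simp add: logm_def E_0 m_part_E A.ln_exp B.m_part_in_M)
  then have "m_part scale n e' (L (E v)) = m_part scale n e' v" by (simp add: m_part_L)
  moreover have "L (E v) 0 = v 0" by (simp add: L_0 E_0)
  ultimately have "element scale n e' (L (E v)) = element scale n e' v" by (simp add: element_def)
  then show ?thesis using B.cd_element L_in assms(1) by metis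
qed

lemma E_polynomial: "\<exists>\<sigma>. (\<forall>j. \<sigma> j \<in> polys {..n}) \<and> (\<forall>v j. E v j = meval v (\<sigma> j))"
proof -
  have "A.alg_poly {..n} (\<lambda>v. scale (v 0) (A.expA (m_part scale n e' v)))"
    by (intro A.alg_poly_scale poly_fun_coord A.alg_poly_fps_val B.alg_poly_m_part) auto
  then have "poly_fun {..n} (\<lambda>v. E v j)" for j
    unfolding E_def A.alg_poly_def using A.functional_cd by blast
  then have "\<forall>j. \<exists>P. P \<in> polys {..n} \<and> (\<forall>v. E v j = meval v P)"
    unfolding poly_fun_def by blast
  then show ?thesis by metis
qed

text \<open>The series is cut at \<open>n + 2\<close>, so the largest denominator is z_0^(n+1);
  multiplying by it homogenizes the logarithm.\<close>

lemma L_polynomial: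
  assumes "j \<le> n"
  shows "\<exists>G\<in>polys {..n}. \<forall>z. z 0 \<noteq> 0 \<longrightarrow> z 0 ^ (n + 1) * L z j = meval z G"
proof (cases "j = 0")
  case True
  then show ?thesis
    by (intro bexI[of _ "mvar 0 ^ (n + 1) * mvar 0"]) (auto simp: L_0 intro!: polys_intros)
next
  case False
  define \<Theta> where "\<Theta> z = (\<Sum>k<n+2. scale (fps_nth (fps_ln 1) k * z 0 ^ (n + 1 - k)) (m_part scale n e z ^ k))"
    for z :: "nat \<Rightarrow> 'k"
  have "A.alg_poly {..n} \<Theta>"
    unfolding \<Theta>_def
    by (intro A.alg_poly_sum A.alg_poly_scale A.alg_poly_power A.alg_poly_m_part poly_fun_mult
        poly_fun_const poly_fun_power poly_fun_coord) auto
  then have "poly_fun {..n} (\<lambda>z. B.cd (\<Theta> z) j)"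
    unfolding A.alg_poly_def using B.functional_cd by blast
  then obtain G where G: "G \<in> polys {..n}" "\<And>z. B.cd (\<Theta> z) j = meval z G"
    by (auto simp: poly_fun_def)
  have "z 0 ^ (n + 1) * L z j = meval z G" if z: "z 0 \<noteq> 0" for z
  proof -
    have "scale (z 0 ^ (n + 1)) (logm z) = \<Theta> z"
      unfolding logm_def A.fps_val_def \<Theta>_def A.scale_sum_right
    proof (rule sum.cong[OF refl])
      fix k assume "k \<in> {..<n + 2}"
      then have "z 0 ^ (n + 1) * (1 / z 0) ^ k = z 0 ^ (n + 1 - k)"
        using z by (simp add: power_diff power_one_over field_simps)
      then show "scale (z 0 ^ (n + 1)) (scale (fps_nth (fps_ln 1) k) (scale (1 / z 0) (m_part scale n e z) ^ k))
          = scale (fps_nth (fps_ln 1) k * z 0 ^ (n + 1 - k)) (m_part scale n e z ^ k)"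
        by (simp only: A.scale_power A.scale_scale) (simp only: ac_simps)
    qed
    then have "z 0 ^ (n + 1) * B.cd (logm z) j = B.cd (\<Theta> z) j"
      using B.cd_scale[of "z 0 ^ (n + 1)" "logm z"] by simp
    then show ?thesis using False G by (simp add: L_def)
  qed
  then show ?thesis using G by blast
qed

lemma pullback_L:
  assumes "Q \<in> polys {..n}"
  shows "\<exists>N. \<exists>G\<in>polys {..n}. \<forall>z. z 0 \<noteq> 0 \<longrightarrow> z 0 ^ N * meval (L z) Q = meval z G"
  using assms
proof (induction rule: polys_induct)
  case (const c)
  show ?case by (rule exI[of _ 0], rule bexI[of _ "mconst c"]) auto
next
  case (var v)
  then obtain G where "G \<in> polys {..n}" "\<forall>z. z 0 \<noteq> 0 \<longrightarrow> z 0 ^ (n + 1) * L z v = meval z G"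
    using L_polynomial[of v] by auto
  then show ?case by (intro exI[of _ "n + 1"] bexI[of _ G]) auto
next
  case (add p q)
  then obtain N N' G G' where "G \<in> polys {..n}" "G' \<in> polys {..n}"
    and eq: "\<And>z. z 0 \<noteq> 0 \<Longrightarrow> z 0 ^ N * meval (L z) p = meval z G"
      "\<And>z. z 0 \<noteq> 0 \<Longrightarrow> z 0 ^ N' * meval (L z) q = meval z G'"
    by blast
  then have "mvar 0 ^ N' * G + mvar 0 ^ N * G' \<in> polys {..n}" by (auto intro!: polys_intros)
  moreover have "z 0 ^ (N + N') * meval (L z) (p + q) = meval z (mvar 0 ^ N' * G + mvar 0 ^ N * G')"
    if "z 0 \<noteq> 0" for z
    using that by (simp add: eq[of z, symmetric] power_add algebra_simps)
  ultimately show ?case by blast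
next
  case (mult p q)
  then obtain N N' G G' where "G \<in> polys {..n}" "G' \<in> polys {..n}"
    and eq: "\<And>z. z 0 \<noteq> 0 \<Longrightarrow> z 0 ^ N * meval (L z) p = meval z G"
      "\<And>z. z 0 \<noteq> 0 \<Longrightarrow> z 0 ^ N' * meval (L z) q = meval z G'"
    by blast
  then have "G * G' \<in> polys {..n}" by (auto intro!: polys_intros)
  moreover have "z 0 ^ (N + N') * meval (L z) (p * q) = meval z (G * G')"
    if "z 0 \<noteq> 0" for z
    using that by (simp add: eq[of z, symmetric] power_add ac_simps)
  ultimately show ?case by blast
qed

text \<open>The kernel of \<open>\<Psi>\<close>, the restriction of polynomials to the cone \<open>K\<^sup>\<times> exp U\<close>, is generated by \<open>f\<close>,
  since in logarithmic coordinates \<open>f\<close> is, up to a power of \<open>z\<^sub>0\<close>, the last coordinate.\<close>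

theorem restriction_to_orbit:
  "\<exists>\<Psi> :: (nat, 'k) mpoly \<Rightarrow> (nat, 'k) mpoly. rhom \<Psi> \<and> \<Psi> (mvar 0) = mvar 0 \<and>
    (\<forall>c. \<Psi> (mconst c) = mconst c) \<and>
    (\<forall>P\<in>polys {..n}. \<Psi> P = 0 \<longleftrightarrow> f dvd P) \<and>
    (\<forall>P. \<Psi> P \<in> polys {..<n}) \<and>
    (\<forall>t\<in>polys {..<n}. \<exists>N. \<exists>G\<in>polys {..n}. \<Psi> G = mvar 0 ^ N * t)"
proof -
  obtain \<sigma> where \<sigma>: "\<And>j. \<sigma> j \<in> polys {..n}" "\<And>v j. E v j = meval v (\<sigma> j)"
    using E_polynomial by blast
  \<comment> \<open>Composition with \<open>E\<close>, followed by restriction to the hyperplane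
    where the last logarithmic coordinate vanishes.\<close>
  define \<Psi> where "\<Psi> P = sub0 n (subst \<sigma> P)" for P
  have meval_\<sigma>: "meval v (subst \<sigma> P) = meval (E v) P" for v P
    unfolding meval_subst \<sigma>(2)[symmetric] ..
  have rhom: "rhom \<Psi>"
    unfolding \<Psi>_def by (rule rhom_comp[OF rhom_sub0 rhom_subst])
  have \<sigma>_polys: "subst \<sigma> P \<in> polys {..n}" for P
  proof -
    have "subst \<sigma> P \<in> polys (\<Union>v\<in>mvars P. {..n})"
      by (rule polys_subst[OF polys_mvars]) (auto intro: polys_mono[OF _ \<sigma>(1)])
    then show ?thesis by (rule polys_mono[rotated]) auto
  qed
  have \<Psi>_polys: "\<Psi> P \<in> polys {..<n}" for P
  proof -
    have "{..n} - {n} = {..<n}" by auto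
    then show ?thesis using sub0_polys[OF \<sigma>_polys, of n P] by (simp add: \<Psi>_def)
  qed
  have \<sigma>0: "\<sigma> 0 = mvar 0"
    using \<sigma>(2)[of _ 0] by (intro mpoly_eqI_nonzero[of "{..n}" 0] \<sigma>(1)) (auto simp: E_0)
  have \<Psi>0: "\<Psi> (mvar 0) = mvar 0"
    using n_pos by (simp add: \<Psi>_def \<sigma>0)
  have \<Psi>_const: "\<Psi> (mconst c) = mconst c" for c
    by (simp add: \<Psi>_def)
  have f_ker: "\<Psi> f = 0"
  proof -
    \<comment> \<open>In logarithmic coordinates the equation is the last coordinate up to a power
      of z_0; setting that coordinate to 0 kills it.\<close>
    have "subst \<sigma> f = mvar 0 ^ d * mvar n"
    proof (rule mpoly_eqI_nonzero[of "{..n}" 0])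
      fix v :: "nat \<Rightarrow> 'k" assume "v \<in> vecs {..n}" "v 0 \<noteq> 0"
      then show "meval v (subst \<sigma> f) = meval v (mvar 0 ^ d * mvar n)"
        using f_eq_L[OF E_in, of v] by (simp add: meval_\<sigma> E_0 L_E)
    qed (use \<sigma>_polys in \<open>auto intro!: polys_intros\<close>)
    then show ?thesis by (simp add: \<Psi>_def)
  qed
  have ker: "f dvd P" if P: "P \<in> polys {..n}" "\<Psi> P = 0" for P
  proof -
    obtain Q where Q: "subst \<sigma> P = mvar n * Q"
      using P(2) unfolding \<Psi>_def mvar_dvd_iff[symmetric] by (auto elim: dvdE)
    have Qp: "Q \<in> polys {..n}"
    proof (cases "Q = 0")
      case False
      then show ?thesis
        using polys_factor[of Q "mvar n" "{..n}"] \<sigma>_polys[of P] Q by (simp add: mult.commute)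
    qed simp
    obtain N G where G: "G \<in> polys {..n}" "\<And>z. z 0 \<noteq> 0 \<Longrightarrow> z 0 ^ N * meval (L z) Q = meval z G"
      using pullback_L[OF Qp] by blast
    \<comment> \<open>Pulling \<open>subst \<sigma> P = mvar n * Q\<close> back along
      \<open>L\<close> replaces the last coordinate by f/z_0^d and \<open>Q\<close> by G/z_0^N.
      Since z_0 is prime and does not divide \<open>f\<close>, the power of z_0 divides
      \<open>G\<close>.\<close>
    have "mvar 0 ^ (d + N) * P = f * G"
    proof (rule mpoly_eqI_nonzero[of "{..n}" 0])
      fix z :: "nat \<Rightarrow> 'k" assume z: "z \<in> vecs {..n}" "z 0 \<noteq> 0"
      have "meval z P = meval (L z) (subst \<sigma> P)" using z by (simp add: meval_\<sigma> E_L)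
      then show "meval z (mvar 0 ^ (d + N) * P) = meval z (f * G)"
        using f_eq_L[of z] z by (simp add: Q power_add ac_simps flip: G(2)[of z])
    qed (use P f_vars G in \<open>auto intro!: polys_intros\<close>)
    then have "mvar 0 ^ (d + N) dvd f * G" by (metis dvd_triv_left)
    then have "mvar 0 ^ (d + N) dvd G"
      by (rule prime_power_dvd_cancel[OF prime_elem_mvar not_mvar_dvd])
    then obtain G' where "G = mvar 0 ^ (d + N) * G'" by (rule dvdE)
    then have "mvar 0 ^ (d + N) * P = mvar 0 ^ (d + N) * (f * G')"
      using \<open>mvar 0 ^ (d + N) * P = f * G\<close> by (simp add: ac_simps)
    then show ?thesis by simp
  qed
  have onto: "\<exists>N. \<exists>G\<in>polys {..n}. \<Psi> G = mvar 0 ^ N * t" if t: "t \<in> polys {..<n}" for t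
  proof -
    have t': "t \<in> polys {..n}" using t by (rule polys_mono[rotated]) auto
    obtain N G where G: "G \<in> polys {..n}" "\<And>z. z 0 \<noteq> 0 \<Longrightarrow> z 0 ^ N * meval (L z) t = meval z G"
      using pullback_L[OF t'] by blast
    have "subst \<sigma> G = mvar 0 ^ N * t"
    proof (rule mpoly_eqI_nonzero[of "{..n}" 0])
      fix v :: "nat \<Rightarrow> 'k" assume v: "v \<in> vecs {..n}" "v 0 \<noteq> 0"
      then show "meval v (subst \<sigma> G) = meval v (mvar 0 ^ N * t)"
        using G(2)[of "E v"] by (simp add: meval_\<sigma> E_0 L_E)
    qed (use t' \<sigma>_polys in \<open>auto intro!: polys_intros\<close>)
    then have "\<Psi> G = mvar 0 ^ N * t"
      using n_pos sub0_ident[OF t, of n] by (simp add: \<Psi>_def)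
    then show ?thesis using G by blast
  qed
  have "\<Psi> P = 0 \<longleftrightarrow> f dvd P" if "P \<in> polys {..n}" for P
    using ker[OF that] f_ker rhom.dvd[OF rhom, of f P] by auto
  then show ?thesis
    using rhom \<Psi>0 \<Psi>_const \<Psi>_polys onto by (intro exI[of _ \<Psi>] conjI ballI allI)
qed

end

section \<open>Hypersurfaces\<close>

lemma in_pt_iff: "u \<in> pt v \<longleftrightarrow> (\<exists>c. c \<noteq> 0 \<and> u = (\<lambda>i. c * v i))"
  unfolding pt_def mem_Collect_eq by (rule ex_cong1) (rule conj_commute)

lemma pt_scale: "pt (\<lambda>i. c * v i) = pt v" if "c \<noteq> 0" for c :: "'k::field"
proof (rule set_eqI)
  fix u
  show "u \<in> pt (\<lambda>i. c * v i) \<longleftrightarrow> u \<in> pt v"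
  proof
    assume "u \<in> pt (\<lambda>i. c * v i)"
    then obtain b where "b \<noteq> 0" "u = (\<lambda>i. b * (c * v i))" by (auto simp: in_pt_iff)
    then show "u \<in> pt v"
      unfolding in_pt_iff using that by (intro exI[of _ "b * c"]) (simp add: mult.assoc)
  next
    assume "u \<in> pt v"
    then obtain b where "b \<noteq> 0" "u = (\<lambda>i. b * v i)" by (auto simp: in_pt_iff)
    then show "u \<in> pt (\<lambda>i. c * v i)"
      unfolding in_pt_iff using that by (intro exI[of _ "b / c"]) simp
  qed
qed

lemma pt_eq_iff: "pt v = pt w \<longleftrightarrow> (\<exists>c. c \<noteq> 0 \<and> w = (\<lambda>i. c * v i))"
proof
  assume eq: "pt v = pt w"
  have "w \<in> pt w" unfolding in_pt_iff by (intro exI[of _ 1]) simp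
  then show "\<exists>c. c \<noteq> 0 \<and> w = (\<lambda>i. c * v i)" unfolding eq[symmetric] in_pt_iff .
qed (auto simp: pt_scale)

lemma nzvecs_scale: "v \<in> nzvecs n \<Longrightarrow> c \<noteq> 0 \<Longrightarrow> (\<lambda>i. c * v i) \<in> nzvecs n"
  for v :: "nat \<Rightarrow> 'k::field"
  by (auto simp: nzvecs_def vecs_def fun_eq_iff)

lemma homogeneous_zero_pt:
  fixes v w :: "nat \<Rightarrow> 'k::field"
  assumes "homogeneous e p" "pt v = pt w"
  shows "meval v p = 0 \<longleftrightarrow> meval w p = 0"
proof -
  obtain c where c: "c \<noteq> 0" "w = (\<lambda>i. c * v i)" using assms(2) unfolding pt_eq_iff by (elim exE conjE)
  show ?thesis unfolding c(2) meval_homogeneous[OF assms(1)] using c(1) by simp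
qed

lemma pt_in_proj_zeros:
  assumes hom: "\<And>p. p \<in> P \<Longrightarrow> \<exists>e. homogeneous e p" and u: "u \<in> nzvecs n"
  shows "pt u \<in> proj_zeros n P \<longleftrightarrow> (\<forall>p\<in>P. meval u p = 0)"
proof
  assume "pt u \<in> proj_zeros n P"
  then obtain v where v: "pt u = pt v" "\<forall>p\<in>P. meval v p = 0" by (auto simp: proj_zeros_def)
  then show "\<forall>p\<in>P. meval u p = 0" using hom homogeneous_zero_pt[OF _ v(1)] by blast
next
  assume "\<forall>p\<in>P. meval u p = 0"
  then show "pt u \<in> proj_zeros n P" using u unfolding proj_zeros_def by blast
qed

text \<open>The chosen representative is immaterial when \<open>G\<close> and \<open>H\<close> are
  homogeneous of equal degree. The result is a function on all points, as germs are represented by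
  such functions.\<close>

definition ratio :: "nat \<Rightarrow> (nat, 'k::field) mpoly \<Rightarrow> (nat, 'k) mpoly \<Rightarrow> 'k point \<Rightarrow> 'k" where
  "ratio n G H y = (let u = SOME u. u \<in> nzvecs n \<and> pt u = y in meval u G / meval u H)"

lemma ratio_pt:
  assumes "homogeneous j G" "homogeneous j H" "u \<in> nzvecs n"
  shows "ratio n G H (pt u) = meval u G / meval u H"
proof -
  define w where "w = (SOME w. w \<in> nzvecs n \<and> pt w = pt u)"
  have "w \<in> nzvecs n \<and> pt w = pt u"
    unfolding w_def by (rule someI[of "\<lambda>w. w \<in> nzvecs n \<and> pt w = pt u" u]) (simp add: assms(3))
  then have "pt u = pt w" by simp
  then obtain c where c: "c \<noteq> 0" "w = (\<lambda>i. c * u i)" unfolding pt_eq_iff by (elim exE conjE)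
  have "ratio n G H (pt u) = meval w G / meval w H"
    by (simp add: ratio_def Let_def w_def)
  also have "\<dots> = meval u G / meval u H"
    unfolding c(2) meval_homogeneous[OF assms(1)] meval_homogeneous[OF assms(2)]
    using c(1) by simp
  finally show ?thesis .
qed

text \<open>The Nullstellensatz is assumed for the single polynomial \<open>f\<close>; it is
  supplied later by the parametrization.\<close>

locale prime_hypersurface =
  fixes n d :: nat and f :: "(nat, 'k::field_char_0) mpoly" and X :: "'k point set"
  assumes f_vars: "f \<in> polys {..n}" and f_hom: "homogeneous d f" and f_prime: "prime_elem f"
    and X_eq: "X = proj_zeros n {f}"
    and nullstellensatz: "P \<in> polys {..n} \<Longrightarrow>
      (\<And>v. v \<in> nzvecs n \<Longrightarrow> meval v f = 0 \<Longrightarrow> meval v P = 0) \<Longrightarrow> f dvd P"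
begin

lemma pt_in_X: "u \<in> nzvecs n \<Longrightarrow> pt u \<in> X \<longleftrightarrow> meval u f = 0"
  using pt_in_proj_zeros[of "{f}" u n] f_hom unfolding X_eq by blast

lemma X_cases:
  assumes "x \<in> X" obtains u where "u \<in> nzvecs n" "x = pt u" "meval u f = 0"
  using assms by (auto simp: X_eq proj_zeros_def)

definition basic_open :: "(nat, 'k) mpoly \<Rightarrow> 'k point set" where
  "basic_open Q = X - proj_zeros n {Q}"

lemma basic_open_open: "Q \<in> polys {..n} \<Longrightarrow> homogeneous e Q \<Longrightarrow> zariski_open n X (basic_open Q)"
  unfolding zariski_open_def basic_open_def hom_polys_def polys_def
  by (intro exI[of _ "{Q}"]) auto

lemma pt_in_basic_open:
  "homogeneous e Q \<Longrightarrow> u \<in> nzvecs n \<Longrightarrow> pt u \<in> basic_open Q \<longleftrightarrow> meval u f = 0 \<and> meval u Q \<noteq> 0"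
  using pt_in_proj_zeros[of "{Q}" u n] unfolding basic_open_def by (auto simp: pt_in_X)

lemma not_dvd: "meval u f = 0 \<Longrightarrow> meval u Q \<noteq> 0 \<Longrightarrow> \<not> f dvd Q"
  using rhom.dvd[OF rhom_meval, of f Q u] by auto

lemma generic_point:
  assumes "Q \<in> polys {..n}" "\<not> f dvd Q"
  obtains u where "u \<in> nzvecs n" "meval u f = 0" "meval u Q \<noteq> 0"
  using nullstellensatz[of Q] assms by blast

text \<open>\<open>P * Q\<close> vanishes on all of \<open>X\<close>, and \<open>f\<close> is prime.
  This turns an identity on a nonempty open subset of \<open>X\<close> into divisibility by
  \<open>f\<close>.\<close>

lemma generic_zero:
  assumes "P \<in> polys {..n}" "Q \<in> polys {..n}" "\<not> f dvd Q"
    and "\<And>u. u \<in> nzvecs n \<Longrightarrow> meval u f = 0 \<Longrightarrow> meval u Q \<noteq> 0 \<Longrightarrow> meval u P = 0"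
  shows "f dvd P"
proof -
  have "f dvd P * Q"
    by (rule nullstellensatz) (use assms in \<open>auto intro!: polys_intros\<close>)
  then show ?thesis using assms(3) f_prime by (auto simp: prime_elem_def)
qed

lemma open_basic:
  assumes W: "zariski_open n X W" "pt v \<in> W" and v: "v \<in> nzvecs n"
  obtains Q e where "Q \<in> polys {..n}" "homogeneous e Q" "meval v Q \<noteq> 0" "meval v f = 0"
    "\<And>u. u \<in> nzvecs n \<Longrightarrow> meval u f = 0 \<Longrightarrow> meval u Q \<noteq> 0 \<Longrightarrow> pt u \<in> W"
proof -
  obtain P where P: "P \<subseteq> hom_polys n" "W = X - proj_zeros n P" using W(1) by (auto simp: zariski_open_def)
  have hom: "\<exists>e. homogeneous e p" if "p \<in> P" for p using that P(1) by (auto simp: hom_polys_def)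
  obtain Q where Q: "Q \<in> P" "meval v Q \<noteq> 0"
    using W(2) pt_in_proj_zeros[OF hom v] unfolding P(2) by blast
  then obtain e where e: "homogeneous e Q" "Q \<in> polys {..n}" using P by (auto simp: hom_polys_def polys_def)
  have "pt u \<in> W" if "u \<in> nzvecs n" "meval u f = 0" "meval u Q \<noteq> 0" for u
    using that P(2) Q(1) pt_in_proj_zeros[OF hom that(1)] by (auto simp: pt_in_X)
  moreover have "meval v f = 0" using W(2) v P by (auto simp: pt_in_X)
  ultimately show thesis using that e Q by blast
qed

lemma open_nonempty_basic:
  assumes W: "zariski_open n X W" "W \<noteq> {}"
  obtains Q e where "Q \<in> polys {..n}" "homogeneous e Q" "\<not> f dvd Q"
    "\<And>u. u \<in> nzvecs n \<Longrightarrow> meval u f = 0 \<Longrightarrow> meval u Q \<noteq> 0 \<Longrightarrow> pt u \<in> W"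
proof -
  obtain x where "x \<in> W" using W(2) by blast
  moreover have "W \<subseteq> X" using W(1) by (auto simp: zariski_open_def)
  ultimately obtain v where v: "v \<in> nzvecs n" "pt v \<in> W" using X_cases by blast
  show thesis
    using open_basic[OF W(1) v(2,1)] not_dvd that by metis
qed

lemma regular_at_basic:
  assumes "regular_at n X (pt v) h" "v \<in> nzvecs n"
  obtains Q e G H where "Q \<in> polys {..n}" "homogeneous e Q" "meval v Q \<noteq> 0"
    "G \<in> polys {..n}" "H \<in> polys {..n}"
    "\<And>u. u \<in> nzvecs n \<Longrightarrow> meval u f = 0 \<Longrightarrow> meval u Q \<noteq> 0 \<Longrightarrow>
      meval u H \<noteq> 0 \<and> h (pt u) = meval u G / meval u H"
proof -
  obtain W G H where W: "zariski_open n X W" "pt v \<in> W" "mvars G \<subseteq> {..n}" "mvars H \<subseteq> {..n}"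
    "\<forall>v \<in> nzvecs n. pt v \<in> W \<longrightarrow> meval v H \<noteq> 0 \<and> h (pt v) = meval v G / meval v H"
    using assms(1) unfolding regular_at_def by blast
  obtain Q e where "Q \<in> polys {..n}" "homogeneous e Q" "meval v Q \<noteq> 0"
    "\<And>u. u \<in> nzvecs n \<Longrightarrow> meval u f = 0 \<Longrightarrow> meval u Q \<noteq> 0 \<Longrightarrow> pt u \<in> W"
    using open_basic[OF W(1,2) assms(2)] by metis
  then show thesis using that[of Q e G H] W by (auto simp: polys_def)
qed

lemma regular_at_ratio:
  assumes "G \<in> polys {..n}" "H \<in> polys {..n}" "homogeneous j G" "homogeneous j H"
    and "v \<in> nzvecs n" "meval v f = 0" "meval v H \<noteq> 0"
  shows "regular_at n X (pt v) (ratio n G H)"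
  unfolding regular_at_def
  using assms basic_open_open[OF assms(2,4)]
  by (intro exI[of _ "basic_open H"] exI[of _ G] exI[of _ H] exI[of _ j])
    (auto simp: pt_in_basic_open polys_def ratio_pt)

lemma rational_eqI:
  assumes "Q \<in> polys {..n}" "homogeneous e Q" "\<not> f dvd Q"
    and "\<And>u. u \<in> nzvecs n \<Longrightarrow> meval u f = 0 \<Longrightarrow> meval u Q \<noteq> 0 \<Longrightarrow> h (pt u) = g (pt u)"
  shows "rational_eq n X h g"
proof -
  obtain u where "u \<in> nzvecs n" "meval u f = 0" "meval u Q \<noteq> 0"
    using generic_point[OF assms(1,3)] .
  then have "basic_open Q \<noteq> {}" using pt_in_basic_open[OF assms(2)] by blast
  moreover have "h x = g x" if x: "x \<in> basic_open Q" for x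
  proof -
    obtain u where "u \<in> nzvecs n" "x = pt u" "meval u f = 0"
      using x X_cases[of x] by (auto simp: basic_open_def)
    then show ?thesis using x assms(4) pt_in_basic_open[OF assms(2)] by blast
  qed
  ultimately show ?thesis
    unfolding rational_eq_def using basic_open_open[OF assms(1,2)] by blast
qed

lemma rational_eqD:
  assumes "rational_eq n X h g"
  obtains Q e where "Q \<in> polys {..n}" "homogeneous e Q" "\<not> f dvd Q"
    "\<And>u. u \<in> nzvecs n \<Longrightarrow> meval u f = 0 \<Longrightarrow> meval u Q \<noteq> 0 \<Longrightarrow> h (pt u) = g (pt u)"
proof -
  obtain W where W: "zariski_open n X W" "W \<noteq> {}" "\<And>x. x \<in> W \<Longrightarrow> h x = g x"
    using assms unfolding rational_eq_def by blast
  show thesis using open_nonempty_basic[OF W(1,2)] W(3) that by metis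
qed

text \<open>Since \<open>h\<close> is invariant under scaling, a representation \<open>h = G/T\<close> by inhomogeneous
  polynomials splits into homogeneous components.\<close>

lemma in_local_ringI:
  assumes v: "v \<in> nzvecs n" "meval v f = 0"
    and T: "T \<in> polys {..n}" "meval v T \<noteq> 0" and G: "G \<in> polys {..n}"
    and Q: "Q \<in> polys {..n}" "homogeneous e Q" "\<not> f dvd Q"
    and h: "\<And>u. u \<in> nzvecs n \<Longrightarrow> meval u f = 0 \<Longrightarrow> meval u Q \<noteq> 0 \<Longrightarrow> h (pt u) * meval u T = meval u G"
  shows "in_local_ring n X (pt v) h"
proof -
  have "meval (\<lambda>i. 1 * v i) T \<noteq> 0" using T by simp
  \<comment> \<open>The value of \<open>T\<close> at \<open>v\<close> is the sum of the values of
    its components, so some component is nonzero there; it becomes the denominator.\<close>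
  then obtain j where j: "meval v (coeff (grade T) j) \<noteq> 0"
    unfolding meval_scaled by (metis (no_types, lifting) mult_zero_left sum.neutral)
  define Tj Gj where "Tj = coeff (grade T) j" and "Gj = coeff (grade G) j"
  have hom: "homogeneous j Tj" "homogeneous j Gj"
    by (simp_all add: Tj_def Gj_def homogeneous_coeff_grade)
  have pol: "Tj \<in> polys {..n}" "Gj \<in> polys {..n}"
    using T G by (simp_all add: Tj_def Gj_def coeff_grade_polys)
  have nd: "\<not> f dvd Tj" using not_dvd[OF v(2)] j by (simp add: Tj_def)
  have comp: "h (pt u) * meval u Tj = meval u Gj"
    if u: "u \<in> nzvecs n" "meval u f = 0" "meval u Q \<noteq> 0" for u
  proof -
    define q where "q P = (\<Sum>i\<le>tdeg P. monom (meval u (coeff (grade P) i)) i)" for P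
    have poly_q: "poly (q P) c = meval (\<lambda>i. c * u i) P" for P c
      by (simp add: q_def poly_sum poly_monom meval_scaled)
    have coeff_q: "coeff (q P) j = meval u (coeff (grade P) j)" for P
      using coeff_eq_0[of "grade P" j] by (auto simp: q_def coeff_sum tdeg_def)
    \<comment> \<open>The identity along the line through \<open>u\<close> is known only for nonzero
      scalars; the extra factor X makes it hold at 0 too, so that coefficients can be
      compared.\<close>
    have "poly ([:0, 1:] * (smult (h (pt u)) (q T) - q G)) c = 0" for c
    proof (cases "c = 0")
      case False
      have "pt (\<lambda>i. c * u i) = pt u" by (rule pt_scale[OF False])
      then have "h (pt u) * meval (\<lambda>i. c * u i) T = meval (\<lambda>i. c * u i) G"
        using h[OF nzvecs_scale[OF u(1) False]] u False meval_homogeneous[OF f_hom] meval_homogeneous[OF Q(2)]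
        by simp
      then show ?thesis by (simp add: poly_q)
    qed simp
    then have "[:0, 1:] * (smult (h (pt u)) (q T) - q G) = 0"
      using poly_all_0_iff_0 by blast
    then have "smult (h (pt u)) (q T) - q G = 0"
      unfolding mult_eq_0_iff by simp
    then have "coeff (smult (h (pt u)) (q T) - q G) j = 0" by simp
    then show ?thesis by (simp add: coeff_q Tj_def Gj_def)
  qed
  have "regular_at n X (pt v) (ratio n Gj Tj)"
    using regular_at_ratio[OF pol(2,1) hom(2,1) v] j by (simp add: Tj_def)
  moreover have "rational_eq n X h (ratio n Gj Tj)"
  proof (rule rational_eqI)
    show "Q * Tj \<in> polys {..n}" "homogeneous (e + j) (Q * Tj)" "\<not> f dvd Q * Tj"
      using Q pol hom nd f_prime by (auto intro: polys_mult homogeneous_mult simp: prime_elem_dvd_mult_iff)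
    fix u assume "u \<in> nzvecs n" "meval u f = 0" "meval u (Q * Tj) \<noteq> 0"
    then show "h (pt u) = ratio n Gj Tj (pt u)"
      using comp[of u] by (simp add: ratio_pt[OF hom(2,1)] field_simps)
  qed
  ultimately show ?thesis unfolding in_local_ring_def by blast
qed

text \<open>Clearing denominators in the integral equation for G0/H0 gives the divisibility assumed
  in \<open>den\<close>, and the conclusion of \<open>den\<close> gives a representation with a
  denominator nonzero at \<open>v\<close>.\<close>

lemma normalI:
  assumes den: "\<And>v r C G0 H0. v \<in> nzvecs n \<Longrightarrow> meval v f = 0 \<Longrightarrow> (\<And>i. i \<le> r \<Longrightarrow> C i \<in> polys {..n}) \<Longrightarrow>
      G0 \<in> polys {..n} \<Longrightarrow> H0 \<in> polys {..n} \<Longrightarrow> f dvd (\<Sum>i\<le>r. C i * G0 ^ i * H0 ^ (r - i)) \<Longrightarrow>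
      \<not> f dvd H0 \<Longrightarrow> meval v (C r) \<noteq> 0 \<Longrightarrow>
      \<exists>T\<in>polys {..n}. \<exists>G\<in>polys {..n}. meval v T \<noteq> 0 \<and> f dvd T * G0 - H0 * G"
  shows "normal_variety n X"
  unfolding normal_variety_def
proof (intro ballI allI impI, elim conjE)
  fix x h assume x: "x \<in> X" and rat: "rational_fun n X h" and int: "integral_over_local_ring n X x h"
  obtain v where v: "v \<in> nzvecs n" "x = pt v" "meval v f = 0" using X_cases[OF x] .
  obtain W where W: "zariski_open n X W" "W \<noteq> {}" "\<And>y. y \<in> W \<Longrightarrow> regular_at n X y h"
    using rat unfolding rational_fun_def by blast
  have "W \<subseteq> X" using W(1) by (auto simp: zariski_open_def)
  then obtain v0 where v0: "v0 \<in> nzvecs n" "pt v0 \<in> W" "meval v0 f = 0" using W(2) X_cases by blast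
  obtain Q0 e0 G0 H0 where Q0: "Q0 \<in> polys {..n}" "meval v0 Q0 \<noteq> 0" "homogeneous e0 Q0" and GH0: "G0 \<in> polys {..n}" "H0 \<in> polys {..n}"
    and h0: "\<And>u. u \<in> nzvecs n \<Longrightarrow> meval u f = 0 \<Longrightarrow> meval u Q0 \<noteq> 0 \<Longrightarrow>
      meval u H0 \<noteq> 0 \<and> h (pt u) = meval u G0 / meval u H0"
    using regular_at_basic[OF W(3)[OF v0(2)] v0(1)] by metis
  have nQ0: "\<not> f dvd Q0" by (rule not_dvd[OF v0(3) Q0(2)])
  have nH0: "\<not> f dvd H0" using h0[OF v0(1,3) Q0(2)] by (intro not_dvd[OF v0(3)]) simp
  obtain r c where c: "\<And>i. i < r \<Longrightarrow> regular_at n X (pt v) (c i)"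
    and eq: "rational_eq n X (\<lambda>y. h y ^ r + (\<Sum>i<r. c i y * h y ^ i)) (\<lambda>_. 0)"
    using int unfolding integral_over_local_ring_def v(2) by blast
  obtain Q1 where Q1: "Q1 \<in> polys {..n}" "\<not> f dvd Q1"
    and eq1: "\<And>u. u \<in> nzvecs n \<Longrightarrow> meval u f = 0 \<Longrightarrow> meval u Q1 \<noteq> 0 \<Longrightarrow>
      h (pt u) ^ r + (\<Sum>i<r. c i (pt u) * h (pt u) ^ i) = 0"
    using rational_eqD[OF eq] by metis
  have "\<forall>i. \<exists>Q G H. i < r \<longrightarrow> Q \<in> polys {..n} \<and> meval v Q \<noteq> 0 \<and> G \<in> polys {..n} \<and> H \<in> polys {..n} \<and>
    (\<forall>u. u \<in> nzvecs n \<longrightarrow> meval u f = 0 \<longrightarrow> meval u Q \<noteq> 0 \<longrightarrow>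
      meval u H \<noteq> 0 \<and> c i (pt u) = meval u G / meval u H)"
  proof
    fix i
    show "\<exists>Q G H. i < r \<longrightarrow> Q \<in> polys {..n} \<and> meval v Q \<noteq> 0 \<and> G \<in> polys {..n} \<and> H \<in> polys {..n} \<and>
      (\<forall>u. u \<in> nzvecs n \<longrightarrow> meval u f = 0 \<longrightarrow> meval u Q \<noteq> 0 \<longrightarrow>
        meval u H \<noteq> 0 \<and> c i (pt u) = meval u G / meval u H)"
    proof (cases "i < r")
      case True
      show ?thesis by (rule regular_at_basic[OF c[OF True] v(1)]) blast
    qed simp
  qed
  then obtain Q G H where QGH: "\<And>i. i < r \<Longrightarrow> Q i \<in> polys {..n} \<and> meval v (Q i) \<noteq> 0 \<and> G i \<in> polys {..n} \<and> H i \<in> polys {..n}"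
    and ci: "\<And>i u. i < r \<Longrightarrow> u \<in> nzvecs n \<Longrightarrow> meval u f = 0 \<Longrightarrow> meval u (Q i) \<noteq> 0 \<Longrightarrow>
      meval u (H i) \<noteq> 0 \<and> c i (pt u) = meval u (G i) / meval u (H i)"
    by metis
  \<comment> \<open>The coefficients G_i/H_i are brought to the common denominator
    \<open>C r\<close>, the product of all \<open>H j\<close>, which does not vanish at
    \<open>v\<close>.\<close>
  define C where "C i = (if i < r then G i * (\<Prod>j\<in>{..<r} - {i}. H j) else (\<Prod>j<r. H j))" for i
  define R where "R = Q0 * Q1 * (\<Prod>i<r. Q i)"
  have "f dvd (\<Sum>i\<le>r. C i * G0 ^ i * H0 ^ (r - i))"
  proof (rule generic_zero)
    show "(\<Sum>i\<le>r. C i * G0 ^ i * H0 ^ (r - i)) \<in> polys {..n}"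
      using QGH GH0 by (auto simp: C_def intro!: polys_intros)
    show "R \<in> polys {..n}" using QGH Q0 Q1 by (auto simp: R_def intro!: polys_intros)
    have "\<not> f dvd (\<Prod>i<r. Q i)"
      using prime_elem_prod[OF f_prime, of Q "{..<r}"] not_dvd[OF v(3)] QGH by blast
    then show "\<not> f dvd R"
      using nQ0 Q1 by (simp add: R_def prime_elem_dvd_mult_iff[OF f_prime])
    fix u assume u: "u \<in> nzvecs n" "meval u f = 0" "meval u R \<noteq> 0"
    then have nz: "meval u Q0 \<noteq> 0" "meval u Q1 \<noteq> 0" "\<And>i. i < r \<Longrightarrow> meval u (Q i) \<noteq> 0"
      by (auto simp: R_def)
    define y where "y = h (pt u)"
    have H0: "meval u H0 \<noteq> 0" "meval u G0 = y * meval u H0"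
      using h0[OF u(1,2) nz(1)] by (auto simp: y_def)
    let ?P = "\<Prod>j<r. meval u (H j)"
    have Ci: "meval u (C i) = ?P * c i (pt u)" if i: "i < r" for i
    proof -
      have "?P = meval u (H i) * (\<Prod>j\<in>{..<r} - {i}. meval u (H j))"
        using i by (intro prod.remove) auto
      then show ?thesis
        using ci[OF i u(1,2) nz(3)[OF i]] i by (simp add: C_def)
    qed
    have "meval u (\<Sum>i\<le>r. C i * G0 ^ i * H0 ^ (r - i))
        = (\<Sum>i\<le>r. meval u H0 ^ r * (meval u (C i) * y ^ i))"
      unfolding meval_hom
    proof (rule sum.cong[OF refl])
      fix i assume "i \<in> {..r}"
      then have "meval u H0 ^ r = meval u H0 ^ i * meval u H0 ^ (r - i)" by (simp flip: power_add)
      then show "meval u (C i) * meval u G0 ^ i * meval u H0 ^ (r - i) = meval u H0 ^ r * (meval u (C i) * y ^ i)"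
        by (simp add: H0(2) power_mult_distrib ac_simps)
    qed
    also have "\<dots> = meval u H0 ^ r * (\<Sum>i\<le>r. meval u (C i) * y ^ i)"
      by (rule sum_distrib_left[symmetric])
    also have "(\<Sum>i\<le>r. meval u (C i) * y ^ i) = (\<Sum>i<r. meval u (C i) * y ^ i) + ?P * y ^ r"
      by (simp add: C_def[of r] flip: lessThan_Suc_atMost)
    also have "(\<Sum>i<r. meval u (C i) * y ^ i) = ?P * (\<Sum>i<r. c i (pt u) * y ^ i)"
      unfolding sum_distrib_left by (rule sum.cong) (auto simp: Ci ac_simps)
    also have "\<dots> + ?P * y ^ r = ?P * (y ^ r + (\<Sum>i<r. c i (pt u) * y ^ i))"
      by (simp add: algebra_simps)
    also have "\<dots> = 0" using eq1[OF u(1,2) nz(2)] by (simp add: y_def)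
    finally show "meval u (\<Sum>i\<le>r. C i * G0 ^ i * H0 ^ (r - i)) = 0" by simp
  qed
  moreover have "meval v (C r) \<noteq> 0"
    using ci[OF _ v(1,3)] QGH by (auto simp: C_def)
  moreover have "C i \<in> polys {..n}" for i
    using QGH by (auto simp: C_def intro!: polys_intros)
  ultimately obtain T G' where T: "T \<in> polys {..n}" "G' \<in> polys {..n}" "meval v T \<noteq> 0" "f dvd T * G0 - H0 * G'"
    using den[OF v(1,3) _ GH0 _ nH0, of r C] by blast
  show "in_local_ring n X x h"
    unfolding v(2)
  proof (rule in_local_ringI[OF v(1,3) T(1,3,2) Q0(1,3) nQ0])
    fix u assume u: "u \<in> nzvecs n" "meval u f = 0" "meval u Q0 \<noteq> 0"
    have "meval u (T * G0 - H0 * G') = 0"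
      using rhom.dvd[OF rhom_meval T(4), of u] u(2) by simp
    then show "h (pt u) * meval u T = meval u G'"
      using h0[OF u] by (auto simp: field_simps)
  qed
qed

end

section \<open>The normality criterion\<close>

text \<open>\<Psi> embeds K[z_0, ..., z_n]/(f) into K[z_0, ..., z_{n-1}], and the two rings become
  equal after inverting z_0.\<close>

locale orbit_restriction =
  fixes n :: nat and f :: "(nat, 'k::field_char_0) mpoly"
    and \<Psi> :: "(nat, 'k) mpoly \<Rightarrow> (nat, 'k) mpoly"
  assumes n_pos: "1 \<le> n" and f_vars: "f \<in> polys {..n}" and f_nz: "f \<noteq> 0"
    and rhom_\<Psi>: "rhom \<Psi>" and \<Psi>_0: "\<Psi> (mvar 0) = mvar 0" and \<Psi>_const: "\<Psi> (mconst c) = mconst c"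
    and \<Psi>_ker: "P \<in> polys {..n} \<Longrightarrow> \<Psi> P = 0 \<longleftrightarrow> f dvd P"
    and \<Psi>_polys: "\<Psi> P \<in> polys {..<n}"
    and \<Psi>_onto: "t \<in> polys {..<n} \<Longrightarrow> \<exists>N. \<exists>G\<in>polys {..n}. \<Psi> G = mvar 0 ^ N * t"
begin

lemmas \<Psi>_hom = rhom.hom_simps[OF rhom_\<Psi>]

text \<open>The kernel of \<Psi> is known only inside \<open>polys {..n}\<close>, whereas
  \<open>prime_elem\<close> ranges over all polynomials. Factors of \<open>f\<close> stay in
  \<open>polys {..n}\<close>, so irreducibility can be tested there, and unique factorization gives
  primality.\<close>

lemma f_prime: "prime_elem f"
proof (rule irreducible_imp_prime_elem_mpoly)
  have f0: "\<Psi> f = 0" using \<Psi>_ker[OF f_vars] by simp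
  have "\<not> f dvd 1" using \<Psi>_ker[of 1] by (auto simp: \<Psi>_hom)
  moreover have "a dvd 1 \<or> b dvd 1" if ab: "f = a * b" for a b
  proof -
    have "a \<in> polys {..n}" "b \<in> polys {..n}"
      using polys_factor[of a b] polys_factor[of b a] f_vars f_nz by (auto simp: ab mult.commute)
    moreover have "\<Psi> a = 0 \<or> \<Psi> b = 0" using f0 by (simp add: ab \<Psi>_hom)
    ultimately have "f dvd a \<or> f dvd b" using \<Psi>_ker by blast
    then have "f * b dvd f * 1 \<or> f * a dvd f * 1"
      using ab by (metis dvd_refl mult.commute mult.right_neutral mult_dvd_mono)
    then show ?thesis using f_nz by auto
  qed
  ultimately show "irreducible f" using f_nz by (auto simp: irreducible_def)
qed

text \<open>Every \<open>v\<close> with \<open>v 0\<close> nonzero yields a point \<open>w\<close>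
  of the orbit, with coordinates the values of \<open>\<Psi> (mvar j)\<close>. So vanishing of
  \<open>P\<close> on \<open>X\<close> makes \<open>\<Psi> P\<close> vanish at enough points to be
  0.\<close>

lemma nullstellensatz:
  assumes P: "P \<in> polys {..n}" and zero: "\<And>v. v \<in> nzvecs n \<Longrightarrow> meval v f = 0 \<Longrightarrow> meval v P = 0"
  shows "f dvd P"
proof -
  have "\<Psi> P = 0"
  proof (rule mpoly_eqI_nonzero[of "{..<n}" 0])
    fix v :: "nat \<Rightarrow> 'k" assume v: "v \<in> vecs {..<n}" "v 0 \<noteq> 0"
    define w where "w j = (if j \<le> n then meval v (\<Psi> (mvar j)) else 0)" for j
    have eq: "meval v (\<Psi> Q) = meval w Q" if "Q \<in> polys {..n}" for Q
      by (rule rhom_eq_on_polys[OF that rhom_comp[OF rhom_meval rhom_\<Psi>] rhom_meval])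
        (auto simp: \<Psi>_const w_def)
    have "w 0 \<noteq> 0" using v by (simp add: w_def \<Psi>_0)
    then have "w \<in> nzvecs n" by (auto simp: nzvecs_def vecs_def w_def fun_eq_iff)
    moreover have "meval w f = 0"
      using eq[OF f_vars] \<Psi>_ker[OF f_vars] by simp
    ultimately show "meval v (\<Psi> P) = meval v 0" using zero eq[OF P] by simp
  qed (use n_pos \<Psi>_polys in auto)
  then show ?thesis using \<Psi>_ker[OF P] by simp
qed

text \<open>The orbit is isomorphic to an affine space, hence normal: away from \<open>z\<^sub>0 = 0\<close> an integral
  element has only the denominator \<open>C r\<close>.\<close>

lemma denominator_on_orbit:
  assumes C: "C r \<in> polys {..n}" and GH: "G0 \<in> polys {..n}" "H0 \<in> polys {..n}"
    and int: "(\<Sum>i\<le>r. C i * G0 ^ i * H0 ^ (r - i)) \<in> polys {..n}"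
      "f dvd (\<Sum>i\<le>r. C i * G0 ^ i * H0 ^ (r - i))"
    and H0: "\<not> f dvd H0"
  shows "\<exists>N G. f dvd mvar 0 ^ N * C r * G0 - H0 * G"
proof -
  have "(\<Sum>i\<le>r. \<Psi> (C i) * \<Psi> G0 ^ i * \<Psi> H0 ^ (r - i)) = 0"
    using \<Psi>_ker[OF int(1)] int(2) by (simp add: \<Psi>_hom)
  moreover have \<Psi>H0: "\<Psi> H0 \<noteq> 0" using \<Psi>_ker[OF GH(2)] H0 by simp
  ultimately have "\<Psi> H0 dvd \<Psi> (C r) * \<Psi> G0" by (rule rational_root)
  then obtain t where t: "\<Psi> (C r) * \<Psi> G0 = \<Psi> H0 * t" by (rule dvdE)
  have "t \<in> polys {..<n}"
  proof (cases "t = 0")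
    case False
    then have "t * \<Psi> H0 \<noteq> 0" using \<Psi>H0 by simp
    moreover have "t * \<Psi> H0 \<in> polys {..<n}"
      using t \<Psi>_polys by (metis mult.commute polys_mult)
    ultimately show ?thesis by (rule polys_factor[rotated])
  qed simp
  then obtain N G where G: "G \<in> polys {..n}" "\<Psi> G = mvar 0 ^ N * t" using \<Psi>_onto by blast
  have "\<Psi> (mvar 0 ^ N * C r * G0 - H0 * G) = mvar 0 ^ N * (\<Psi> (C r) * \<Psi> G0 - \<Psi> H0 * t)"
    by (simp add: \<Psi>_hom \<Psi>_0 G algebra_simps)
  then have "\<Psi> (mvar 0 ^ N * C r * G0 - H0 * G) = 0" by (simp add: t)
  moreover have "mvar 0 ^ N * C r * G0 - H0 * G \<in> polys {..n}"
    using C GH G by (auto intro!: polys_intros)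
  ultimately show ?thesis using \<Psi>_ker by blast
qed

end

text \<open>The zero is sought on the line with coordinates z_1, z_2, which exists by
  \<open>2 \<le> n\<close>. If q(1, t) is not constant it has a root; if it is a constant c, then
  q(t, 1) = c t^m vanishes at t = 0.\<close>

lemma homogeneous_zero_exists:
  fixes q :: "(nat, 'k::{alg_closed_field, field_char_0}) mpoly"
  assumes hom: "homogeneous m q" and m: "0 < m" and n: "2 \<le> n"
  shows "\<exists>v\<in>nzvecs n. v 0 = 0 \<and> meval v q = 0"
proof -
  define pnt where "pnt a b = (\<lambda>i::nat. if i = 1 then a else if i = 2 then b else (0::'k))" for a b
  have pnt: "pnt a b \<in> nzvecs n" "pnt a b 0 = 0" if "a \<noteq> 0 \<or> b \<noteq> 0" for a b
  proof -
    have "pnt a b 1 = a" "pnt a b 2 = b" by (simp_all add: pnt_def)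
    then have "pnt a b \<noteq> (\<lambda>_. 0)" using that by auto
    then show "pnt a b \<in> nzvecs n" using n by (auto simp: nzvecs_def vecs_def pnt_def)
    show "pnt a b 0 = 0" by (simp add: pnt_def)
  qed
  have line: "\<exists>P. \<forall>t. poly P t = meval (pnt (poly a t) (poly b t)) q" for a b
  proof -
    define P where "P = psub (\<lambda>c. [:c:]) (\<lambda>i. if i = 1 then a else if i = 2 then b else 0) q"
    have "poly P t = meval (pnt (poly a t) (poly b t)) q" for t
      unfolding P_def
      by (rule rhom_eqI[where p = q, OF rhom_comp[OF rhom_poly rhom_psub[OF rhom_pCons[OF rhom_id]]] rhom_meval])
        (auto simp: psub_mconst[OF rhom_pCons[OF rhom_id]] psub_mvar[OF rhom_pCons[OF rhom_id]] pnt_def)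
    then show ?thesis by blast
  qed
  obtain P where P: "\<And>t. poly P t = meval (pnt 1 t) q" using line[of "[:1:]" "[:0, 1:]"] by auto
  obtain R where R: "\<And>t. poly R t = meval (pnt t 1) q" using line[of "[:0, 1:]" "[:1:]"] by auto
  show ?thesis
  proof (cases "degree P > 0")
    case True
    then obtain t where "poly P t = 0" using alg_closed_imp_poly_has_root by blast
    then show ?thesis using P pnt[of 1 t] by auto
  next
    case False
    then obtain c where c: "P = [:c:]" using degree_eq_zeroE by blast
    have "poly ([:0, 1:] * (R - monom c m)) t = 0" for t
    proof (cases "t = 0")
      case False
      have "pnt t 1 = (\<lambda>i. t * pnt 1 (1 / t) i)" using False by (auto simp: pnt_def)
      then have "poly R t = t ^ m * poly P (1 / t)"
        unfolding R P by (simp only: meval_homogeneous[OF hom])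
      then show ?thesis by (simp add: c poly_monom)
    qed simp
    then have "[:0, 1:] * (R - monom c m) = 0" using poly_all_0_iff_0 by blast
    then have "R = monom c m" unfolding mult_eq_0_iff by simp
    then have "meval (pnt 0 1) q = 0" using R[of 0] m by (simp add: poly_monom zero_power)
    then show ?thesis using pnt[of 0 1] by auto
  qed
qed

text \<open>The witness is the rational function \<open>A z\<^sub>0 / (q l\<^sup>m)\<close>; multiplying
  \<open>f = A z\<^sub>0\<^sup>2 + w q z\<^sub>0 + r q\<^sup>2\<close> by \<open>A / q\<^sup>2\<close> gives an integral equation for \<open>A z\<^sub>0 / q\<close>.\<close>

lemma (in prime_hypersurface) not_normal:
  fixes A q w r :: "(nat, 'k) mpoly"
  assumes f_eq: "f = A * mvar 0 ^ 2 + w * q * mvar 0 + r * q ^ 2"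
    and vars: "A \<in> polys {..n}" "q \<in> polys {..n}" "w \<in> polys {..n}" "r \<in> polys {..n}"
    and q_irr: "irreducible q" and q_free: "sub0 0 q = q"
    and hom: "homogeneous (d - 2) A" "homogeneous k q" "homogeneous m w" "homogeneous (d - 2 * k) r"
    and deg: "d - 1 = k + m" "2 * k \<le> d" "2 \<le> d"
    and v: "v \<in> nzvecs n" "v 0 = 0" "meval v q = 0"
  shows "\<not> normal_variety n X"
proof
  assume normal: "normal_variety n X"
  have q_prime: "prime_elem q" by (rule irreducible_imp_prime_elem_mpoly[OF q_irr])
  have q0: "q \<noteq> 0" using q_irr by auto
  have fv: "meval v f = 0" by (simp add: f_eq v)
  have tdeg_f: "tdeg f = d" using tdeg_homogeneous[OF f_hom] f_prime by auto
  have f_not_dvd: "\<not> f dvd p" if "homogeneous j p" "p \<noteq> 0" "j < d" for p j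
  proof
    assume "f dvd p"
    then obtain c where c: "p = f * c" by (rule dvdE)
    then have "tdeg p = d + tdeg c" using that(2) by (auto simp: tdeg_mult tdeg_f)
    then show False using tdeg_homogeneous[OF that(1,2)] that(3) by simp
  qed
  have f_q: "\<not> f dvd q" by (rule f_not_dvd[OF hom(2) q0]) (use deg in auto)
  obtain i where i: "v i \<noteq> 0" using v(1) by (auto simp: nzvecs_def)
  then have "i \<le> n" using v(1) by (auto simp: nzvecs_def vecs_def)
  \<comment> \<open>The numerator \<open>A * mvar 0\<close> has degree d - 1 = k + m. A power of a
    coordinate nonzero at \<open>v\<close> raises the degree of the denominator from k to k + m
    without affecting regularity at \<open>v\<close>.\<close>
  define l where "l = (mvar i :: (nat, 'k) mpoly) ^ m"
  have l: "l \<in> polys {..n}" "homogeneous m l" "meval v l \<noteq> 0"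
    using homogeneous_power[OF homogeneous_mvar, of m i] \<open>i \<le> n\<close> i
    by (auto simp: l_def intro: polys_power)
  have f_l: "\<not> f dvd l" by (rule not_dvd[OF fv l(3)])
  \<comment> \<open>Otherwise \<open>q\<close> divides \<open>f\<close>, which contradicts primality
    of \<open>f\<close> since \<open>f\<close> has larger degree. This also excludes
    \<open>A = 0\<close>, hence the case \<open>d = 2\<close>.\<close>
  have q_A: "\<not> q dvd A"
  proof
    assume "q dvd A"
    then have "q dvd A * mvar 0 ^ 2" by (rule dvd_mult2)
    moreover have "q dvd w * q * mvar 0" "q dvd r * q ^ 2" by (simp_all add: power2_eq_square)
    ultimately have "q dvd f" unfolding f_eq by (intro dvd_add)
    then obtain c where c: "f = q * c" by (rule dvdE)
    then have "f dvd q \<or> f dvd c" using f_prime prime_elem_dvd_mult_iff by (metis dvd_refl)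
    then obtain b where b: "c = f * b" using f_q by (auto elim: dvdE)
    have "f = q * (f * b)" unfolding b[symmetric] by (rule c)
    then have "f * 1 = f * (q * b)" by (metis mult.left_commute mult.right_neutral)
    then have "q * b = 1" using f_prime by (metis mult_left_cancel not_prime_elem_zero)
    then have "q dvd 1" by (metis dvd_triv_left)
    then show False using q_irr by (simp add: irreducible_def)
  qed
  \<comment> \<open>Since \<open>q\<close> is free of z_0, a relation z_0 = q c forces z_0 to divide
    c, making \<open>q\<close> a unit.\<close>
  have q_z: "\<not> q dvd mvar 0"
  proof
    assume "q dvd mvar 0"
    then have "sub0 0 q dvd sub0 0 (mvar 0)" by (rule rhom.dvd[OF rhom_sub0])
    moreover obtain c where c: "mvar 0 = q * c" using \<open>q dvd mvar 0\<close> by (rule dvdE)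
    ultimately have "q * sub0 0 c = 0" using q_free by (metis sub0_hom(2) sub0_mvar)
    then have "mvar 0 dvd c" using q0 by (simp add: mvar_dvd_iff)
    then obtain b where b: "c = mvar 0 * b" by (rule dvdE)
    have "mvar 0 = q * (mvar 0 * b)" unfolding b[symmetric] by (rule c)
    then have "mvar 0 * 1 = mvar 0 * (q * b)" by (metis mult.left_commute mult.right_neutral)
    then have "q * b = 1" by (metis mult_left_cancel mvar_neq_0)
    then have "q dvd 1" by (metis dvd_triv_left)
    then show False using q_irr by (simp add: irreducible_def)
  qed
  define h where "h = ratio n (A * mvar 0) (q * l)"
  have degs: "d - 2 + 1 = d - 1" "k + m = d - 1" "d - 2 + (d - 2 * k) = 2 * m" "m * 2 = 2 * m"
    using deg by auto
  have homs: "homogeneous (d - 1) (A * mvar 0)" "homogeneous (d - 1) (q * l)"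
    "homogeneous (2 * m) (A * r)" "homogeneous (2 * m) (l ^ 2)"
    using homogeneous_mult[OF hom(1) homogeneous_mvar[of 0]] homogeneous_mult[OF hom(2) l(2)]
      homogeneous_mult[OF hom(1) hom(4)] homogeneous_power[OF l(2), of 2]
    unfolding degs by auto
  have pols: "A * mvar 0 \<in> polys {..n}" "q * l \<in> polys {..n}" "A * r \<in> polys {..n}" "l ^ 2 \<in> polys {..n}"
    using vars l by (auto intro!: polys_intros)
  have f_ql: "\<not> f dvd q * l" using f_q f_l f_prime by (simp add: prime_elem_dvd_mult_iff)
  have hval: "h (pt u) = meval u A * u 0 / (meval u q * meval u l)" if "u \<in> nzvecs n" for u
    using ratio_pt[OF homs(1,2) that] by (simp add: h_def)
  have "rational_fun n X h"
    unfolding rational_fun_def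
  proof (intro exI conjI ballI)
    show "zariski_open n X (basic_open (q * l))" by (rule basic_open_open[OF pols(2) homs(2)])
    obtain u where "u \<in> nzvecs n" "meval u f = 0" "meval u (q * l) \<noteq> 0"
      using generic_point[OF pols(2) f_ql] .
    then show "basic_open (q * l) \<noteq> {}" using pt_in_basic_open[OF homs(2)] by blast
    fix y assume y: "y \<in> basic_open (q * l)"
    obtain u where "u \<in> nzvecs n" "y = pt u" "meval u f = 0"
      using y X_cases[of y] by (auto simp: basic_open_def)
    then show "regular_at n X y h"
      unfolding h_def using y pt_in_basic_open[OF homs(2)]
      by (auto intro!: regular_at_ratio[OF pols(1,2) homs(1,2)])
  qed
  moreover have "integral_over_local_ring n X (pt v) h"
    unfolding integral_over_local_ring_def
  proof (intro exI conjI allI impI)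
    \<comment> \<open>The coefficients of y^2 + w y + A r after replacing y by h l: the linear one
      is divided by \<open>l\<close>, the constant one by \<open>l ^ 2\<close>.\<close>
    let ?c = "\<lambda>j::nat. if j = 0 then ratio n (A * r) (l ^ 2) else ratio n w l"
    show "regular_at n X (pt v) (?c j)" if "j < 2" for j
      using regular_at_ratio[OF pols(3,4) homs(3,4) v(1) fv] regular_at_ratio[OF vars(3) l(1) hom(3) l(2) v(1) fv] l(3)
      by auto
    show "rational_eq n X (\<lambda>y. h y ^ 2 + (\<Sum>j<2. ?c j y * h y ^ j)) (\<lambda>_. 0)"
    proof (rule rational_eqI[OF pols(2) homs(2) f_ql])
      fix u assume u: "u \<in> nzvecs n" "meval u f = 0" "meval u (q * l) \<noteq> 0"
      let ?A = "meval u A" and ?q = "meval u q" and ?l = "meval u l" and ?w = "meval u w"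
        and ?r = "meval u r" and ?z = "u 0"
      have nz: "?q \<noteq> 0" "?l \<noteq> 0" using u by auto
      have sum2: "(\<Sum>j<2. F j) = F 0 + F 1" for F :: "nat \<Rightarrow> 'k" by (simp add: numeral_2_eq_2)
      have c0: "ratio n (A * r) (l ^ 2) (pt u) = ?A * ?r / ?l ^ 2"
        using ratio_pt[OF homs(3,4) u(1)] by simp
      have c1: "ratio n w l (pt u) = ?w / ?l" by (rule ratio_pt[OF hom(3) l(2) u(1)])
      have "h (pt u) ^ 2 + (\<Sum>j<2. ?c j (pt u) * h (pt u) ^ j)
          = (?A * ?z / (?q * ?l)) ^ 2 + (?A * ?r / ?l ^ 2 + ?w / ?l * (?A * ?z / (?q * ?l)))"
        unfolding sum2 by (simp add: hval[OF u(1)] c0 c1)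
      also have "\<dots> = ?A * (?A * ?z ^ 2 + ?w * ?q * ?z + ?r * ?q ^ 2) / (?q ^ 2 * ?l ^ 2)"
        using nz by (simp add: field_simps power2_eq_square)
      also have "\<dots> = 0" using u(2) by (simp add: f_eq)
      finally show "h (pt u) ^ 2 + (\<Sum>j<2. ?c j (pt u) * h (pt u) ^ j) = 0" .
    qed
  qed
  moreover have "pt v \<in> X" using pt_in_X[OF v(1)] fv by simp
  ultimately have "in_local_ring n X (pt v) h" using normal unfolding normal_variety_def by blast
  then obtain g where g: "regular_at n X (pt v) g" "rational_eq n X h g" unfolding in_local_ring_def by blast
  obtain Q G H where Q: "Q \<in> polys {..n}" "meval v Q \<noteq> 0" and GH: "G \<in> polys {..n}" "H \<in> polys {..n}"
    and gval: "\<And>u. u \<in> nzvecs n \<Longrightarrow> meval u f = 0 \<Longrightarrow> meval u Q \<noteq> 0 \<Longrightarrow>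
      meval u H \<noteq> 0 \<and> g (pt u) = meval u G / meval u H"
    using regular_at_basic[OF g(1) v(1)] by metis
  obtain Q' where Q': "Q' \<in> polys {..n}" "\<not> f dvd Q'"
    and hg: "\<And>u. u \<in> nzvecs n \<Longrightarrow> meval u f = 0 \<Longrightarrow> meval u Q' \<noteq> 0 \<Longrightarrow> h (pt u) = g (pt u)"
    using rational_eqD[OF g(2)] by metis
  have "f dvd A * mvar 0 * H - G * q * l"
  proof (rule generic_zero)
    show "A * mvar 0 * H - G * q * l \<in> polys {..n}" "Q * Q' * (q * l) \<in> polys {..n}"
      using vars GH l Q Q' by (auto intro!: polys_intros)
    show "\<not> f dvd Q * Q' * (q * l)"
      using not_dvd[OF fv Q(2)] Q' f_ql f_prime by (simp add: prime_elem_dvd_mult_iff[OF f_prime])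
    fix u assume u: "u \<in> nzvecs n" "meval u f = 0" "meval u (Q * Q' * (q * l)) \<noteq> 0"
    then have "meval u A * u 0 / (meval u q * meval u l) = meval u G / meval u H" "meval u H \<noteq> 0"
      using hval gval[of u] hg[of u] by auto
    then show "meval u (A * mvar 0 * H - G * q * l) = 0"
      using u(3) by (simp add: field_simps)
  qed
  then obtain B where B: "A * mvar 0 * H - G * q * l = f * B" by (rule dvdE)
  \<comment> \<open>Modulo \<open>q\<close> the equation \<open>f\<close> is
    \<open>A * mvar 0 ^ 2\<close>, so \<open>q\<close> divides
    \<open>A * mvar 0 * (H - mvar 0 * B)\<close>. Cancelling \<open>A\<close> and z_0 and evaluating
    at \<open>v\<close>, where z_0 and \<open>q\<close> vanish, makes the denominator
    \<open>H\<close> vanish at \<open>v\<close>.\<close>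
  have "A * mvar 0 * (H - mvar 0 * B) = q * (G * l + (w * mvar 0 + r * q) * B)"
  proof -
    have "A * mvar 0 * H = f * B + G * q * l" using B by (simp add: algebra_simps)
    then show ?thesis by (simp add: f_eq algebra_simps power2_eq_square)
  qed
  then have "q dvd A * mvar 0 * (H - mvar 0 * B)" by (rule dvdI)
  then have "q dvd H - mvar 0 * B"
    using q_A q_z by (simp add: prime_elem_dvd_mult_iff[OF q_prime])
  then have "meval v q dvd meval v (H - mvar 0 * B)" by (rule rhom.dvd[OF rhom_meval])
  then have "meval v H = 0" by (simp add: v)
  then show False using gval[OF v(1) fv Q(2)] by simp
qed

section \<open>Degree and dimension bounds\<close>

text \<open>\<open>f\<close> and the irreducible equation \<open>F\<close> are related only through
  their common zero set. If z_0 divided \<open>f\<close>, then \<open>F\<close> would vanish on the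
  hyperplane z_0 = 0 and hence be a multiple of z_0, so it would have degree 1.\<close>

lemma not_mvar_dvd_equation:
  fixes f :: "(nat, 'k::field_char_0) mpoly"
  assumes hyp: "hypersurface n d X" "\<not> hyperplane n X" "X = proj_zeros n {f}" and n: "1 \<le> n"
    and hom: "homogeneous d f"
  shows "2 \<le> d" "\<not> mvar 0 dvd f"
proof -
  obtain F where F: "mvars F \<subseteq> {..n}" "homogeneous d F" "irreducible F" "X = proj_zeros n {F}"
    using hyp(1) unfolding hypersurface_def by blast
  have F0: "F \<noteq> 0" using F by auto
  have tF: "tdeg F = d" by (rule tdeg_homogeneous[OF F(2) F0])
  have "d \<noteq> 0" using F(3) F0 tF by (auto simp: irreducible_def dvd_1_iff_tdeg)
  moreover have "d \<noteq> 1" using hyp by (auto simp: hyperplane_def)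
  ultimately show d: "2 \<le> d" by simp
  show "\<not> mvar 0 dvd f"
  proof
    assume dvd: "mvar 0 dvd f"
    have "sub0 0 F = 0"
    proof (rule mpoly_eqI_nonzero[of "{1..n}" 1])
      have "{..n} - {0} = {1..n}" by auto
      then show "sub0 0 F \<in> polys {1..n}" using sub0_polys[of F "{..n}" 0] F(1) by (simp add: polys_def)
      \<comment> \<open>The condition on \<open>v 1\<close> ensures that \<open>v\<close> represents
        a point of projective space.\<close>
      fix v :: "nat \<Rightarrow> 'k" assume v: "v \<in> vecs {1..n}" "v 1 \<noteq> 0"
      then have nz: "v \<in> nzvecs n" and v0: "v 0 = 0" by (auto simp: nzvecs_def vecs_def)
      have "meval v f = 0" using rhom.dvd[OF rhom_meval dvd, of v] v0 by simp
      then have "pt v \<in> X" unfolding hyp(3) using pt_in_proj_zeros[of "{f}" v n] nz hom by blast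
      then have "meval v F = 0" unfolding F(4) using pt_in_proj_zeros[of "{F}" v n] nz F(2) by blast
      then show "meval v (sub0 0 F) = meval v 0" by (simp add: meval_sub0 v0)
    qed (use n in auto)
    then have "mvar 0 dvd F" by (simp add: mvar_dvd_iff)
    then obtain c where c: "F = mvar 0 * c" by (rule dvdE)
    have "\<not> mvar 0 dvd (1 :: (nat, 'k) mpoly)" using prime_elem_mvar unfolding prime_elem_def by blast
    then have "c dvd 1" using F(3) c by (auto simp: irreducible_def)
    then have "c \<noteq> 0" "tdeg c = 0" by (auto simp: dvd_1_iff_tdeg)
    then have "tdeg F = 1" using tdeg_homogeneous[OF homogeneous_mvar[of 0]] by (simp add: c tdeg_mult)
    then show False using tF d by simp
  qed
qed

text \<open>For \<open>n = 1\<close> the hyperplane \<open>U\<close> is 0 and generates only the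
  scalars, so \<open>M\<close> would be 0. The bound is what provides a point with z_0 = q = 0 in
  the converse direction.\<close>

lemma (in H_pair) two_le_dim:
  assumes n: "dim UNIV = n + 1" and basis: "indexed_basis scale {1..n} e M"
    and proj: "quotient_projection scale M U \<pi>"
  shows "2 \<le> n"
proof (rule ccontr)
  assume "\<not> 2 \<le> n"
  obtain e' where e': "1 \<le> n" "indexed_basis scale {1..n} e' M" "\<pi> (e' n) = 1"
    using adapted_basis_exists[OF n basis proj] by metis
  then have "n = 1" using \<open>\<not> 2 \<le> n\<close> by simp
  obtain B where "finite_dimensional_vector_space scale B" by (rule obtain_finite_basis)
  then interpret fd: finite_dimensional_vector_space scale B .
  have "dim M = 1"
    using basis dim_span_eq_card_independent[of "e ` {1..n}"] \<open>n = 1\<close>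
    by (auto simp: indexed_basis_def card_image)
  then have "dim U = 0" using codim_U by simp
  then have "U \<subseteq> {0}" by (simp only: fd.dim_eq_0)
  let ?K = "range (\<lambda>c. scale c 1)"
  have "subalgebra ?K"
    unfolding subalgebra_def
  proof (intro conjI ballI)
    show "subspace ?K"
      unfolding subspace_def
    proof (intro conjI ballI allI)
      show "0 \<in> ?K" by (rule range_eqI[of _ _ 0]) simp
      fix x y c assume "x \<in> ?K" "y \<in> ?K"
      then obtain a b where ab: "x = scale a 1" "y = scale b 1" by blast
      show "x + y \<in> ?K" unfolding ab scale_left_distrib[symmetric] by blast
    next
      fix x c assume "x \<in> ?K"
      then obtain a where "x = scale a 1" by blast
      then show "scale c x \<in> ?K" by auto
    qed
    show "1 \<in> ?K" by (rule range_eqI[of _ _ 1]) simp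
    fix x y assume "x \<in> ?K" "y \<in> ?K"
    then obtain a b where "x = scale a 1" "y = scale b 1" by blast
    then show "x * y \<in> ?K" by (auto simp: scale_mult)
  qed
  moreover have "U \<subseteq> ?K" using \<open>U \<subseteq> {0}\<close> by (auto intro!: range_eqI[of _ _ 0])
  ultimately have "?K = UNIV" using generates hull_minimal[of U ?K subalgebra] by auto
  have "M \<subseteq> {0}"
  proof
    fix x assume x: "x \<in> M"
    obtain c where c: "x = scale c 1" using \<open>?K = UNIV\<close> by blast
    have "c = 0"
    proof (rule ccontr)
      assume "c \<noteq> 0"
      then have "1 = scale (1 / c) x" by (simp add: c)
      also have "\<dots> \<in> M" using x by (rule subspace_scale[OF M_subspace])
      finally show False using one_not_in_M by simp
    qed
    then show "x \<in> {0}" by (simp add: c)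
  qed
  then have "dim M = 0" by (simp only: fd.dim_eq_0)
  with \<open>dim M = 1\<close> show False by simp
qed

theorem proposition3:
  fixes scale :: "'k::{alg_closed_field, field_char_0} \<Rightarrow> 'a::comm_ring_1 \<Rightarrow> 'a"
    and M U :: "'a set"
    and \<pi> :: "'a \<Rightarrow> 'k"
    and n d s :: nat
    and e :: "nat \<Rightarrow> 'a"
    and X :: "'k point set"
    and \<alpha> :: "(nat \<Rightarrow> 'k) \<Rightarrow> 'k point \<Rightarrow> 'k point"
    and f g :: "(nat, 'k) mpoly"
    and F p :: "nat \<Rightarrow> (nat, 'k) mpoly"
    and a :: "nat \<Rightarrow> nat"
  assumes hypersurface: "hypersurface n d X"
    and not_hyperplane: "\<not> hyperplane n X"
    and action: "induced_additive_action n X \<alpha>"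
    and H_pair: "H_pair scale M U"
    and dim_A: "vector_space.dim scale (UNIV :: 'a set) = n + 1"
    and basis: "indexed_basis scale {1..n} e M"
    and corresponds: "corresponds_to_H_pair scale U n e X \<alpha>"
    and projection: "quotient_projection scale M U \<pi>"
    and f_vars: "mvars f \<subseteq> {..n}"
    and f_eq: "\<And>z. z \<in> vecs {..n} \<Longrightarrow> z 0 \<noteq> 0 \<Longrightarrow>
      meval z f = z 0 ^ d * \<pi> (nil_ln1p scale (scale (1 / z 0) (m_part scale n e z)))"
    and X_eq: "X = proj_zeros n {f}"
    and f_decomposition: "f = (\<Sum>k = 1..d. mvar 0 ^ (d - k) * F k)"
    and F_vars: "\<And>k. k \<in> {1..d} \<Longrightarrow> mvars (F k) \<subseteq> {1..n}"
    and F_homogeneous: "\<And>k. k \<in> {1..d} \<Longrightarrow> homogeneous k (F k)"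
    and factorization: "F d = (\<Prod>i = 1..s. p i ^ a i)"
    and p_vars: "\<And>i. i \<in> {1..s} \<Longrightarrow> mvars (p i) \<subseteq> {1..n}"
    and p_irreducible: "\<And>i. i \<in> {1..s} \<Longrightarrow> irreducible (p i)"
    and p_distinct: "\<And>i j. i \<in> {1..s} \<Longrightarrow> j \<in> {1..s} \<Longrightarrow> i \<noteq> j \<Longrightarrow> \<not> (p i dvd p j \<and> p j dvd p i)"
    and a_pos: "\<And>i. i \<in> {1..s} \<Longrightarrow> 0 < a i"
    and g_eq: "F d = g * (\<Prod>i = 1..s. p i)"
  shows "normal_variety n X \<longleftrightarrow> mcoprime g (F (d - 1))"
proof -
  let ?z = "mvar 0 :: (nat, 'k) mpoly"
  interpret H: H_pair scale M U by (rule H_pair)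
  have n2: "2 \<le> n" by (rule H.two_le_dim[OF dim_A basis projection])
  have f_pol: "f \<in> polys {..n}" using f_vars by (simp add: polys_def)
  have F_pol: "F k \<in> polys {1..n}" if "k \<in> {1..d}" for k
    using F_vars[OF that] by (simp add: polys_def)
  have f_hom: "homogeneous d f"
    unfolding f_decomposition
  proof (rule homogeneous_sum)
    fix k assume k: "k \<in> {1..d}"
    have "homogeneous (1 * (d - k) + k) (?z ^ (d - k) * F k)"
      by (intro homogeneous_mult homogeneous_power homogeneous_mvar F_homogeneous[OF k])
    then show "homogeneous d (?z ^ (d - k) * F k)" using k by simp
  qed
  have n1: "1 \<le> n" using n2 by simp
  have d2: "2 \<le> d" and not_dvd: "\<not> ?z dvd f"
    using not_mvar_dvd_equation[OF hypersurface not_hyperplane X_eq n1 f_hom] by auto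
  have f_nz: "f \<noteq> 0" using not_dvd by auto

  obtain e' where e': "indexed_basis scale {1..n} e' M"
    "\<And>i. i \<in> {1..<n} \<Longrightarrow> \<pi> (e' i) = 0" "\<pi> (e' n) = 1"
    using H.adapted_basis_exists[OF dim_A basis projection] by metis
  interpret P: parametrization scale M n e e' \<pi> d f
  proof (intro parametrization.intro exp_algebra.intro H.based_algebraI[OF dim_A] basis e'
      parametrization_axioms.intro n1 f_pol f_eq not_dvd)
    show "\<pi> (x + y) = \<pi> x + \<pi> y" if "x \<in> M" "y \<in> M" for x y
      using projection that by (auto simp: quotient_projection_def)
    show "\<pi> (scale c x) = c * \<pi> x" if "x \<in> M" for c x
      using projection that by (auto simp: quotient_projection_def)
  qed
  obtain \<Psi> :: "(nat, 'k) mpoly \<Rightarrow> (nat, 'k) mpoly" where \<Psi>: "rhom \<Psi>" "\<Psi> ?z = ?z"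
    "\<forall>c. \<Psi> (mconst c) = mconst c" "\<forall>P\<in>polys {..n}. \<Psi> P = 0 \<longleftrightarrow> f dvd P" "\<forall>P. \<Psi> P \<in> polys {..<n}"
    "\<forall>t\<in>polys {..<n}. \<exists>N. \<exists>G\<in>polys {..n}. \<Psi> G = ?z ^ N * t"
    using P.restriction_to_orbit by (elim exE conjE)
  interpret R: orbit_restriction n f \<Psi>
    by (rule orbit_restriction.intro) (use \<Psi> n1 f_pol f_nz in auto)
  interpret X: prime_hypersurface n d f X
    by unfold_locales (use f_pol f_hom R.f_prime X_eq R.nullstellensatz in auto)

  \<comment> \<open>For \<open>d = 2\<close> the sum is empty and \<open>A = 0\<close>;
    \<open>D\<close> restricts to \<open>F (d - 1)\<close> on z_0 = 0.\<close>
  define A where "A = (\<Sum>k = 1..d - 2. ?z ^ (d - 2 - k) * F k)"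
  define D where "D = F (d - 1) + ?z * A"
  have f_D: "f = F d + ?z * D"
  proof -
    have "{1..d} = insert d (insert (d - 1) {1..d - 2})" using d2 by auto
    moreover have "(\<Sum>k = 1..d - 2. ?z ^ (d - k) * F k) = ?z ^ 2 * A"
      unfolding A_def sum_distrib_left
    proof (rule sum.cong[OF refl])
      fix k assume "k \<in> {1..d - 2}"
      then have "d - k = 2 + (d - 2 - k)" by auto
      then show "?z ^ (d - k) * F k = ?z ^ 2 * (?z ^ (d - 2 - k) * F k)"
        by (simp only: power_add mult.assoc)
    qed
    moreover have "d \<notin> insert (d - 1) {1..d - 2}" "d - 1 \<notin> {1..d - 2}" "d - (d - 1) = 1"
      using d2 by auto
    ultimately have "f = ?z ^ (d - d) * F d + (?z ^ 1 * F (d - 1) + ?z ^ 2 * A)"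
      unfolding f_decomposition by (simp only: sum.insert finite_insert finite_atLeastAtMost simp_thms)
    then show ?thesis by (simp add: D_def algebra_simps power2_eq_square)
  qed
  have Fd_pol: "F d \<in> polys {1..n}" and Fd1_pol: "F (d - 1) \<in> polys {1..n}"
    using F_pol d2 by auto
  have Fd_free: "sub0 0 (F d) = F d" and Fd1_free: "sub0 0 (F (d - 1)) = F (d - 1)"
    using sub0_ident[OF Fd_pol] sub0_ident[OF Fd1_pol] by auto
  have Fd_nz: "F d \<noteq> 0"
    using not_dvd Fd_free by (auto simp: mvar_dvd_iff f_D)
  have p_prime: "prime_elem (p i)" if "i \<in> {1..s}" for i
    by (rule irreducible_imp_prime_elem_mpoly[OF p_irreducible[OF that]])
  \<comment> \<open>Between irreducible elements divisibility in one direction already means being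
    associate.\<close>
  have p_not_dvd: "\<not> p i dvd p j" if ij: "i \<in> {1..s}" "j \<in> {1..s}" "i \<noteq> j" for i j
  proof
    assume dvd: "p i dvd p j"
    then obtain c where c: "p j = p i * c" by (rule dvdE)
    have "\<not> p i dvd 1" using p_irreducible[OF ij(1)] by (simp add: irreducible_def)
    then have "c dvd 1" using p_irreducible[OF ij(2)] c by (auto simp: irreducible_def)
    then obtain b where b: "1 = c * b" by (rule dvdE)
    have "p i = p j * b" unfolding c mult.assoc b[symmetric] by simp
    then have "p j dvd p i" by (rule dvdI)
    then show False using p_distinct[OF ij] dvd by blast
  qed

  show ?thesis
  proof
    assume coprime: "mcoprime g (F (d - 1))"
    \<comment> \<open>Division by the product of the primes removes each of them just once, so the
      multiple factors of \<open>F d\<close> remain in \<open>g\<close>.\<close>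
    have p_dvd_g: "p i dvd g" if i: "i \<in> {1..s}" and ai: "2 \<le> a i" for i
    proof -
      let ?R = "\<Prod>j\<in>{1..s} - {i}. p j"
      have "p i ^ 2 dvd p i ^ a i" by (rule le_imp_power_dvd[OF ai])
      also have "p i ^ a i dvd F d" unfolding factorization using i by (intro dvd_prodI) auto
      also have "F d = p i * (g * ?R)"
        unfolding g_eq prod.remove[OF finite_atLeastAtMost i, of p] by (simp add: ac_simps)
      finally have "p i * p i dvd p i * (g * ?R)" by (simp add: power2_eq_square)
      then have "p i dvd g * ?R" using p_prime[OF i] by auto
      moreover have "\<not> p i dvd ?R"
      proof
        assume "p i dvd ?R"
        then obtain j where "j \<in> {1..s} - {i}" "p i dvd p j"
          using prime_elem_prod[OF p_prime[OF i], of p "{1..s} - {i}"] by blast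
        then show False using p_not_dvd[OF i] by blast
      qed
      ultimately show ?thesis using p_prime[OF i] by (simp add: prime_elem_dvd_mult_iff)
    qed
    show "normal_variety n X"
    proof (rule X.normalI)
      fix v :: "nat \<Rightarrow> 'k" and r C G0 H0
      assume v: "v \<in> nzvecs n" "meval v f = 0" and C: "\<And>i. i \<le> r \<Longrightarrow> C i \<in> polys {..n}"
        and GH: "G0 \<in> polys {..n}" "H0 \<in> polys {..n}"
        and int: "f dvd (\<Sum>i\<le>r. C i * G0 ^ i * H0 ^ (r - i))"
        and H0: "\<not> f dvd H0" and Cr: "meval v (C r) \<noteq> 0"
      have "(\<Sum>i\<le>r. C i * G0 ^ i * H0 ^ (r - i)) \<in> polys {..n}"
        using C GH by (auto intro!: polys_intros)
      then obtain N G where NG: "f dvd ?z ^ N * C r * G0 - H0 * G"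
        using R.denominator_on_orbit[OF C GH _ int H0] by blast
      have "\<exists>T G. meval v T \<noteq> 0 \<and> f dvd T * G0 - H0 * G"
      proof (cases "v 0 = 0")
        case True
        interpret I: initial_form 0 f "F d" D "{1..s}" p a v
        proof unfold_locales
          show "sub0 0 (p i) = p i" if "i \<in> {1..s}" for i
            using sub0_ident[of "p i" "{1..n}" 0] p_vars[OF that] by (simp add: polys_def)
          show "\<not> p i dvd sub0 0 D" if i: "i \<in> {1..s}" "2 \<le> a i" for i
          proof
            assume "p i dvd sub0 0 D"
            then have "p i dvd F (d - 1)" using Fd1_free by (simp add: D_def)
            then have "p i dvd 1" using coprime p_dvd_g[OF i] unfolding mcoprime_def by blast
            then show False using p_irreducible[OF i(1)] by (simp add: irreducible_def)
          qed
        qed (use R.f_prime f_D Fd_free Fd_nz factorization p_prime p_not_dvd a_pos True in auto)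
        \<comment> \<open>\<open>C r\<close> serves both as leading coefficient of the integral
          equation and as the initial denominator \<open>T\<close>.\<close>
        show ?thesis by (rule I.denominator_exists[OF int H0 Cr Cr NG])
      next
        \<comment> \<open>Off the hyperplane z_0 = 0 the denominator \<open>?z ^ N * C r\<close>
          found on the orbit already works.\<close>
        case False
        then have "meval v (?z ^ N * C r) \<noteq> 0" using Cr by simp
        then show ?thesis using NG by blast
      qed
      then obtain T G where TG: "meval v T \<noteq> 0" "f dvd T * G0 - H0 * G" by blast
      \<comment> \<open>\<open>T\<close> and \<open>G\<close> may contain variables beyond z_n;
        setting these to 0 preserves the divisibility and the value of \<open>T\<close> at
        \<open>v\<close>, whose further coordinates are 0.\<close>
      define \<rho> where "\<rho> = subst (\<lambda>i. if i \<le> n then mvar i else 0 :: (nat, 'k) mpoly)"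
      have \<rho>_id: "\<rho> P = P" if "P \<in> polys {..n}" for P
        unfolding \<rho>_def by (rule subst_ident[OF that]) auto
      have \<rho>_pol: "\<rho> P \<in> polys {..n}" for P
        unfolding \<rho>_def by (rule polys_subst[OF polys_mono[OF subset_UNIV polys_mvars]]) auto
      have "meval v (\<rho> T) = meval v T"
      proof -
        have "(\<lambda>i. meval v (if i \<le> n then mvar i else 0 :: (nat, 'k) mpoly)) = v"
          using v(1) by (auto simp: nzvecs_def vecs_def)
        then show ?thesis unfolding \<rho>_def meval_subst by simp
      qed
      moreover have "f dvd \<rho> T * G0 - H0 * \<rho> G"
      proof -
        have "\<rho> f dvd \<rho> (T * G0 - H0 * G)"
          unfolding \<rho>_def by (rule rhom.dvd[OF rhom_subst TG(2)])
        also have "\<rho> (T * G0 - H0 * G) = \<rho> T * \<rho> G0 - \<rho> H0 * \<rho> G" by (simp add: \<rho>_def)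
        finally show ?thesis by (simp add: \<rho>_id f_pol GH)
      qed
      ultimately show "\<exists>T\<in>polys {..n}. \<exists>G\<in>polys {..n}. meval v T \<noteq> 0 \<and> f dvd T * G0 - H0 * G"
        using TG(1) \<rho>_pol by metis
    qed
  next
    assume normal: "normal_variety n X"
    show "mcoprime g (F (d - 1))"
    proof (rule ccontr)
      assume "\<not> mcoprime g (F (d - 1))"
      then obtain c where c: "c dvd g" "c dvd F (d - 1)" "\<not> c dvd 1" unfolding mcoprime_def by blast
      have "g \<noteq> 0" using Fd_nz g_eq by auto
      then have "c \<noteq> 0" using c(1) by auto
      then obtain q where q: "irreducible q" "q dvd c" using irreducible_divisor_exists c(3) by blast
      have q_prime: "prime_elem q" by (rule irreducible_imp_prime_elem_mpoly[OF q(1)])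
      have qg: "q dvd g" by (rule dvd_trans[OF q(2) c(1)])
      \<comment> \<open>A prime divisor of \<open>g\<close> divides some \<open>p i\<close>, hence
        also the product of all \<open>p i\<close>; together with the factor in \<open>g\<close>
        this gives the square of \<open>q\<close> in \<open>F d\<close>.\<close>
      then have qF: "q dvd F d" unfolding g_eq by (rule dvd_mult2)
      then obtain i where "i \<in> {1..s}" "q dvd p i"
        using prime_elem_prod[OF q_prime, of "\<lambda>i. p i ^ a i"] prime_elem_power[OF q_prime]
        unfolding factorization by blast
      then have "q dvd (\<Prod>i = 1..s. p i)" by (meson dvd_prodI dvd_trans finite_atLeastAtMost)
      then have "q * q dvd F d" unfolding g_eq using qg by (intro mult_dvd_mono)
      then obtain r where r: "F d = q * q * r" by (rule dvdE)
      obtain w where w: "F (d - 1) = q * w" using dvd_trans[OF q(2) c(2)] by (rule dvdE)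
      have nz: "q \<noteq> 0" "r \<noteq> 0" using Fd_nz r by auto
      define k where "k = tdeg q"
      have homd: "homogeneous d (F d)" and homd1: "homogeneous (d - 1) (F (d - 1))"
        using F_homogeneous d2 by auto
      have hq: "homogeneous k q" and hr: "homogeneous (tdeg r) r"
        using homogeneous_factor[of d q "q * r"] homogeneous_factor[of d r "q * q"] homd nz
        by (simp_all add: r k_def ac_simps)
      have td: "d = k + k + tdeg r"
        using tdeg_homogeneous[OF homd Fd_nz] nz by (simp add: r tdeg_mult k_def)
      have k0: "0 < k" using q(1) nz by (auto simp: k_def irreducible_def dvd_1_iff_tdeg)
      \<comment> \<open>\<open>F (d - 1)\<close> may be 0; then \<open>w = 0\<close> is homogeneous
        of every degree.\<close>
      have hw: "homogeneous (d - 1 - k) w"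
      proof (cases "w = 0")
        case False
        then have qw: "q * w \<noteq> 0" "w * q \<noteq> 0" using nz by auto
        have "tdeg (q * w) = d - 1" by (rule tdeg_homogeneous[OF homd1[unfolded w] qw(1)])
        then have "d - 1 = k + tdeg w" using nz False by (simp add: tdeg_mult k_def)
        moreover have "homogeneous (tdeg w) w"
          by (rule homogeneous_factor[OF homd1[unfolded w mult.commute[of q]] qw(2)])
        ultimately show ?thesis by simp
      qed simp
      have hA: "homogeneous (d - 2) A"
        unfolding A_def
      proof (rule homogeneous_sum)
        fix j assume j: "j \<in> {1..d - 2}"
        have "homogeneous (1 * (d - 2 - j) + j) (?z ^ (d - 2 - j) * F j)"
          by (intro homogeneous_mult homogeneous_power homogeneous_mvar F_homogeneous) (use j in auto)
        moreover have "1 * (d - 2 - j) + j = d - 2" using j unfolding atLeastAtMost_iff by linarith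
        ultimately show "homogeneous (d - 2) (?z ^ (d - 2 - j) * F j)" by metis
      qed
      have q_pol: "q \<in> polys {1..n}" by (rule polys_dvd[OF qF Fd_pol Fd_nz])
      have r_pol: "r \<in> polys {1..n}" using polys_dvd[OF _ Fd_pol Fd_nz, of r] by (simp add: r)
      have w_pol: "w \<in> polys {1..n}"
      proof (cases "w = 0")
        case False
        then show ?thesis
          using nz by (intro polys_factor[OF Fd1_pol[unfolded w mult.commute[of q]]]) simp
      qed simp
      have mono: "P \<in> polys {..n}" if "P \<in> polys {1..n}" for P :: "(nat, 'k) mpoly"
        using that by (rule polys_mono[rotated]) auto
      have A_pol: "A \<in> polys {..n}"
        unfolding A_def
      proof (intro polys_sum polys_mult)
        fix k assume "k \<in> {1..d - 2}"
        then have "k \<in> {1..d}" by auto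
        then show "F k \<in> polys {..n}" by (intro mono F_pol)
      qed (auto intro: polys_power)
      obtain v where v: "v \<in> nzvecs n" "v 0 = 0" "meval v q = 0"
        using homogeneous_zero_exists[OF hq k0 n2] by blast
      have "\<not> normal_variety n X"
      proof (rule X.not_normal[where A = A and q = q and w = w and r = r])
        show "f = A * ?z ^ 2 + w * q * ?z + r * q ^ 2"
          unfolding f_D D_def r w by (simp add: algebra_simps power2_eq_square)
        show "sub0 0 q = q" using sub0_ident[OF q_pol] by simp
        show "homogeneous (d - 2 * k) r" using hr td by (simp add: mult_2)
      qed (use A_pol q_pol w_pol r_pol mono q(1) hA hq hw v td k0 d2 in auto)
      then show False using normal by blast
    qed
  qed
qed

end
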